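(* Let $n \ge 10$ and let $C$ be a cubic form in $n$ variables as described in the context which satisfies Davenport's Geometric Condition. Then the singular series of $C$ is absolutely convergent, i.e. \[ \sum_{q=1}^{\infty} \sum_{\substack{a \bmod q\\ \gcd(a,q)=1}} \frac{|S(q,a)|}{q^n} < \infty . \] In particular, $\mathfrak{S} = \prod_p \chi_p$ and $\mathfrak{S} > 0$.
   Context: Let $C(\mathbf{x}) = \sum_{i,j,k=1}^n c_{ijk} x_i x_j x_k$ be a cubic form with integer coefficients $c_{ijk}$ that are symmetric in $i,j,k$. Let $M(\mathbf{x})$ be the $n\times n$ matrix with entries $M(\mathbf{x})_{jk} = \sum_{i=1}^n c_{ijk} x_i$, and $r(\mathbf{x})$ its rank over $\mathbb{Q}$. $C$ satisfies Davenport's Geometric Condition if for every integer $0 \le r \le n$ and every $\varepsilon>0$, $\#\{\mathbf{x} \in \mathbb{Z}^n : \|\mathbf{x}\|_\infty \le P,\ r(\mathbf{x}) = r\} \ll_{\varepsilon} P^{r+\varepsilon}$ for all $P\ge 1$. Write $e(x)=e^{2\pi i x}$ and define the Gauss sums $S(q,a) = \sum_{\mathbf{x} \bmod q} e(aC(\mathbf{x})/q)$, the singular series $\mathfrak{S} = \sum_{q\ge1}\sum_{\gcd(a,q)=1} S(q,a)/q^n$, and the $p$-adic densities $\chi_p = \sum_{k\ge 0}\sum_{a \bmod p^k,\ \gcd(a,p^k)=1} S(p^k,a)/p^{kn}$. *)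

theory Defs
  imports "HOL-Analysis.Analysis"
begin

definition cubic_form :: "('n::finite \<Rightarrow> 'n \<Rightarrow> 'n \<Rightarrow> int) \<Rightarrow> ('n \<Rightarrow> int) \<Rightarrow> int" where
  "cubic_form c x = (\<Sum>i\<in>UNIV. \<Sum>j\<in>UNIV. \<Sum>k\<in>UNIV. c i j k * x i * x j * x k)"

definition symmetric_coeffs :: "('n::finite \<Rightarrow> 'n \<Rightarrow> 'n \<Rightarrow> int) \<Rightarrow> bool" where
  "symmetric_coeffs c \<longleftrightarrow> (\<forall>i j k. c i j k = c j i k \<and> c i j k = c i k j)"

text \<open>The matrix M(x), with entries M(x)_{jk} = sum_i c_{ijk} x_i (as a real matrix;
  its rank over the reals equals its rank over the rationals since its entries are integers).\<close>

definition Mmat :: "('n::finite \<Rightarrow> 'n \<Rightarrow> 'n \<Rightarrow> int) \<Rightarrow> ('n \<Rightarrow> int) \<Rightarrow> real^'n^'n" where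
  "Mmat c x = (\<chi> j k. real_of_int (\<Sum>i\<in>UNIV. c i j k * x i))"

definition davenport_geometric :: "('n::finite \<Rightarrow> 'n \<Rightarrow> 'n \<Rightarrow> int) \<Rightarrow> bool" where
  "davenport_geometric c \<longleftrightarrow>
     (\<forall>r::nat. r \<le> CARD('n) \<longrightarrow> (\<forall>\<epsilon>>0. \<exists>K::real. \<forall>P::real. P \<ge> 1 \<longrightarrow>
        real (card {x :: 'n \<Rightarrow> int. (\<forall>i. real_of_int \<bar>x i\<bar> \<le> P) \<and> rank (Mmat c x) = r})
          \<le> K * P powr (real r + \<epsilon>)))"

definition e_fun :: "real \<Rightarrow> complex" where
  "e_fun t = exp (2 * pi * \<i> * complex_of_real t)"

definition gauss_sum :: "('n::finite \<Rightarrow> 'n \<Rightarrow> 'n \<Rightarrow> int) \<Rightarrow> nat \<Rightarrow> int \<Rightarrow> complex" where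
  "gauss_sum c q a = (\<Sum>x \<in> {x :: 'n \<Rightarrow> int. \<forall>i. x i \<in> {0..<int q}}.
       e_fun (real_of_int (a * cubic_form c x) / real q))"

definition sing_term :: "('n::finite \<Rightarrow> 'n \<Rightarrow> 'n \<Rightarrow> int) \<Rightarrow> nat \<Rightarrow> complex" where
  "sing_term c q = (\<Sum>a\<in>{a\<in>{0..<int q}. coprime a (int q)}. gauss_sum c q a / of_nat q ^ CARD('n))"

definition sing_abs_term :: "('n::finite \<Rightarrow> 'n \<Rightarrow> 'n \<Rightarrow> int) \<Rightarrow> nat \<Rightarrow> real" where
  "sing_abs_term c q = (\<Sum>a\<in>{a\<in>{0..<int q}. coprime a (int q)}. norm (gauss_sum c q a) / real q ^ CARD('n))"

definition singular_series :: "('n::finite \<Rightarrow> 'n \<Rightarrow> 'n \<Rightarrow> int) \<Rightarrow> complex" where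
  "singular_series c = (\<Sum>q. sing_term c (q + 1))"

definition padic_density :: "('n::finite \<Rightarrow> 'n \<Rightarrow> 'n \<Rightarrow> int) \<Rightarrow> nat \<Rightarrow> complex" where
  "padic_density c p = (\<Sum>k. sing_term c (p ^ k))"

end

theory Submission
  imports Defs "HOL-Number_Theory.Number_Theory" "HOL-Computational_Algebra.Polynomial_Factorial"
    "HOL-Computational_Algebra.Fundamental_Theorem_Algebra"
begin

text \<open>
  By multiplicativity everything reduces to prime powers. Weyl differencing with short shifts
  \<open>|h| < H\<close> bounds \<open>|S(q, a)|\<^sup>2\<close> by an average over \<open>h\<close> of the square root of the number of
  solutions of \<open>M(h) y = 0\<close> modulo \<open>q\<close>; that number is controlled by the rational rank of \<open>M(h)\<close>
  and a nonzero minor, and the geometric condition counts the \<open>h\<close> of each rank. With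
  \<open>H\<close> about \<open>q powr (1 / 3)\<close> this gives \<open>O(q powr (- 3 / 5))\<close> for the terms of the singular series,
  which settles the powers \<open>p ^ k\<close> with \<open>k \<ge> 2\<close>.

  For primes \<open>p \<approx> Z ^ 200\<close> one averages over \<open>p\<close> and takes the longer shifts \<open>H \<approx> Z ^ 82\<close>. A fixed
  matrix \<open>M(h)\<close> drops rank modulo very few large primes, so the only danger is a matrix of full
  rank over the rationals whose kernel modulo \<open>p\<close> has dimension above \<open>n - 7\<close>. On a line \<open>h + t v\<close> with
  \<open>det M(v) \<noteq> 0\<close> the polynomial \<open>det (M(h + t v) + x M(v))\<close> then has a root of multiplicity at least
  \<open>n - 6\<close> at \<open>x = 0\<close> modulo \<open>p\<close>; as \<open>n \<ge> 10\<close>, its responsible irreducible factor is at most quadratic,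
  and its value and discriminant can only vanish modulo boundedly many large primes for each line.

  Positivity: each p-adic density is positive because the form has a nonsingular p-adic zero. If
  it had none, every form modulo \<open>p\<close> would be anisotropic outside its radical, so by Chevalley
  three rescaling steps affect at most 9 of the \<open>n \<ge> 10\<close> variables and strictly lower the
  valuation of the Hessian forever.
\<close>

section \<open>Integer matrices modulo a prime\<close>

text \<open>The bound \<open>p powr (- 3 / 5)\<close> is not summable over primes, and the exponents
  of the averaging argument are dictated by what has to replace it. For \<open>p\<close> of size
  \<open>X = Z ^ 200\<close> Weyl differencing bounds the term at \<open>p\<close> by
  \<open>p * sqrt (V p)\<close>, where \<open>V p\<close> is \<open>H ^ (- n)\<close> times a sum of
  kernel weights. By the arithmetic-geometric mean inequality the total of \<open>V p\<close> over
  these primes has to be smaller than \<open>X ^ (- 3) = Z ^ (- 600)\<close>. Matrices of rank 0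
  alone contribute about \<open>X / H ^ n\<close>, so for \<open>n = 10\<close> the length
  \<open>H\<close> must exceed \<open>Z ^ 80\<close>; on the other hand the values of quadratic
  factors have size \<open>H ^ 2\<close> and must stay below \<open>p\<close>, so \<open>H\<close>
  must be below \<open>Z ^ 100\<close>. A prime dividing the chosen minor of a matrix of rank
  \<open>r\<close> leaves only the weight \<open>Z ^ (- 59 * r)\<close>. Together with the rarity
  \<open>Z ^ (- 82 * (n - r))\<close> of such matrices this suffices for all \<open>r < n\<close>,
  but for \<open>r = n = 10\<close> it gives only \<open>Z ^ (- 590)\<close>. This narrow failure is
  why full rank is treated by kernel dimension: a kernel of dimension at most \<open>n - 7\<close>
  has weight at most \<open>Z ^ (- 700)\<close>, and the pairs with a larger kernel are rarer by a
  factor \<open>H\<close>.\<close>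

definition real_mat :: "int^'n^'n \<Rightarrow> real^'n^'n" where
  "real_mat A = (\<chi> i j. real_of_int (A$i$j))"

definition real_vec :: "int^'n \<Rightarrow> real^'n" where
  "real_vec x = (\<chi> i. real_of_int (x$i))"

definition replace_col :: "'n \<Rightarrow> 'a^'n \<Rightarrow> 'a^'n^'n \<Rightarrow> 'a^'n^'n" where
  "replace_col j v A = (\<chi> i k. if k = j then v$i else A$i$k)"

definition ibox :: "int \<Rightarrow> (int^'n) set" where
  "ibox q = {x. \<forall>i. 0 \<le> x$i \<and> x$i < q}"

definition kerq :: "int \<Rightarrow> int^'n^'n \<Rightarrow> (int^'n) set" where
  "kerq q A = {y \<in> ibox q. \<forall>i. q dvd (A *v y)$i}"

lemma real_mat_mult_vec: "real_mat A *v real_vec x = real_vec (A *v x)"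
  by (simp add: real_mat_def real_vec_def matrix_vector_mult_def vec_eq_iff)

lemma det_real_mat: "det (real_mat A) = real_of_int (det A)"
  by (simp add: det_def real_mat_def)

lemma matrix_vector_mult_smult:
  "A *v (c *s x) = c *s (A *v x)" for A :: "'a::comm_semiring_1^'n^'m"
  by (simp add: matrix_vector_mult_def vec_eq_iff sum_distrib_left mult_ac)

text \<open>Cramer's rule without division. The real identity \<open>cramer_lemma\<close> descends
  because both sides are integers.\<close>

lemma det_replace_col: "det (replace_col j (A *v z) A) = z$j * det (A :: int^'n^'n)"
proof -
  have "real_mat (replace_col j (A *v z) A)
      = (\<chi> i k. if k = j then (real_mat A *v real_vec z)$i else real_mat A$i$k)"
    by (auto simp: real_mat_def replace_col_def vec_eq_iff real_vec_def matrix_vector_mult_def)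
  then have "real_of_int (det (replace_col j (A *v z) A)) = real_of_int (z$j * det A)"
    by (simp add: det_real_mat [symmetric] cramer_lemma real_vec_def)
  then show ?thesis
    by linarith
qed

lemma det_scale_col:
  fixes A :: "'a::comm_ring_1^'n^'n"
  shows "det (replace_col j (c *s u) A) = c * det (replace_col j u A)"
proof -
  have *: "transpose (replace_col j w A) = (\<chi> i. if i = j then w else column i A)" for w
    by (simp add: vec_eq_iff transpose_def replace_col_def column_def)
  have "det (transpose (replace_col j (c *s u) A)) = c * det (transpose (replace_col j u A))"
    unfolding * by (rule det_row_mul)
  then show ?thesis
    by simp
qed

lemma det_col_dvd:
  fixes A :: "int^'n^'n"
  assumes "\<And>i. m dvd A$i$j"
  shows "m dvd det A"
  unfolding det_def
proof (intro dvd_sum dvd_mult)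
  fix s :: "'n \<Rightarrow> 'n" assume "s \<in> {p. p permutes UNIV}"
  then obtain i where "s i = j"
    by (metis mem_Collect_eq permutes_def)
  then have "m dvd A$i$s i"
    using assms by simp
  then show "m dvd (\<Prod>i\<in>UNIV. A$i$s i)"
    by (meson UNIV_I dvd_prodI dvd_trans finite)
qed

lemma det_cong:
  fixes A B :: "int^'n^'n"
  assumes "\<And>i j. [A$i$j = B$i$j] (mod m)"
  shows "[det A = det B] (mod m)"
  unfolding det_def using assms by (intro cong_sum cong_mult cong_refl cong_prod) auto

lemma mult_vec_cong:
  fixes A :: "int^'n^'m"
  assumes "\<And>j. [x$j = y$j] (mod m)"
  shows "[(A *v x)$i = (A *v y)$i] (mod m)"
  unfolding matrix_vector_mult_def vec_lambda_beta
  using assms by (intro cong_sum cong_mult cong_refl)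

text \<open>A substitute for the inverse matrix over the integers: \<open>z\<close> is the adjugate
  applied to \<open>b\<close>, its entries being Cramer's determinants.\<close>

lemma ex_mult_vec_eq_det:
  fixes A :: "int^'n^'n"
  assumes "det A \<noteq> 0"
  shows "\<exists>z. A *v z = det A *s b"
proof -
  define z where "z = (\<chi> k. det (replace_col k b A))"
  define x where "x = (\<chi> k. real_of_int (det (replace_col k b A)) / real_of_int (det A))"
  have "det (real_mat A) \<noteq> 0"
    using assms by (simp add: det_real_mat)
  moreover have "x = (\<chi> k. det(\<chi> i j. if j=k then real_vec b$i else real_mat A$i$j) / det (real_mat A))"
  proof -
    have "real_mat (replace_col k b A) = (\<chi> i j. if j=k then real_vec b$i else real_mat A$i$j)" for k
      by (auto simp: real_mat_def replace_col_def vec_eq_iff real_vec_def)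
    then show ?thesis
      by (simp add: x_def flip: det_real_mat)
  qed
  ultimately have "real_mat A *v x = real_vec b"
    using cramer by blast
  moreover have "real_vec z = real_of_int (det A) *s x"
    using assms by (simp add: z_def x_def real_vec_def vec_eq_iff)
  ultimately have "real_vec (A *v z) = real_of_int (det A) *s real_vec b"
    by (simp add: real_mat_mult_vec [symmetric] vector_scalar_commute)
  then have "A *v z = det A *s b"
    by (simp add: real_vec_def vec_eq_iff flip: of_int_mult)
  then show ?thesis ..
qed

text \<open>Injectivity modulo \<open>m\<close>: replacing column \<open>j\<close> by
  \<open>A *v z\<close> yields a determinant that is divisible by \<open>m\<close> and equals
  \<open>z$j * det A\<close>.\<close>

lemma dvd_vec_if_dvd_mult_vec:
  fixes A :: "int^'n^'n"
  assumes "\<And>i. m dvd (A *v z)$i" "coprime m (det A)"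
  shows "m dvd z$j"
proof -
  have "m dvd det (replace_col j (A *v z) A)"
    using assms(1) by (intro det_col_dvd [of _ _ j]) (simp add: replace_col_def)
  then show ?thesis
    using assms(2) by (simp add: det_replace_col coprime_dvd_mult_left_iff)
qed

text \<open>Linear algebra over the field with \<open>p\<close> elements, done with integer
  matrices. Among all \<open>U\<close> invertible modulo \<open>p\<close>, take one with the most
  columns in \<open>L\<close>. If \<open>U *v z\<close> were in \<open>L\<close> with
  \<open>z$j\<close> prime to \<open>p\<close> for some \<open>j\<close> outside \<open>I\<close>,
  it could replace column \<open>j\<close>, which multiplies the determinant by \<open>z$j\<close>
  only. The lemma serves both for kernels of matrices and for the radical of a cubic form modulo
  \<open>p\<close>.\<close>

lemma adapted_basis:
  fixes L :: "(int^'n) set"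
  assumes p: "prime p"
    and add: "\<And>x y. x \<in> L \<Longrightarrow> y \<in> L \<Longrightarrow> x + y \<in> L"
    and scale: "\<And>x k. x \<in> L \<Longrightarrow> k *s x \<in> L"
  obtains U I where "\<not> p dvd det U" "\<And>i. i \<in> I \<Longrightarrow> column i U \<in> L"
    "\<And>z j. U *v z \<in> L \<Longrightarrow> j \<notin> I \<Longrightarrow> p dvd z$j"
proof -
  define P where "P k \<longleftrightarrow> (\<exists>U I. \<not> p dvd det (U :: int^'n^'n) \<and> (\<forall>i\<in>I. column i U \<in> L) \<and> card I = k)" for k
  have "P 0"
    unfolding P_def
    by (rule exI [of _ "mat 1"], rule exI [of _ "{}"]) (use p not_prime_unit in auto)
  moreover have "\<And>k. P k \<Longrightarrow> k \<le> CARD('n)"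
    by (auto simp: P_def card_mono)
  ultimately obtain k where k: "P k" "\<And>m. P m \<Longrightarrow> m \<le> k"
    using Nat.ex_has_greatest_nat [of P 0] by blast
  then obtain U I where U: "\<not> p dvd det (U :: int^'n^'n)" "\<And>i. i \<in> I \<Longrightarrow> column i U \<in> L" "card I = k"
    unfolding P_def by blast
  have "p dvd z$j" if "U *v z \<in> L" "j \<notin> I" for z j
  proof (rule ccontr)
    assume "\<not> p dvd z$j"
    then have "\<not> p dvd det (replace_col j (U *v z) U)"
      using U p by (simp add: det_replace_col prime_dvd_mult_iff)
    moreover have "column i (replace_col j (U *v z) U) \<in> L" if "i \<in> insert j I" for i
    proof (cases "i = j")
      case True
      then show ?thesis
        using \<open>U *v z \<in> L\<close> by (simp add: column_def replace_col_def)
    next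
      case False
      then have "column i (replace_col j (U *v z) U) = column i U"
        by (simp add: column_def replace_col_def)
      then show ?thesis
        using U(2) that False by auto
    qed
    moreover have "card (insert j I) = Suc k"
      using U(3) \<open>j \<notin> I\<close> by simp
    ultimately have "P (Suc k)"
      unfolding P_def by (intro exI [of _ "replace_col j (U *v z) U"] exI [of _ "insert j I"]) blast
    then show False
      using k(2) by fastforce
  qed
  then show ?thesis
    using that U by blast
qed

section \<open>Residue boxes and kernels modulo a prime power\<close>

lemma ibox_vec: "ibox q = vec_lambda ` PiE UNIV (\<lambda>_. {0..<q})"
proof -
  have "x \<in> vec_lambda ` PiE UNIV (\<lambda>_. {0..<q})" if "x \<in> ibox q" for x
    using that by (intro image_eqI [of _ _ "vec_nth x"]) (auto simp: ibox_def)
  then show ?thesis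
    by (auto simp: ibox_def)
qed

lemma finite_ibox [simp]: "finite (ibox q)"
  by (simp add: ibox_vec finite_PiE)

lemma card_ibox: "q \<ge> 0 \<Longrightarrow> card (ibox q :: (int^'n) set) = nat q ^ CARD('n)"
  unfolding ibox_vec by (subst card_image) (auto simp: inj_on_def card_PiE)

lemma finite_kerq [simp]: "finite (kerq q A)"
  by (auto simp: kerq_def intro: finite_subset [OF _ finite_ibox])

lemma ibox_cong_imp_eq:
  assumes "x \<in> ibox q" "y \<in> ibox q" "\<And>i. q dvd x$i - y$i"
  shows "x = y"
proof (simp add: vec_eq_iff, rule allI)
  fix i
  have "[x$i = y$i] (mod q)"
    using assms(3) by (simp add: cong_iff_dvd_diff)
  then show "x$i = y$i"
    using assms(1,2) by (intro cong_less_imp_eq_int [of _ q]) (auto simp: ibox_def)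
qed

text \<open>If no such vector existed, \<open>A\<close> would act injectively on the finite box of
  residues, hence surjectively. Preimages of the unit vectors would then form an inverse of
  \<open>A\<close> modulo \<open>p\<close>, although \<open>p\<close> divides
  \<open>det A\<close>.\<close>

lemma kernel_vector_mod_prime:
  fixes A :: "int^'n^'n"
  assumes "prime p" "p dvd det A"
  obtains v j where "\<not> p dvd v$j" "\<And>i. p dvd (A *v v)$i"
proof (rule ccontr)
  assume "\<not> thesis"
  with that have *: "p dvd v$j" if "\<And>i. p dvd (A *v v)$i" for v j
    using that by blast
  have p: "p > 1"
    using assms(1) prime_gt_1_int by simp
  define f where "f x = (\<chi> i. (A *v x)$i mod p)" for x :: "int^'n"
  have "inj_on f (ibox p)"
  proof (rule inj_onI)
    fix x y assume xy: "x \<in> ibox p" "y \<in> ibox p" "f x = f y"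
    have "p dvd (A *v (x - y))$i" for i
      using xy(3) by (simp add: f_def vec_eq_iff matrix_vector_mult_diff_distrib mod_eq_dvd_iff)
    then have "p dvd (x - y)$j" for j
      by (rule *)
    then show "x = y"
      using xy by (intro ibox_cong_imp_eq [of _ p]) auto
  qed
  moreover have "f ` ibox p \<subseteq> ibox p"
    using p by (auto simp: f_def ibox_def)
  ultimately have surj: "f ` ibox p = ibox p"
    by (intro endo_inj_surj) auto
  have "\<exists>w. f w = axis j 1" for j
  proof -
    have "axis j 1 \<in> ibox p"
      using p by (auto simp: ibox_def axis_def)
    then show ?thesis
      using surj by (metis imageE)
  qed
  then obtain w where w: "\<And>j. f (w j) = axis j 1"
    by metis
  define W :: "int^'n^'n" where "W = (\<chi> i j. w j$i)"
  have "[(A ** W)$i$j = (mat 1 :: int^'n^'n)$i$j] (mod p)" for i j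
  proof -
    have "(A ** W)$i$j = (A *v w j)$i"
      by (simp add: W_def matrix_matrix_mult_def matrix_vector_mult_def)
    moreover have "(A *v w j)$i mod p = (mat 1 :: int^'n^'n)$i$j mod p"
      using w [of j] p by (auto simp: f_def vec_eq_iff axis_def mat_def)
    ultimately show ?thesis
      by (simp add: cong_def)
  qed
  then have "[det (A ** W) = det (mat 1 :: int^'n^'n)] (mod p)"
    by (rule det_cong)
  then have "[det A * det W = 1] (mod p)"
    by (simp add: det_mul)
  then have "p dvd det A * det W \<longleftrightarrow> p dvd 1"
    by (meson cong_dvd_iff)
  then show False
    using assms p by (auto simp: zdvd1_eq)
qed

lemma kernel_vector_normalised:
  fixes A :: "int^'n^'n"
  assumes "prime p" "p dvd det A"
  obtains v j where "v$j = 1" "\<And>i. p dvd (A *v v)$i"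
proof -
  obtain v j where v: "\<not> p dvd v$j" "\<And>i. p dvd (A *v v)$i"
    using kernel_vector_mod_prime [OF assms] by blast
  have "coprime (v$j) p"
    using v(1) assms(1) by (simp add: coprime_commute prime_imp_coprime)
  then obtain c where c: "[v$j * c = 1] (mod p)"
    by (meson cong_solve_coprime_int)
  then obtain d where d: "1 - c * v$j = p * d"
    by (metis cong_iff_dvd_diff cong_sym dvdE mult.commute)
  \<comment> \<open>Scaling alone makes the entry \<open>j\<close> only congruent to 1. The added
    multiple of \<open>p\<close> makes it equal to 1, so that \<open>det_replace_col\<close> later
    leaves no extra factor.\<close>
  define w where "w = c *s v + (p * d) *s axis j 1"
  have "w$j = 1"
    using d by (simp add: w_def axis_def)
  moreover have "p dvd (A *v w)$i" for i
  proof -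
    have "(A *v w)$i = c * (A *v v)$i + p * (d * (A *v axis j 1)$i)"
      by (simp add: w_def matrix_vector_right_distrib matrix_vector_mult_smult)
    then show ?thesis
      using v(2) by simp
  qed
  ultimately show ?thesis
    using that by blast
qed

text \<open>Descent on the determinant: a kernel vector modulo \<open>p\<close> allows to divide one column of
  \<open>A\<close> (in a suitable basis) by \<open>p\<close>, at the price of a factor \<open>p\<close> in the count.\<close>

lemma card_kerq_le_det:
  fixes A :: "int^'n^'n"
  assumes p: "prime p" and "det A \<noteq> 0"
  shows "int (card (kerq (p ^ k) A)) \<le> \<bar>det A\<bar>"
  using assms(2)
proof (induction "nat \<bar>det A\<bar>" arbitrary: A rule: less_induct)
  case less
  show ?case
  proof (cases "p dvd det A \<and> k > 0")
    case False
    have "kerq (p ^ k) A \<subseteq> {0}"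
    proof
      fix y assume y: "y \<in> kerq (p ^ k) A"
      have "coprime (p ^ k) (det A)"
        using False p prime_imp_coprime by (cases "k = 0") auto
      then have "p ^ k dvd y$j" for j
        using y by (metis (no_types, lifting) dvd_vec_if_dvd_mult_vec kerq_def mem_Collect_eq)
      then have "p ^ k dvd y$j - (0::int^'n)$j" for j
        by simp
      moreover have "0 \<in> ibox (p ^ k)"
        using p by (auto simp: ibox_def prime_gt_0_int)
      ultimately show "y \<in> {0}"
        using y by (metis (no_types, lifting) ibox_cong_imp_eq kerq_def mem_Collect_eq singletonI)
    qed
    then have "card (kerq (p ^ k) A) \<le> card {0 :: int^'n}"
      by (intro card_mono) auto
    then have "card (kerq (p ^ k) A) \<le> 1"
      by simp
    moreover have "\<bar>det A\<bar> \<ge> 1"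
      using less.prems by linarith
    ultimately show ?thesis
      by linarith
  next
    case True
    then obtain k' where k': "k = Suc k'"
      using gr0_implies_Suc by blast
    have p0: "p > 1"
      using p prime_gt_1_int by simp
    obtain v j where v: "v$j = 1" "\<And>i. p dvd (A *v v)$i"
      using kernel_vector_normalised [of p A] True p by blast
    define B where "B = replace_col j (\<chi> i. (A *v v)$i div p) A"
    have det: "det A = p * det B"
    proof -
      have "(A *v v) = p *s (\<chi> i. (A *v v)$i div p)"
        using v(2) by (simp add: vec_eq_iff)
      then have "det (replace_col j (A *v v) A) = p * det B"
        unfolding B_def by (metis det_scale_col)
      then show ?thesis
        using v(1) by (simp add: det_replace_col)
    qed
    have detB: "det B \<noteq> 0" "nat \<bar>det B\<bar> < nat \<bar>det A\<bar>"
      using less.prems p0 by (auto simp: det abs_mult)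
    \<comment> \<open>\<open>w y\<close> expresses \<open>y\<close> in the basis that contains
      \<open>v\<close> in place of the unit vector \<open>j\<close>. The new column is
      \<open>A v\<close> divided by \<open>p\<close>, so its coefficient is \<open>p * y$j\<close>,
      and \<open>B *v w y = A *v y\<close>.\<close>
    define w where "w y = (\<chi> i. (if i = j then p * y$j else y$i - y$j * v$i))" for y :: "int^'n"
    have Bw: "B *v w y = A *v y" for y
    proof (simp add: vec_eq_iff, rule allI)
      fix i
      have "A *v y = A *v (y - y$j *s v) + y$j *s (A *v v)"
        by (simp add: matrix_vector_mult_diff_distrib matrix_vector_mult_smult)
      moreover have "(A *v (y - y$j *s v))$i = (\<Sum>a\<in>UNIV - {j}. A$i$a * (y$a - y$j * v$a))"
        using v(1) by (simp add: matrix_vector_mult_def sum.remove [of UNIV j])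
      moreover have "(B *v w y)$i = (\<Sum>a\<in>UNIV - {j}. A$i$a * (y$a - y$j * v$a)) + (A *v v)$i div p * (p * y$j)"
        by (simp add: matrix_vector_mult_def sum.remove [of UNIV j] B_def w_def replace_col_def)
      moreover have "(A *v v)$i div p * (p * y$j) = y$j * (A *v v)$i"
        using v(2) [of i] by auto
      ultimately show "(B *v w y)$i = (A *v y)$i"
        by simp
    qed
    define red where "red y = (\<chi> i. y$i mod p ^ k)" for y :: "int^'n"
    \<comment> \<open>Modulo \<open>p ^ k\<close>, the vector \<open>w y\<close> determines
      \<open>y$j\<close> only modulo \<open>p ^ k'\<close>. Its leading digit
      \<open>y$j div p ^ k'\<close> restores injectivity, and the \<open>p\<close> possible digits
      are paid for by the factor \<open>p\<close> removed from the determinant.\<close>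
    define g where "g y = (red (w y), y$j div p ^ k')" for y
    have "inj_on g (kerq (p ^ k) A)"
    proof (rule inj_onI)
      fix x y assume xy: "x \<in> kerq (p ^ k) A" "y \<in> kerq (p ^ k) A" "g x = g y"
      have "w x$i mod p ^ k = w y$i mod p ^ k" for i
        using xy(3) by (simp add: g_def red_def vec_eq_iff)
      then have wxy: "p ^ k dvd w x$i - w y$i" for i
        by (simp add: mod_eq_dvd_iff)
      have "p * p ^ k' dvd p * (x$j - y$j)"
        using wxy [of j] by (simp add: w_def k' algebra_simps)
      then have "p ^ k' dvd x$j - y$j"
        using p0 by simp
      then have "x$j mod p ^ k' = y$j mod p ^ k'"
        by (simp add: mod_eq_dvd_iff)
      then have xyj: "x$j = y$j"
        using xy(3) by (metis g_def mult_div_mod_eq prod.inject)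
      have "p ^ k dvd x$i - y$i" for i
        using wxy [of i] xyj by (cases "i = j") (auto simp: w_def algebra_simps)
      then show "x = y"
        using xy by (intro ibox_cong_imp_eq [of _ "p ^ k"]) (auto simp: kerq_def)
    qed
    moreover have "g ` kerq (p ^ k) A \<subseteq> kerq (p ^ k) B \<times> {0..<p}"
    proof
      fix z assume "z \<in> g ` kerq (p ^ k) A"
      then obtain y where y: "y \<in> kerq (p ^ k) A" "z = g y"
        by blast
      have "p ^ k dvd (B *v red (w y))$i" for i
      proof -
        have "[(B *v red (w y))$i = (B *v w y)$i] (mod p ^ k)"
          by (rule mult_vec_cong) (simp add: red_def)
        moreover have "p ^ k dvd (B *v w y)$i"
          using y(1) by (simp add: Bw kerq_def)
        ultimately show ?thesis
          using cong_dvd_iff by blast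
      qed
      moreover have "red (w y) \<in> ibox (p ^ k)"
        using p0 by (auto simp: red_def ibox_def)
      moreover have "0 \<le> y$j div p ^ k'"
        using y(1) p0 by (auto simp: kerq_def ibox_def k' pos_imp_zdiv_nonneg_iff)
      moreover have "y$j div p ^ k' < p"
      proof -
        have "p ^ k' * (y$j div p ^ k') \<le> y$j"
          using pos_mod_sign [of "p ^ k'" "y$j"] p0 by (simp add: minus_mult_div_eq_mod [symmetric])
        also have "y$j < p ^ k' * p"
          using y(1) by (simp add: kerq_def ibox_def k' mult.commute)
        finally show ?thesis
          using p0 by (simp add: mult_less_cancel_left_pos)
      qed
      ultimately show "z \<in> kerq (p ^ k) B \<times> {0..<p}"
        by (simp add: y(2) g_def kerq_def)
    qed
    ultimately have "card (kerq (p ^ k) A) \<le> card (kerq (p ^ k) B \<times> {0..<p})"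
      by (intro card_inj_on_le [of g]) auto
    also have "\<dots> = card (kerq (p ^ k) B) * nat p"
      by (simp add: card_cartesian_product)
    finally have "int (card (kerq (p ^ k) A)) \<le> int (card (kerq (p ^ k) B)) * p"
      using p0 by (metis (no_types, opaque_lifting) of_nat_le_iff of_nat_mult nat_0_le order.strict_trans zless_imp_add1_zle less_le_not_le zero_less_one)
    also have "\<dots> \<le> \<bar>det B\<bar> * p"
      using less.hyps [OF detB(2) detB(1)] p0 by simp
    also have "\<dots> = \<bar>det A\<bar>"
      using p0 by (simp add: det abs_mult)
    finally show ?thesis .
  qed
qed

section \<open>Zeros of cubic polynomials modulo a prime\<close>

inductive hpoly :: "'n set \<Rightarrow> nat \<Rightarrow> (int^'n \<Rightarrow> int) \<Rightarrow> bool" for J where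
  const: "hpoly J 0 (\<lambda>_. c)"
| zero: "hpoly J d (\<lambda>_. 0)"
| add: "hpoly J d F \<Longrightarrow> hpoly J d G \<Longrightarrow> hpoly J d (\<lambda>x. F x + G x)"
| var: "i \<in> J \<Longrightarrow> hpoly J d F \<Longrightarrow> hpoly J (Suc d) (\<lambda>x. x$i * F x)"

lemma hpoly_mono: "hpoly J d F \<Longrightarrow> J \<subseteq> K \<Longrightarrow> hpoly K d F"
  by (induction rule: hpoly.induct) (auto intro: hpoly.intros)

lemma hpoly_scale: "hpoly J d F \<Longrightarrow> hpoly J d (\<lambda>x. c * F x)"
proof (induction rule: hpoly.induct)
  case (const b)
  show ?case
    by (rule hpoly.const)
next
  case (zero d)
  then show ?case
    by (simp add: hpoly.zero)
next
  case (add d F G)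
  then show ?case
    using hpoly.add by (fastforce simp: algebra_simps)
next
  case (var i d F)
  then show ?case
    using hpoly.var [of i J d "\<lambda>x. c * F x"] by (simp add: mult.left_commute)
qed

lemma hpoly_sum:
  "(\<And>i. i \<in> A \<Longrightarrow> hpoly J d (F i)) \<Longrightarrow> hpoly J d (\<lambda>x. \<Sum>i\<in>A. F i x)"
  by (induction A rule: infinite_finite_induct) (auto intro: hpoly.intros)

lemma hpoly_mult: "hpoly J d F \<Longrightarrow> hpoly J e G \<Longrightarrow> hpoly J (d + e) (\<lambda>x. F x * G x)"
proof (induction rule: hpoly.induct)
  case (const c)
  then show ?case
    by (simp add: hpoly_scale)
next
  case (zero d)
  then show ?case
    by (simp add: hpoly.zero)
next
  case (add d F1 F2)
  then show ?case
    using hpoly.add by (fastforce simp: algebra_simps)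
next
  case (var i d F)
  then show ?case
    using hpoly.var [of i J "d + e" "\<lambda>x. F x * G x"] by (simp add: mult.assoc)
qed

lemma hpoly_power: "hpoly J d F \<Longrightarrow> hpoly J (k * d) (\<lambda>x. F x ^ k)"
proof (induction k)
  case 0
  then show ?case
    by (simp add: hpoly.const)
next
  case (Suc k)
  then show ?case
    using hpoly_mult [of J d F "k * d"] by simp
qed

text \<open>Telescoping \<open>(t + 1) ^ Suc e - t ^ Suc e\<close> over all residues expresses
  \<open>Suc e\<close> times the power sum by lower power sums and a power of \<open>p\<close>.
  Since \<open>Suc e < p\<close>, the factor \<open>Suc e\<close> can be cancelled modulo
  \<open>p\<close>.\<close>

lemma prime_dvd_sum_power:
  fixes p :: nat
  assumes "prime p"
  shows "e < p - 1 \<Longrightarrow> int p dvd (\<Sum>t\<in>{0..<int p}. t ^ e)"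
proof (induction e rule: less_induct)
  case (less e)
  have sum_nat: "(\<Sum>t\<in>{0..<int p}. t ^ k) = (\<Sum>t<p. int t ^ k)" for k
    by (rule sum.reindex_bij_witness [of _ int nat]) auto
  have "(int t + 1) ^ Suc e - int t ^ Suc e = (\<Sum>k\<le>e. int (Suc e choose k) * int t ^ k)" for t
    by (subst binomial_ring) simp
  then have "(\<Sum>t<p. (int t + 1) ^ Suc e - int t ^ Suc e)
      = (\<Sum>t<p. \<Sum>k\<le>e. int (Suc e choose k) * int t ^ k)"
    by simp
  also have "\<dots> = (\<Sum>k\<le>e. int (Suc e choose k) * (\<Sum>t<p. int t ^ k))"
    by (subst sum.swap) (simp add: sum_distrib_left)
  also have "\<dots> = (\<Sum>k<e. int (Suc e choose k) * (\<Sum>t<p. int t ^ k)) + int (Suc e) * (\<Sum>t<p. int t ^ e)"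
    by (simp add: lessThan_Suc_atMost [symmetric] add.commute)
  finally have "(\<Sum>k<e. int (Suc e choose k) * (\<Sum>t<p. int t ^ k)) + int (Suc e) * (\<Sum>t<p. int t ^ e)
      = (\<Sum>t<p. int (Suc t) ^ Suc e - int t ^ Suc e)"
    by (simp add: add.commute)
  also have "\<dots> = int p ^ Suc e"
    by (subst sum_lessThan_telescope) simp
  finally have eq: "int (Suc e) * (\<Sum>t<p. int t ^ e) = int p ^ Suc e - (\<Sum>k<e. int (Suc e choose k) * (\<Sum>t<p. int t ^ k))"
    by linarith
  have "int p dvd (\<Sum>k<e. int (Suc e choose k) * (\<Sum>t<p. int t ^ k))"
  proof (rule dvd_sum)
    fix k assume "k \<in> {..<e}"
    then have "int p dvd (\<Sum>t<p. int t ^ k)"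
      using less by (simp flip: sum_nat)
    then show "int p dvd int (Suc e choose k) * (\<Sum>t<p. int t ^ k)"
      by simp
  qed
  then have "int p dvd int (Suc e) * (\<Sum>t<p. int t ^ e)"
    unfolding eq by (intro dvd_diff) auto
  moreover have "\<not> int p dvd int (Suc e)"
    using less.prems by (auto dest!: dvd_imp_le simp del: of_nat_Suc)
  ultimately show ?case
    using assms unfolding sum_nat by (metis prime_dvd_mult_iff prime_nat_int_transfer)
qed

definition supp_box :: "'n set \<Rightarrow> int \<Rightarrow> (int^'n) set" where
  "supp_box J p = {x. \<forall>i. x$i \<in> (if i \<in> J then {0..<p} else {0})}"

lemma supp_box_eq: "supp_box J p = vec_lambda ` PiE UNIV (\<lambda>i. if i \<in> J then {0..<p} else {0})"
  (is "_ = vec_lambda ` ?G")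
proof (intro equalityI subsetI)
  fix x assume "x \<in> supp_box J p"
  then show "x \<in> vec_lambda ` ?G"
    by (intro image_eqI [of _ _ "vec_nth x"]) (auto simp: supp_box_def)
next
  fix x assume "x \<in> vec_lambda ` ?G"
  then obtain g where "g \<in> ?G" "x = vec_lambda g"
    by blast
  then show "x \<in> supp_box J p"
    by (simp add: supp_box_def PiE_iff)
qed

lemma sum_supp_box_monomial:
  fixes J :: "'n::finite set"
  shows "(\<Sum>x\<in>supp_box J p. \<Prod>i\<in>UNIV. x$i ^ e i)
    = (\<Prod>i\<in>UNIV. \<Sum>t\<in>(if i \<in> J then {0..<p} else {0}). t ^ e i)"
proof -
  have "inj_on vec_lambda X" for X :: "('n::finite \<Rightarrow> int) set"
    by (simp add: inj_on_def)
  then have "(\<Sum>x\<in>supp_box J p. \<Prod>i\<in>UNIV. x$i ^ e i)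
      = (\<Sum>g\<in>PiE UNIV (\<lambda>i. if i \<in> J then {0..<p} else {0}). \<Prod>i\<in>UNIV. g i ^ e i)"
    unfolding supp_box_eq by (subst sum.reindex) auto
  also have "\<dots> = (\<Prod>i\<in>UNIV. \<Sum>t\<in>(if i \<in> J then {0..<p} else {0}). t ^ e i)"
    by (subst prod_sum_PiE) auto
  finally show ?thesis .
qed

text \<open>The exponents \<open>e\<close> collect the variables peeled off so far, and
  \<open>sum e J + d\<close> is invariant under the rule \<open>var\<close>. At a constant the
  degree condition leaves some \<open>i\<close> in \<open>J\<close> with \<open>e i < p - 1\<close>,
  whose power sum vanishes modulo \<open>p\<close>.\<close>

lemma prime_dvd_sum_hpoly:
  fixes p :: nat
  assumes "prime p"
  shows "hpoly J d F \<Longrightarrow> (\<And>i. i \<notin> J \<Longrightarrow> e i = 0) \<Longrightarrow> sum e J + d < card J * (p - 1) \<Longrightarrow>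
    int p dvd (\<Sum>x\<in>supp_box J p. (\<Prod>i\<in>UNIV. x$i ^ e i) * F x)"
proof (induction arbitrary: e rule: hpoly.induct)
  case (const c)
  have "\<exists>i\<in>J. e i < p - 1"
  proof (rule ccontr)
    assume "\<not> (\<exists>i\<in>J. e i < p - 1)"
    then have "(\<Sum>i\<in>J. p - 1) \<le> sum e J"
      by (intro sum_mono) auto
    then show False
      using const.prems by simp
  qed
  then obtain i where i: "i \<in> J" "e i < p - 1"
    by blast
  have "int p dvd (\<Sum>t\<in>(if i \<in> J then {0..<int p} else {0}). t ^ e i)"
    using i prime_dvd_sum_power [OF assms i(2)] by simp
  then have "int p dvd (\<Prod>i\<in>UNIV. \<Sum>t\<in>(if i \<in> J then {0..<int p} else {0}). t ^ e i)"
    by (meson UNIV_I dvd_prodI dvd_trans finite)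
  then show ?case
    by (simp add: sum_supp_box_monomial flip: sum_distrib_right)
next
  case (zero d)
  then show ?case
    by simp
next
  case (add d F G)
  then show ?case
    by (simp add: distrib_left sum.distrib)
next
  case (var i d F)
  define e' where "e' = e(i := Suc (e i))"
  have "(\<Prod>k\<in>UNIV. x$k ^ e' k) = (\<Prod>k\<in>UNIV. x$k ^ e k) * x$i" for x :: "int^'a"
  proof -
    have "(\<Prod>k\<in>UNIV - {i}. x$k ^ e' k) = (\<Prod>k\<in>UNIV - {i}. x$k ^ e k)"
      by (rule prod.cong) (auto simp: e'_def)
    then show ?thesis
      by (simp add: prod.remove [of UNIV i] e'_def)
  qed
  moreover have "int p dvd (\<Sum>x\<in>supp_box J p. (\<Prod>k\<in>UNIV. x$k ^ e' k) * F x)"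
  proof (rule var.IH)
    have "sum e' (J - {i}) = sum e (J - {i})"
      by (rule sum.cong) (auto simp: e'_def)
    then have "sum e' J = Suc (sum e J)"
      using var.hyps(1) by (simp add: sum.remove [of J i] e'_def)
    then show "sum e' J + d < card J * (p - 1)"
      using var.prems by simp
  qed (use var in \<open>auto simp: e'_def\<close>)
  ultimately show ?case
    by (simp add: mult.assoc)
qed

lemma fermat_int:
  assumes "prime p" "\<not> int p dvd x"
  shows "[x ^ (p - 1) = 1] (mod int p)"
proof -
  define a where "a = nat (x mod int p)"
  have a: "int a = x mod int p"
    using assms(1) by (simp add: a_def prime_gt_0_nat)
  then have "\<not> p dvd a"
    using assms(2) by (metis int_dvd_int_iff dvd_mod_iff dvd_refl)
  then have "[int a ^ (p - 1) = 1] (mod int p)"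
    using fermat_theorem [OF assms(1)] by (metis cong_int_iff of_nat_1 of_nat_power)
  moreover have "[int a ^ (p - 1) = x ^ (p - 1)] (mod int p)"
    unfolding a by (intro cong_pow) (simp add: cong_def)
  ultimately show ?thesis
    by (metis cong_sym cong_trans)
qed

text \<open>By Fermat \<open>1 - F x ^ (p - 1)\<close> is the indicator of the zeros modulo
  \<open>p\<close>, and its sum over the box is divisible by \<open>p\<close> because
  \<open>d < card J\<close>. So the number of zeros in the box is divisible by \<open>p\<close>; the
  zero vector is one of them, hence not the only one.\<close>

lemma chevalley:
  fixes p :: nat and F :: "int^'n \<Rightarrow> int"
  assumes p: "prime p" and F: "hpoly J d F" "F 0 = 0" and d: "d < card J"
  obtains x where "\<And>i. i \<notin> J \<Longrightarrow> x$i = 0" "\<exists>j\<in>J. \<not> int p dvd x$j" "int p dvd F x"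
proof -
  let ?X = "supp_box J (int p) :: (int^'n) set"
  have p1: "p > 1"
    using p prime_gt_1_nat by blast
  have fin: "finite ?X"
    by (simp add: supp_box_eq finite_PiE)
  define Z where "Z = {x \<in> ?X. int p dvd F x}"
  have "int p dvd (\<Sum>x\<in>?X. (\<Prod>i\<in>UNIV. x$i ^ (\<lambda>_. 0) i) * F x ^ (p - 1))"
    using d p1 by (intro prime_dvd_sum_hpoly [OF p hpoly_power [OF F(1)]]) auto
  then have 1: "int p dvd (\<Sum>x\<in>?X. F x ^ (p - 1))"
    by simp
  have "J \<noteq> {}"
    using d by auto
  then have "0 < card J"
    by (simp add: card_gt_0_iff)
  then have "int p dvd (\<Sum>x\<in>?X. (\<Prod>i\<in>UNIV. x$i ^ (\<lambda>_. 0) i) * 1)"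
    using p1 by (intro prime_dvd_sum_hpoly [OF p hpoly.const]) auto
  then have 2: "int p dvd int (card ?X)"
    by simp
  have "[(\<Sum>x\<in>?X. 1 - F x ^ (p - 1)) = (\<Sum>x\<in>?X. if int p dvd F x then 1 else 0)] (mod int p)"
  proof (rule cong_sum)
    fix x
    show "[1 - F x ^ (p - 1) = (if int p dvd F x then 1 else 0)] (mod int p)"
    proof (cases "int p dvd F x")
      case True
      then have "int p dvd F x ^ (p - 1)"
        using p1 by (meson dvd_trans dvd_power zero_less_diff)
      with True show ?thesis
        by (simp add: cong_iff_dvd_diff)
    next
      case False
      then show ?thesis
        using fermat_int [OF p False] by (simp add: cong_iff_dvd_diff dvd_diff_commute)
    qed
  qed
  moreover have "(\<Sum>x\<in>?X. if int p dvd F x then 1 else 0) = int (card Z)"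
    using fin by (simp add: Z_def sum.inter_filter [symmetric])
  moreover have "int p dvd (\<Sum>x\<in>?X. 1 - F x ^ (p - 1))"
    using 1 2 by (simp add: sum_subtractf)
  ultimately have dvdZ: "int p dvd int (card Z)"
    using cong_dvd_iff by metis
  have "0 \<in> Z"
    using F(2) p1 by (auto simp: Z_def supp_box_def)
  have "\<not> Z \<subseteq> {0}"
  proof
    assume "Z \<subseteq> {0}"
    then have "Z = {0}"
      using \<open>0 \<in> Z\<close> by blast
    then show False
      using dvdZ p1 by (auto simp: zdvd1_eq)
  qed
  then obtain x where x: "x \<in> Z" "x \<noteq> 0"
    by blast
  then obtain j where j: "x$j \<noteq> 0"
    by (auto simp: vec_eq_iff)
  have xs: "x$i \<in> (if i \<in> J then {0..<int p} else {0})" for i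
    using x(1) by (auto simp: Z_def supp_box_def)
  have "j \<in> J"
    using j xs [of j] by (auto split: if_splits)
  moreover have "\<not> int p dvd x$j"
    using xs [of j] j \<open>j \<in> J\<close> by (auto dest: zdvd_imp_le)
  moreover have "int p dvd F x"
    using x(1) by (simp add: Z_def)
  ultimately show ?thesis
    using that xs by (metis singletonD)
qed

section \<open>Cubic forms over the p-adic integers\<close>

definition tri :: "('n::finite \<Rightarrow> 'n \<Rightarrow> 'n \<Rightarrow> int) \<Rightarrow> int^'n \<Rightarrow> int^'n \<Rightarrow> int^'n \<Rightarrow> int" where
  "tri s x y z = (\<Sum>i\<in>UNIV. \<Sum>j\<in>UNIV. \<Sum>k\<in>UNIV. s i j k * x$i * y$j * z$k)"

text \<open>The tensor \<open>s\<close> stands for the cubic polynomial \<open>tri s x x x / 6\<close>; the divisibility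
  conditions say that this polynomial has integer coefficients. This keeps the argument uniform
  in \<open>p\<close>, including \<open>p = 2\<close> and \<open>p = 3\<close>.\<close>

definition integral_tensor :: "('n::finite \<Rightarrow> 'n \<Rightarrow> 'n \<Rightarrow> int) \<Rightarrow> bool" where
  "integral_tensor s \<longleftrightarrow> symmetric_coeffs s \<and> (\<forall>i. 6 dvd s i i i) \<and> (\<forall>i j. 2 dvd s i i j)"

definition cub :: "('n::finite \<Rightarrow> 'n \<Rightarrow> 'n \<Rightarrow> int) \<Rightarrow> int^'n \<Rightarrow> int" where
  "cub s x = tri s x x x div 6"

text \<open>The derivative of \<open>cub s\<close> at \<open>x\<close> in direction
  \<open>y\<close>. The divisions in \<open>cub\<close> and \<open>dcub\<close> are exact for an
  integral tensor, by \<open>cub_6\<close> and \<open>dcub_2\<close>.\<close>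

definition dcub :: "('n::finite \<Rightarrow> 'n \<Rightarrow> 'n \<Rightarrow> int) \<Rightarrow> int^'n \<Rightarrow> int^'n \<Rightarrow> int" where
  "dcub s x y = tri s x x y div 2"

section \<open>Polarisation identities for integral cubic forms\<close>

lemma tri_add1: "tri s (x + x') y z = tri s x y z + tri s x' y z"
  by (simp add: tri_def distrib_left distrib_right sum.distrib)

lemma tri_add2: "tri s x (y + y') z = tri s x y z + tri s x y' z"
  by (simp add: tri_def distrib_left distrib_right sum.distrib)

lemma tri_add3: "tri s x y (z + z') = tri s x y z + tri s x y z'"
  by (simp add: tri_def distrib_left distrib_right sum.distrib)

lemma tri_scale1: "tri s (c *s x) y z = c * tri s x y z"
  by (simp add: tri_def sum_distrib_left algebra_simps)

lemma tri_scale2: "tri s x (c *s y) z = c * tri s x y z"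
  by (simp add: tri_def sum_distrib_left algebra_simps)

lemma tri_scale3: "tri s x y (c *s z) = c * tri s x y z"
  by (simp add: tri_def sum_distrib_left algebra_simps)

lemmas tri_linear = tri_add1 tri_add2 tri_add3 tri_scale1 tri_scale2 tri_scale3

lemma tri_sum1: "tri s (\<Sum>a\<in>A. x a) y z = (\<Sum>a\<in>A. tri s (x a) y z)"
  by (induction A rule: infinite_finite_induct) (auto simp: tri_add1, auto simp: tri_def)

lemma tri_sum2: "tri s y (\<Sum>a\<in>A. x a) z = (\<Sum>a\<in>A. tri s y (x a) z)"
  by (induction A rule: infinite_finite_induct) (auto simp: tri_add2, auto simp: tri_def)

lemma tri_sum3: "tri s y z (\<Sum>a\<in>A. x a) = (\<Sum>a\<in>A. tri s y z (x a))"
  by (induction A rule: infinite_finite_induct) (auto simp: tri_add3, auto simp: tri_def)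

lemma tri_swap12: "symmetric_coeffs s \<Longrightarrow> tri s x y z = tri s y x z"
  unfolding tri_def by (subst sum.swap) (simp add: symmetric_coeffs_def mult_ac)

lemma tri_swap23:
  assumes "symmetric_coeffs s"
  shows "tri s x y z = tri s x z y"
proof -
  have "(\<Sum>j\<in>UNIV. \<Sum>k\<in>UNIV. s i j k * x$i * y$j * z$k) = (\<Sum>j\<in>UNIV. \<Sum>k\<in>UNIV. s i j k * x$i * z$j * y$k)" for i
    using assms by (subst sum.swap) (simp add: symmetric_coeffs_def mult_ac)
  then show ?thesis
    by (simp add: tri_def)
qed

lemma tri_expand:
  assumes "symmetric_coeffs s"
  shows "tri s (x + t *s y) (x + t *s y) (x + t *s y)
    = tri s x x x + 3 * t * tri s x x y + 3 * t\<^sup>2 * tri s y y x + t ^ 3 * tri s y y y"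
proof -
  have "tri s x y x = tri s x x y" "tri s y x x = tri s x x y" "tri s x y y = tri s y y x" "tri s y x y = tri s y y x"
    using tri_swap12 [OF assms] tri_swap23 [OF assms] by metis+
  then show ?thesis
    by (simp add: tri_linear power2_eq_square power3_eq_cube algebra_simps)
qed

text \<open>Off-diagonal terms come in equal pairs and diagonal coefficients are even. Adding one
  variable at a time exhibits the half as an \<open>hpoly\<close>.\<close>

lemma quadratic_half:
  fixes S :: "'n::finite \<Rightarrow> 'n \<Rightarrow> int"
  assumes "\<And>i j. S i j = S j i" "\<And>i. 2 dvd S i i" "finite J"
  shows "\<exists>Q. hpoly J 2 Q \<and> (\<forall>x. (\<Sum>i\<in>J. \<Sum>j\<in>J. S i j * x$i * x$j) = 2 * Q x)"
  using assms(3)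
proof (induction J rule: finite_induct)
  case empty
  then show ?case
    by (auto intro!: exI [of _ "\<lambda>_. 0"] hpoly.zero)
next
  case (insert a J)
  then obtain Q where Q: "hpoly J 2 Q" "\<And>x. (\<Sum>i\<in>J. \<Sum>j\<in>J. S i j * x$i * x$j) = 2 * Q x"
    by blast
  obtain m where m: "S a a = 2 * m"
    using assms(2) by blast
  define R where "R x = x$a * (m * x$a + (\<Sum>j\<in>J. S a j * x$j)) + Q x" for x
  have lin: "hpoly (insert a J) 1 (\<lambda>x. c * x$j)" if "j \<in> insert a J" for c j
    using hpoly.var [OF that hpoly.const [of _ c]] by (simp add: mult.commute)
  have "hpoly (insert a J) 2 R"
    unfolding R_def numeral_2_eq_2
  proof (intro hpoly.add hpoly.var)
    show "hpoly (insert a J) (Suc (Suc 0)) Q"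
      using hpoly_mono [OF Q(1), of "insert a J"] by (auto simp: numeral_2_eq_2)
  qed (use lin in \<open>auto intro!: hpoly_sum\<close>)
  moreover have "(\<Sum>i\<in>insert a J. \<Sum>j\<in>insert a J. S i j * x$i * x$j) = 2 * R x" for x
  proof -
    have "(\<Sum>i\<in>J. S i a * x$i * x$a) = x$a * (\<Sum>j\<in>J. S a j * x$j)"
      by (simp add: sum_distrib_left assms(1) [of _ a] mult_ac)
    moreover have "(\<Sum>j\<in>J. S a j * x$a * x$j) = x$a * (\<Sum>j\<in>J. S a j * x$j)"
      by (simp add: sum_distrib_left mult_ac)
    ultimately show ?thesis
      using insert.hyps Q(2) [of x] by (simp add: sum.distrib R_def m algebra_simps)
  qed
  ultimately show ?case
    by blast
qed

text \<open>Adding the variable \<open>a\<close> sorts the new terms by their degree in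
  \<open>x$a\<close>. Degree 3 has a coefficient divisible by 6, degree 2 occurs three times with
  even coefficients, and degree 1 occurs three times with a quadratic form covered by
  \<open>quadratic_half\<close>. The resulting \<open>hpoly\<close> of degree 3 is what
  \<open>chevalley\<close> is applied to.\<close>

lemma cubic_sixth:
  fixes s :: "'n::finite \<Rightarrow> 'n \<Rightarrow> 'n \<Rightarrow> int"
  assumes "integral_tensor s" "finite J"
  shows "\<exists>Q. hpoly J 3 Q \<and> (\<forall>x. (\<Sum>i\<in>J. \<Sum>j\<in>J. \<Sum>k\<in>J. s i j k * x$i * x$j * x$k) = 6 * Q x)"
  using assms(2)
proof (induction J rule: finite_induct)
  case empty
  then show ?case
    by (auto intro!: exI [of _ "\<lambda>_. 0"] hpoly.zero)
next
  case (insert a J)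
  have sym: "\<And>i j k. s i j k = s j i k" "\<And>i j k. s i j k = s i k j"
    using assms(1) by (auto simp: integral_tensor_def symmetric_coeffs_def)
  obtain Q where Q: "hpoly J 3 Q" "\<And>x. (\<Sum>i\<in>J. \<Sum>j\<in>J. \<Sum>k\<in>J. s i j k * x$i * x$j * x$k) = 6 * Q x"
    using insert.IH by blast
  have "\<exists>R. hpoly J 2 R \<and> (\<forall>x. (\<Sum>i\<in>J. \<Sum>j\<in>J. s a i j * x$i * x$j) = 2 * R x)"
  proof (rule quadratic_half)
    show "s a i j = s a j i" for i j
      by (rule sym)
    show "2 dvd s a i i" for i
      using assms(1) sym by (metis integral_tensor_def)
  qed (use insert in auto)
  then obtain R where R: "hpoly J 2 R" "\<And>x. (\<Sum>i\<in>J. \<Sum>j\<in>J. s a i j * x$i * x$j) = 2 * R x"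
    by blast
  obtain m where m: "s a a a = 6 * m"
    using assms(1) unfolding integral_tensor_def by blast
  have "\<exists>h. s a a i = 2 * h" for i
    using assms(1) unfolding integral_tensor_def by blast
  then obtain h where h: "\<And>i. s a a i = 2 * h i"
    by metis
  define P where "P x = x$a * (x$a * (m * x$a + (\<Sum>j\<in>J. h j * x$j)) + R x) + Q x" for x
  have lin: "hpoly (insert a J) 1 (\<lambda>x. c * x$j)" if "j \<in> insert a J" for c j
    using hpoly.var [OF that hpoly.const [of _ c]] by (simp add: mult.commute)
  have "hpoly (insert a J) 3 P"
    unfolding P_def numeral_3_eq_3
  proof (intro hpoly.add hpoly.var)
    show "hpoly (insert a J) (Suc (Suc (Suc 0))) Q"
      using hpoly_mono [OF Q(1), of "insert a J"] by (auto simp: numeral_3_eq_3)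
    show "hpoly (insert a J) (Suc (Suc 0)) R"
      using hpoly_mono [OF R(1), of "insert a J"] by (auto simp: numeral_2_eq_2)
  qed (use lin in \<open>auto intro!: hpoly_sum\<close>)
  moreover have "(\<Sum>i\<in>insert a J. \<Sum>j\<in>insert a J. \<Sum>k\<in>insert a J. s i j k * x$i * x$j * x$k) = 6 * P x" for x
  proof -
    define H where "H = (\<Sum>j\<in>J. h j * x$j)"
    have l: "(\<Sum>i\<in>J. s a a i * x$a * x$a * x$i) = 2 * (x$a)\<^sup>2 * H"
      "(\<Sum>i\<in>J. s a i a * x$a * x$i * x$a) = 2 * (x$a)\<^sup>2 * H"
      "(\<Sum>i\<in>J. s i a a * x$i * x$a * x$a) = 2 * (x$a)\<^sup>2 * H"
      by (simp_all add: H_def sum_distrib_left sym(2) [of a _ a] sym(1) [of _ a a] h power2_eq_square mult_ac)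
    have q: "(\<Sum>i\<in>J. \<Sum>j\<in>J. s a i j * x$a * x$i * x$j) = 2 * x$a * R x"
      "(\<Sum>i\<in>J. \<Sum>j\<in>J. s i a j * x$i * x$a * x$j) = 2 * x$a * R x"
      "(\<Sum>i\<in>J. \<Sum>j\<in>J. s i j a * x$i * x$j * x$a) = 2 * x$a * R x"
    proof -
      have "2 * x$a * R x = (\<Sum>i\<in>J. \<Sum>j\<in>J. x$a * (s a i j * x$i * x$j))"
        using R(2) [of x] by (simp flip: sum_distrib_left)
      then show "(\<Sum>i\<in>J. \<Sum>j\<in>J. s a i j * x$a * x$i * x$j) = 2 * x$a * R x"
        "(\<Sum>i\<in>J. \<Sum>j\<in>J. s i a j * x$i * x$a * x$j) = 2 * x$a * R x"
        "(\<Sum>i\<in>J. \<Sum>j\<in>J. s i j a * x$i * x$j * x$a) = 2 * x$a * R x"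
        using sym by (simp_all add: mult_ac)
    qed
    have "(\<Sum>i\<in>insert a J. \<Sum>j\<in>insert a J. \<Sum>k\<in>insert a J. s i j k * x$i * x$j * x$k)
      = s a a a * x$a * x$a * x$a + 3 * (2 * (x$a)\<^sup>2 * H) + 3 * (2 * x$a * R x) + 6 * Q x"
      using insert.hyps by (simp add: sum.distrib Q(2) l q)
    then show ?thesis
      by (simp add: P_def m H_def [symmetric] power2_eq_square algebra_simps)
  qed
  ultimately show ?case
    by blast
qed

lemma cub_6:
  assumes "integral_tensor s"
  shows "tri s x x x = 6 * cub s x"
proof -
  have "6 dvd tri s x x x"
    using cubic_sixth [OF assms, of UNIV] by (auto simp: tri_def)
  then show ?thesis
    by (simp add: cub_def)
qed

lemma dcub_2:
  assumes "integral_tensor s"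
  shows "tri s x x y = 2 * dcub s x y"
proof -
  have sym: "symmetric_coeffs s"
    using assms by (simp add: integral_tensor_def)
  have "\<exists>Q. hpoly UNIV 2 Q \<and> (\<forall>x. (\<Sum>i\<in>UNIV. \<Sum>j\<in>UNIV. (\<Sum>k\<in>UNIV. s i j k * y$k) * x$i * x$j) = 2 * Q x)"
  proof (rule quadratic_half)
    show "(\<Sum>k\<in>UNIV. s i j k * y$k) = (\<Sum>k\<in>UNIV. s j i k * y$k)" for i j
      using sym by (metis symmetric_coeffs_def)
    show "2 dvd (\<Sum>k\<in>UNIV. s i i k * y$k)" for i
      using assms by (intro dvd_sum) (simp add: integral_tensor_def)
  qed simp
  moreover have "tri s x x y = (\<Sum>i\<in>UNIV. \<Sum>j\<in>UNIV. (\<Sum>k\<in>UNIV. s i j k * y$k) * x$i * x$j)"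
    by (simp add: tri_def sum_distrib_left sum_distrib_right mult_ac)
  ultimately have "2 dvd tri s x x y"
    by auto
  then show ?thesis
    by (simp add: dcub_def)
qed

lemma cub_expand:
  assumes "integral_tensor s"
  shows "cub s (x + t *s y) = cub s x + t * dcub s x y + t\<^sup>2 * dcub s y x + t ^ 3 * cub s y"
proof -
  have "6 * cub s (x + t *s y) = 6 * (cub s x + t * dcub s x y + t\<^sup>2 * dcub s y x + t ^ 3 * cub s y)"
    using tri_expand [of s x t y] assms
    by (simp add: cub_6 [OF assms] dcub_2 [OF assms] integral_tensor_def algebra_simps)
  then show ?thesis
    by simp
qed

lemma dcub_expand:
  assumes "integral_tensor s"
  shows "dcub s (x + t *s z) y = dcub s x y + t * tri s x z y + t\<^sup>2 * dcub s z y"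
proof -
  have "symmetric_coeffs s"
    using assms by (simp add: integral_tensor_def)
  then have "tri s z x y = tri s x z y"
    by (rule tri_swap12)
  then have "2 * dcub s (x + t *s z) y = 2 * (dcub s x y + t * tri s x z y + t\<^sup>2 * dcub s z y)"
    by (simp add: tri_linear power2_eq_square algebra_simps flip: dcub_2 [OF assms])
  then show ?thesis
    by simp
qed

lemma dcub_self:
  assumes "integral_tensor s"
  shows "dcub s x x = 3 * cub s x"
  using cub_6 [OF assms, of x] dcub_2 [OF assms, of x x] by simp

lemma cub_scale: "integral_tensor s \<Longrightarrow> cub s (c *s x) = c ^ 3 * cub s x"
  using cub_6 [of s x] cub_6 [of s "c *s x"] by (simp add: tri_linear power3_eq_cube)

text \<open>A nonsingular p-adic zero in finite terms: zeros modulo every power of \<open>p\<close>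
  at which the derivative in one fixed direction \<open>y\<close> has valuation at most
  \<open>l\<close>. The vector \<open>x\<close> may depend on \<open>K\<close>, so no limit in the
  p-adic integers has to be formed.\<close>

definition padic_zero :: "nat \<Rightarrow> ('n::finite \<Rightarrow> 'n \<Rightarrow> 'n \<Rightarrow> int) \<Rightarrow> bool" where
  "padic_zero p s \<longleftrightarrow> (\<exists>y l. \<forall>K. \<exists>x. int p ^ K dvd cub s x \<and> \<not> int p ^ Suc l dvd dcub s x y)"

lemma hensel_padic_zero:
  assumes p: "prime p" and s: "integral_tensor s"
    and x: "int p dvd cub s x" "\<not> int p dvd dcub s x y"
  shows "padic_zero p s"
proof -
  have *: "\<exists>z. int p ^ Suc K dvd cub s z \<and> \<not> int p dvd dcub s z y" for K
  proof (induction K)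
    case 0
    then show ?case
      using x by auto
  next
    case (Suc K)
    then obtain z m where z: "cub s z = int p ^ Suc K * m" "\<not> int p dvd dcub s z y"
      by (auto elim: dvdE)
    have "coprime (dcub s z y) (int p)"
      using z(2) p by (simp add: coprime_commute prime_imp_coprime)
    then obtain c where c: "[dcub s z y * c = 1] (mod int p)"
      by (meson cong_solve_coprime_int)
    \<comment> \<open>Newton's correction: \<open>c\<close> inverts the derivative modulo
      \<open>p\<close>, so the linear term cancels the value modulo the next power, and
      \<open>t\<close> squared is already divisible by that power.\<close>
    define t where "t = int p ^ Suc K * (- m * c)"
    have "cub s (z + t *s y) = cub s z + t * dcub s z y + t\<^sup>2 * (dcub s y z + t * cub s y)"
      by (simp add: cub_expand [OF s] power2_eq_square power3_eq_cube algebra_simps)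
    moreover have "int p ^ Suc (Suc K) dvd t\<^sup>2 * (dcub s y z + t * cub s y)"
    proof -
      have "int p ^ Suc (Suc K) dvd int p ^ (2 * Suc K)"
        by (rule le_imp_power_dvd) simp
      then have "int p ^ Suc (Suc K) dvd t\<^sup>2"
        by (simp add: t_def power_mult_distrib power_mult [symmetric] mult.commute power2_eq_square
              flip: power_add mult_2)
      then show ?thesis
        by simp
    qed
    moreover have "int p ^ Suc (Suc K) dvd cub s z + t * dcub s z y"
    proof -
      have "cub s z + t * dcub s z y = int p ^ Suc K * (m * (1 - dcub s z y * c))"
        by (simp add: z(1) t_def algebra_simps)
      moreover have "int p dvd 1 - dcub s z y * c"
        using c by (metis cong_iff_dvd_diff cong_sym)
      ultimately show ?thesis
        by (simp add: mult.commute mult_dvd_mono)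
    qed
    ultimately have "int p ^ Suc (Suc K) dvd cub s (z + t *s y)"
      by (metis dvd_add)
    moreover have "\<not> int p dvd dcub s (z + t *s y) y"
    proof -
      have "int p dvd t"
        by (simp add: t_def)
      then have "int p dvd t * tri s z y y + t\<^sup>2 * dcub s y y"
        by (simp add: power2_eq_square)
      then show ?thesis
        using z(2) by (simp add: dcub_expand [OF s] add.assoc dvd_add_left_iff)
    qed
    ultimately show ?case
      by blast
  qed
  have "\<exists>z. int p ^ K dvd cub s z \<and> \<not> int p ^ Suc 0 dvd dcub s z y" for K
    using * [of K] by (metis dvd_trans le_imp_power_dvd lessI less_imp_le power_one_right One_nat_def)
  then show ?thesis
    unfolding padic_zero_def by blast
qed

text \<open>A zero modulo \<open>p\<close> outside the radical of the form modulo \<open>p\<close> would lift by Hensel's lemma.\<close>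

lemma zero_in_radical:
  assumes p: "prime p" and s: "integral_tensor s" and "\<not> padic_zero p s" and v: "int p dvd cub s v"
  shows "int p dvd dcub s v y" and "int p dvd dcub s y v" and "int p dvd tri s y z v"
proof -
  have 1: "int p dvd dcub s v y" for y
    using assms hensel_padic_zero by blast
  have 2: "int p dvd dcub s y v" for y
  proof (rule ccontr)
    assume n: "\<not> int p dvd dcub s y v"
    then have "coprime (dcub s y v) (int p)"
      using p by (simp add: coprime_commute prime_imp_coprime)
    then obtain c where c: "[dcub s y v * c = 1] (mod int p)"
      by (meson cong_solve_coprime_int)
    \<comment> \<open>The quadratic and cubic terms of \<open>cub s (y + t *s v)\<close> vanish
      modulo \<open>p\<close> by fact 1 and the hypothesis on \<open>v\<close>, so this
      \<open>t\<close> produces a zero modulo \<open>p\<close>. Its derivative in direction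
      \<open>v\<close> is still a unit, and Hensel's lemma gives the contradiction.\<close>
    define t where "t = - cub s y * c"
    have "cub s y + t * dcub s y v = cub s y * (1 - dcub s y v * c)"
      by (simp add: t_def algebra_simps)
    moreover have "int p dvd 1 - dcub s y v * c"
      using c by (metis cong_iff_dvd_diff cong_sym)
    ultimately have "int p dvd cub s y + t * dcub s y v"
      by simp
    then have "int p dvd cub s (y + t *s v)"
      using 1 v by (simp add: cub_expand [OF s])
    moreover have "\<not> int p dvd dcub s (y + t *s v) v"
    proof -
      have "symmetric_coeffs s"
        using s by (simp add: integral_tensor_def)
      then have "tri s y v v = tri s v v y"
        using tri_swap12 tri_swap23 by metis
      then have "int p dvd t * tri s y v v + t\<^sup>2 * dcub s v v"
        using 1 v by (simp add: dcub_2 [OF s] dcub_self [OF s])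
      then show ?thesis
        using n by (simp add: dcub_expand [OF s] add.assoc dvd_add_left_iff)
    qed
    ultimately show False
      using assms hensel_padic_zero by blast
  qed
  show "int p dvd dcub s v y" "int p dvd dcub s y v"
    by (fact 1 2)+
  \<comment> \<open>Polarisation of the quadratic form \<open>dcub s y v\<close> in
    \<open>y\<close>, which needs no division by 2.\<close>
  have "tri s y z v = dcub s (y + z) v - dcub s y v - dcub s z v"
    using dcub_expand [OF s, of y 1 z v] by simp
  then show "int p dvd tri s y z v"
    using 2 by simp
qed

section \<open>Hessians and linear substitutions\<close>

definition hess :: "('n::finite \<Rightarrow> 'n \<Rightarrow> 'n \<Rightarrow> int) \<Rightarrow> int^'n \<Rightarrow> int^'n^'n" where
  "hess s x = (\<chi> j k. \<Sum>i\<in>UNIV. s i j k * x$i)"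

text \<open>The coefficient tensor after the substitution \<open>T\<close>; see
  \<open>tri_pull\<close>.\<close>

definition pull :: "int^'n^'n \<Rightarrow> ('n::finite \<Rightarrow> 'n \<Rightarrow> 'n \<Rightarrow> int) \<Rightarrow> 'n \<Rightarrow> 'n \<Rightarrow> 'n \<Rightarrow> int" where
  "pull T s i j k = tri s (column i T) (column j T) (column k T)"

lemma tri_pull: "tri (pull T s) x y z = tri s (T *v x) (T *v y) (T *v z)"
  unfolding matrix_mult_sum tri_def [of "pull T s"] tri_sum1
  unfolding tri_sum2
  unfolding tri_sum3
  by (simp add: tri_linear pull_def mult_ac)

lemma integral_pull:
  assumes "integral_tensor s"
  shows "integral_tensor (pull T s)"
proof -
  have sym: "symmetric_coeffs s"
    using assms by (simp add: integral_tensor_def)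
  have "symmetric_coeffs (pull T s)"
    unfolding symmetric_coeffs_def [of "pull T s"] pull_def
    by (intro allI conjI) (rule tri_swap12 [OF sym], rule tri_swap23 [OF sym])
  then show ?thesis
    by (simp add: integral_tensor_def pull_def cub_6 [OF assms] dcub_2 [OF assms])
qed

lemma transpose_hess_mult:
  "(transpose A ** hess s x ** B)$j$k = tri s x (column j A) (column k B)"
proof -
  have "(transpose A ** hess s x ** B)$j$k
      = (\<Sum>b\<in>UNIV. \<Sum>a\<in>UNIV. \<Sum>i\<in>UNIV. s i a b * x$i * A$a$j * B$b$k)"
    by (simp add: matrix_matrix_mult_def transpose_def hess_def sum_distrib_left sum_distrib_right mult_ac)
  also have "\<dots> = (\<Sum>b\<in>UNIV. \<Sum>i\<in>UNIV. \<Sum>a\<in>UNIV. s i a b * x$i * A$a$j * B$b$k)"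
    by (rule sum.cong [OF refl]) (rule sum.swap)
  also have "\<dots> = (\<Sum>i\<in>UNIV. \<Sum>b\<in>UNIV. \<Sum>a\<in>UNIV. s i a b * x$i * A$a$j * B$b$k)"
    by (rule sum.swap)
  also have "\<dots> = (\<Sum>i\<in>UNIV. \<Sum>a\<in>UNIV. \<Sum>b\<in>UNIV. s i a b * x$i * A$a$j * B$b$k)"
    by (rule sum.cong [OF refl]) (rule sum.swap)
  finally show ?thesis
    by (simp add: tri_def column_def)
qed

lemma det_smult_matrix: "det (\<chi> i j. c * A$i$j) = c ^ CARD('n) * det A"
  for A :: "'a::comm_ring_1^'n^'n"
proof -
  have "(\<chi> i j. c * A$i$j) = (\<chi> i. c *s (A$i))"
    by (simp add: vec_eq_iff)
  then show ?thesis
    by (simp add: det_rows_mul [of "\<lambda>_. c" "\<lambda>i. A$i"])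
qed

lemma det_hess_scale: "det (hess s (c *s x)) = c ^ CARD('n) * det (hess s (x :: int^'n))"
proof -
  have "hess s (c *s x) = (\<chi> i j. c * hess s x$i$j)"
    by (simp add: hess_def vec_eq_iff sum_distrib_left mult_ac)
  then show ?thesis
    by (simp add: det_smult_matrix)
qed

text \<open>Covariance of the Hessian: \<open>transpose T ** hess s (T *v x) ** T\<close> is
  \<open>c\<close> times the Hessian of \<open>s'\<close> at \<open>x\<close>. With \<open>c\<close>
  a power of \<open>p\<close> this is the balance sheet of a rescaling step.\<close>

lemma det_hess_transform:
  fixes T :: "int^'n^'n"
  assumes "\<And>x y z. tri s (T *v x) (T *v y) (T *v z) = c * tri s' x y z"
  shows "(det T)\<^sup>2 * det (hess s (T *v x)) = c ^ CARD('n) * det (hess s' x)"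
proof -
  have col: "column j T = T *v axis j 1" for j
    by (simp add: column_def vec_eq_iff matrix_vector_mult_def axis_def if_distrib cong: if_cong)
  have "(transpose T ** hess s (T *v x) ** T)$j$k = c * hess s' x$j$k" for j k
  proof -
    have "hess s' x$j$k = tri s' x (axis j 1) (axis k 1)"
      using transpose_hess_mult [of "mat 1" s' x "mat 1" j k]
      by (simp add: transpose_mat) (simp add: column_def mat_def axis_def eq_commute cong: if_cong)
    then show ?thesis
      by (simp add: transpose_hess_mult col assms)
  qed
  then have "transpose T ** hess s (T *v x) ** T = (\<chi> j k. c * hess s' x$j$k)"
    by (simp add: vec_eq_iff)
  then have "det (transpose T ** hess s (T *v x) ** T) = c ^ CARD('n) * det (hess s' x)"
    by (simp add: det_smult_matrix)
  then show ?thesis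
    by (simp add: det_mul power2_eq_square mult_ac)
qed

text \<open>Zeros modulo \<open>p\<close> lie in the radical, so the set \<open>L\<close> of all of
  them is closed under addition and has an adapted basis. The substitution \<open>T\<close> keeps
  the directions in \<open>L\<close> and scales the others by \<open>p\<close>. The last property
  says that every zero modulo \<open>p\<close> lies, up to a factor prime to \<open>p\<close>, in
  the image of \<open>T\<close>; it allows a vector to be carried through several steps.\<close>

lemma radical_step:
  fixes s :: "'n::finite \<Rightarrow> 'n \<Rightarrow> 'n \<Rightarrow> int"
  assumes p: "prime p" and s: "integral_tensor s" and nz: "\<not> padic_zero p s"
  obtains T s' u m where "det T = u * int p ^ m" "\<not> int p dvd u" "m \<le> 3"
    "integral_tensor s'" "\<not> padic_zero p s'"
    "\<And>x y z. tri s (T *v x) (T *v y) (T *v z) = int p * tri s' x y z"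
    "\<And>x. int p dvd cub s x \<Longrightarrow> \<exists>u y. \<not> int p dvd u \<and> u *s x = T *v y"
proof -
  have pi: "prime (int p)"
    using p by simp
  have p0: "int p > 0"
    using p by (simp add: prime_gt_0_nat)
  define L where "L = {v. int p dvd cub s v}"
  have Ladd: "x + y \<in> L" if "x \<in> L" "y \<in> L" for x y
    using that zero_in_radical(1) [OF p s nz, of x y] zero_in_radical(1) [OF p s nz, of y x]
      cub_expand [OF s, of x 1 y] by (simp add: L_def)
  have Lscale: "k *s x \<in> L" if "x \<in> L" for x k
    using that by (simp add: L_def cub_scale [OF s])
  obtain U I where U: "\<not> int p dvd det U" "\<And>i. i \<in> I \<Longrightarrow> column i U \<in> L"
    "\<And>z j. U *v z \<in> L \<Longrightarrow> j \<notin> I \<Longrightarrow> int p dvd z$j"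
    using adapted_basis [OF pi, of L] Ladd Lscale by blast
  have card3: "card (- I) \<le> 3"
  proof (rule ccontr)
    \<comment> \<open>With more than three directions outside \<open>L\<close>, Chevalley's theorem
      finds a zero modulo \<open>p\<close> among them. It would be an element of \<open>L\<close>
      with a coordinate outside \<open>I\<close> prime to \<open>p\<close>, against the choice of
      \<open>U\<close>.\<close>
    assume c: "\<not> card (- I) \<le> 3"
    obtain Q where Q: "hpoly (- I) 3 Q"
      "\<And>x. (\<Sum>i\<in>-I. \<Sum>j\<in>-I. \<Sum>k\<in>-I. pull U s i j k * x$i * x$j * x$k) = 6 * Q x"
      using cubic_sixth [OF integral_pull [OF s], of "- I" U] by auto
    have "Q 0 = 0"
      using Q(2) [of 0] by simp
    then obtain x where x: "\<And>i. i \<notin> - I \<Longrightarrow> x$i = 0" "\<exists>j\<in>-I. \<not> int p dvd x$j" "int p dvd Q x"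
      using chevalley [OF p Q(1)] c by (metis not_le)
    have "6 * cub s (U *v x) = tri (pull U s) x x x"
      by (simp add: tri_pull cub_6 [OF s])
    also have "\<dots> = (\<Sum>i\<in>-I. \<Sum>j\<in>-I. \<Sum>k\<in>-I. pull U s i j k * x$i * x$j * x$k)"
    proof -
      have "(\<Sum>k\<in>UNIV. pull U s i j k * x$i * x$j * x$k) = (\<Sum>k\<in>-I. pull U s i j k * x$i * x$j * x$k)" for i j
        using x(1) by (intro sum.mono_neutral_right) auto
      moreover have "(\<Sum>j\<in>UNIV. \<Sum>k\<in>-I. pull U s i j k * x$i * x$j * x$k) = (\<Sum>j\<in>-I. \<Sum>k\<in>-I. pull U s i j k * x$i * x$j * x$k)" for i
        using x(1) by (intro sum.mono_neutral_right) auto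
      moreover have "(\<Sum>i\<in>UNIV. \<Sum>j\<in>-I. \<Sum>k\<in>-I. pull U s i j k * x$i * x$j * x$k) = (\<Sum>i\<in>-I. \<Sum>j\<in>-I. \<Sum>k\<in>-I. pull U s i j k * x$i * x$j * x$k)"
        using x(1) by (intro sum.mono_neutral_right) auto
      ultimately show ?thesis
        by (simp add: tri_def)
    qed
    finally have "cub s (U *v x) = Q x"
      by (simp add: Q(2))
    then have "U *v x \<in> L"
      using x(3) by (simp add: L_def)
    then show False
      using U(3) x(2) by blast
  qed
  \<comment> \<open>Now every column of \<open>T\<close> belongs to \<open>L\<close>, hence to the
    radical modulo \<open>p\<close>, so all coefficients of the substituted tensor are divisible by
    \<open>p\<close>.\<close>
  define d where "d j = (if j \<in> I then 1 else int p)" for j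
  define T where "T = U ** (\<chi> i j. if i = j then d j else 0)"
  have Tvec: "T *v y = U *v (\<chi> j. d j * y$j)" for y
  proof -
    have "(\<chi> i j. if i = j then d j else 0) *v y = (\<chi> j. d j * y$j)"
      by (simp add: matrix_vector_mult_def vec_eq_iff if_distrib if_distribR cong: if_cong)
    then show ?thesis
      by (simp add: T_def flip: matrix_vector_mul_assoc)
  qed
  have "det (\<chi> i j. if i = j then d j else 0 :: int^'n^'n) = (\<Prod>i\<in>UNIV. d i)"
    by (subst det_diagonal) auto
  also have "\<dots> = int p ^ card (- I)"
  proof -
    have "(\<Prod>i\<in>UNIV. d i) = (\<Prod>i\<in>-I. d i)"
      by (rule prod.mono_neutral_right) (auto simp: d_def)
    also have "\<dots> = int p ^ card (- I)"
      by (simp add: d_def)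
    finally show ?thesis .
  qed
  finally have detT: "det T = det U * int p ^ card (- I)"
    by (simp add: T_def det_mul)
  have colT: "column j T \<in> L" for j
  proof -
    have "column j T = d j *s column j U"
      by (simp add: T_def matrix_matrix_mult_def column_def vec_eq_iff if_distrib cong: if_cong)
    moreover have "int p *s x \<in> L" for x
      using p by (simp add: L_def cub_scale [OF s] prime_gt_0_nat)
    ultimately show ?thesis
      using U(2) by (auto simp: d_def)
  qed
  define s' where "s' i j k = pull T s i j k div int p" for i j k
  have s': "pull T s i j k = int p * s' i j k" for i j k
  proof -
    have "int p dvd pull T s i j k"
      using zero_in_radical(3) [OF p s nz] colT [of k] by (simp add: L_def pull_def)
    then show ?thesis
      by (simp add: s'_def)
  qed
  have int_s': "integral_tensor s'"
  proof -
    have "integral_tensor (pull T s)"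
      by (rule integral_pull [OF s])
    then have "symmetric_coeffs s'"
      by (simp add: integral_tensor_def symmetric_coeffs_def s'_def)
    moreover have "6 dvd s' i i i" for i
    proof -
      obtain h where "cub s (column i T) = int p * h"
        using colT [of i] unfolding L_def by blast
      then have "int p * s' i i i = int p * (6 * h)"
        by (simp add: pull_def cub_6 [OF s] flip: s')
      then show ?thesis
        using p0 by simp
    qed
    moreover have "2 dvd s' i i j" for i j
    proof -
      obtain h where "dcub s (column i T) (column j T) = int p * h"
        using zero_in_radical(1) [OF p s nz] colT [of i] unfolding L_def by blast
      then have "int p * s' i i j = int p * (2 * h)"
        by (simp add: pull_def dcub_2 [OF s] flip: s')
      then show ?thesis
        using p0 by simp
    qed
    ultimately show ?thesis
      by (simp add: integral_tensor_def)
  qed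
  have tri': "tri s (T *v x) (T *v y) (T *v z) = int p * tri s' x y z" for x y z
    by (simp add: tri_def [of "pull T s"] tri_def [of s'] s' sum_distrib_left mult_ac flip: tri_pull)
  \<comment> \<open>\<open>T\<close> carries a nonsingular zero of \<open>s'\<close> to one of
    \<open>s\<close>. Values and derivatives gain one factor \<open>p\<close>, so the bound
    \<open>l\<close> on the valuation becomes \<open>Suc l\<close>.\<close>
  have "\<not> padic_zero p s'"
  proof
    assume "padic_zero p s'"
    then obtain y l where yl: "\<And>K. \<exists>x. int p ^ K dvd cub s' x \<and> \<not> int p ^ Suc l dvd dcub s' x y"
      unfolding padic_zero_def by blast
    have "\<exists>x. int p ^ K dvd cub s x \<and> \<not> int p ^ Suc (Suc l) dvd dcub s x (T *v y)" for K
    proof -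
      obtain x where x: "int p ^ K dvd cub s' x" "\<not> int p ^ Suc l dvd dcub s' x y"
        using yl by blast
      have "cub s (T *v x) = int p * cub s' x"
        using tri' [of x x x] by (simp add: cub_6 [OF s] cub_6 [OF int_s'])
      moreover have "dcub s (T *v x) (T *v y) = int p * dcub s' x y"
        using tri' [of x x y] by (simp add: dcub_2 [OF s] dcub_2 [OF int_s'])
      ultimately show ?thesis
        using x p0 by (intro exI [of _ "T *v x"]) auto
    qed
    then show False
      using nz unfolding padic_zero_def by blast
  qed
  moreover have "\<exists>u y. \<not> int p dvd u \<and> u *s x = T *v y" if "int p dvd cub s x" for x
  proof -
    have "det U \<noteq> 0"
      using U(1) by auto
    then obtain z where z: "U *v z = det U *s x"
      using ex_mult_vec_eq_det by blast
    then have "U *v z \<in> L"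
      using Lscale that by (simp add: L_def)
    then have "int p dvd z$j" if "j \<notin> I" for j
      using U(3) that by blast
    then have "(\<chi> j. d j * (z$j div d j)) = z"
      by (auto simp: vec_eq_iff d_def)
    then have "T *v (\<chi> j. z$j div d j) = det U *s x"
      by (simp add: Tvec z)
    then show ?thesis
      using U(1) by metis
  qed
  ultimately show ?thesis
    using that [OF detT U(1) card3 int_s' _ tri'] by blast
qed

text \<open>Since every anisotropic layer has dimension at most 3, three steps scale at most 9 of the
  \<open>n \<ge> 10\<close> variables by \<open>p\<close> while the form is divided by \<open>p ^ 3\<close>; this strictly decreases the
  \<open>p\<close>-adic valuation of the Hessian.\<close>

lemma hessian_descent:
  fixes s :: "'n::finite \<Rightarrow> 'n \<Rightarrow> 'n \<Rightarrow> int"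
  assumes n: "CARD('n) \<ge> 10" and p: "prime p" and s: "integral_tensor s" and nz: "\<not> padic_zero p s"
    and D: "det (hess s x) \<noteq> 0"
  obtains s' :: "'n \<Rightarrow> 'n \<Rightarrow> 'n \<Rightarrow> int" and y
    where "integral_tensor s'" "\<not> padic_zero p s'" "det (hess s' y) \<noteq> 0"
    "multiplicity (int p) (det (hess s' y)) < multiplicity (int p) (det (hess s x))"
proof -
  have pi: "prime_elem (int p)"
    using p by simp
  have p0: "int p \<noteq> 0"
    using p by auto
  obtain T1 s1 u1 m1 where 1: "det T1 = u1 * int p ^ m1" "\<not> int p dvd u1" "m1 \<le> 3"
    "integral_tensor s1" "\<not> padic_zero p s1"
    "\<And>x y z. tri s (T1 *v x) (T1 *v y) (T1 *v z) = int p * tri s1 x y z"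
    "\<And>x. int p dvd cub s x \<Longrightarrow> \<exists>u y. \<not> int p dvd u \<and> u *s x = T1 *v y"
    using radical_step [OF p s nz] by metis
  obtain T2 s2 u2 m2 where 2: "det T2 = u2 * int p ^ m2" "\<not> int p dvd u2" "m2 \<le> 3"
    "integral_tensor s2" "\<not> padic_zero p s2"
    "\<And>x y z. tri s1 (T2 *v x) (T2 *v y) (T2 *v z) = int p * tri s2 x y z"
    "\<And>x. int p dvd cub s1 x \<Longrightarrow> \<exists>u y. \<not> int p dvd u \<and> u *s x = T2 *v y"
    using radical_step [OF p 1(4) 1(5)] by metis
  obtain T3 s3 u3 m3 where 3: "det T3 = u3 * int p ^ m3" "\<not> int p dvd u3" "m3 \<le> 3"
    "integral_tensor s3" "\<not> padic_zero p s3"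
    "\<And>x y z. tri s2 (T3 *v x) (T3 *v y) (T3 *v z) = int p * tri s3 x y z"
    "\<And>x. int p dvd cub s2 x \<Longrightarrow> \<exists>u y. \<not> int p dvd u \<and> u *s x = T3 *v y"
    using radical_step [OF p 2(4) 2(5)] by metis
  have c1: "cub s (T1 *v x) = int p * cub s1 x" for x
    using 1(6) [of x x x] by (simp add: cub_6 [OF s] cub_6 [OF 1(4)])
  have c2: "cub s1 (T2 *v x) = int p * cub s2 x" for x
    using 2(6) [of x x x] by (simp add: cub_6 [OF 2(4)] cub_6 [OF 1(4)])
  \<comment> \<open>The start is \<open>p x\<close> and not \<open>x\<close>: its value is divisible
    by \<open>p ^ 3\<close>, and each step spends one of these factors, so the vector remains a zero
    modulo \<open>p\<close> until the third step.\<close>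
  have "int p dvd cub s (int p *s x)"
    using p0 by (simp add: cub_scale [OF s])
  then obtain v1 y1 where y1: "\<not> int p dvd v1" "v1 *s (int p *s x) = T1 *v y1"
    using 1(7) by blast
  have "int p * cub s1 y1 = int p * (int p * (int p * v1 ^ 3 * cub s x))"
    by (simp only: c1 [symmetric] y1(2) [symmetric]) (simp add: cub_scale [OF s] power3_eq_cube)
  then have y1': "cub s1 y1 = int p * (int p * v1 ^ 3 * cub s x)"
    using p0 by simp
  then obtain v2 y2 where y2: "\<not> int p dvd v2" "v2 *s y1 = T2 *v y2"
    using 2(7) by (metis dvd_triv_left)
  have "int p * cub s2 y2 = int p * (int p * (v2 ^ 3 * v1 ^ 3 * cub s x))"
    by (simp only: c2 [symmetric] y2(2) [symmetric]) (simp add: cub_scale [OF 1(4)] y1' mult_ac)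
  then have "int p dvd cub s2 y2"
    using p0 by simp
  then obtain v3 y3 where y3: "\<not> int p dvd v3" "v3 *s y2 = T3 *v y3"
    using 3(7) by blast
  define T where "T = T1 ** T2 ** T3"
  define v where "v = v1 * v2 * v3"
  define m where "m = m1 + m2 + m3"
  have "T *v y3 = T1 *v (T2 *v (v3 *s y2))"
    by (simp add: T_def y3(2) matrix_vector_mul_assoc matrix_mul_assoc)
  also have "\<dots> = v3 *s (v2 *s (T1 *v y1))"
    by (simp add: matrix_vector_mult_smult flip: y2(2))
  finally have Ty: "T *v y3 = (v * int p) *s x"
    by (simp add: v_def mult_ac flip: y1(2))
  have "tri s (T *v x) (T *v y) (T *v z) = int p ^ 3 * tri s3 x y z" for x y z
    using 1(6) 2(6) 3(6) by (simp add: T_def power3_eq_cube flip: matrix_vector_mul_assoc)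
  then have "(det T)\<^sup>2 * det (hess s ((v * int p) *s x)) = (int p ^ 3) ^ CARD('n) * det (hess s3 y3)"
    using det_hess_transform [of s T "int p ^ 3" s3 y3] by (simp add: Ty)
  moreover have "det T = u1 * u2 * u3 * int p ^ m"
    by (simp add: T_def det_mul 1(1) 2(1) 3(1) m_def power_add)
  moreover have "(int p ^ 3) ^ CARD('n) = int p ^ (3 * CARD('n))"
    by (simp add: power_mult)
  moreover have "(u1 * u2 * u3 * int p ^ m)\<^sup>2 = (u1 * u2 * u3)\<^sup>2 * int p ^ (2 * m)"
    by (simp add: power_mult_distrib power_mult [symmetric] mult.commute)
  \<comment> \<open>Up to factors prime to \<open>p\<close> the exponents of \<open>p\<close> are
    \<open>2 * m\<close> from \<open>det T\<close> and \<open>n\<close> from the vector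
    \<open>p x\<close> on the left, and \<open>3 * n\<close> from dividing the form three times on
    the right.\<close>
  ultimately have eq: "(u1 * u2 * u3)\<^sup>2 * v ^ CARD('n) * int p ^ (2 * m + CARD('n)) * det (hess s x)
      = int p ^ (3 * CARD('n)) * det (hess s3 y3)"
    by (simp add: det_hess_scale power_mult_distrib [of v] power_add mult.assoc mult.left_commute)
  have unit: "\<not> int p dvd (u1 * u2 * u3)\<^sup>2 * v ^ CARD('n)"
    using 1(2) 2(2) 3(2) y1(1) y2(1) y3(1) p
    by (auto simp: v_def prime_dvd_mult_iff prime_dvd_power_iff)
  then have nz': "(u1 * u2 * u3)\<^sup>2 * v ^ CARD('n) \<noteq> 0"
    by (metis dvd_0_right)
  have D3: "det (hess s3 y3) \<noteq> 0"
    using eq nz' D p0 by auto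
  \<comment> \<open>Each step contributes at most 3, so \<open>m \<le> 9\<close>. This gives
    \<open>2 * m + n < 3 * n\<close>, which is where ten variables are needed.\<close>
  have m9: "m < CARD('n)"
    using 1(3) 2(3) 3(3) n by (simp add: m_def)
  have "multiplicity (int p) ((u1 * u2 * u3)\<^sup>2 * v ^ CARD('n) * (int p ^ (2 * m + CARD('n)) * det (hess s x)))
      = 2 * m + CARD('n) + multiplicity (int p) (det (hess s x))"
    using nz' unit D p0 pi
    by (simp add: prime_elem_multiplicity_mult_distrib not_dvd_imp_multiplicity_0
          prime_elem_multiplicity_power_distrib del: power_mult_distrib)
  moreover have "multiplicity (int p) (int p ^ (3 * CARD('n)) * det (hess s3 y3))
      = 3 * CARD('n) + multiplicity (int p) (det (hess s3 y3))"
    using D3 p0 pi by (simp add: prime_elem_multiplicity_mult_distrib prime_elem_multiplicity_power_distrib)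
  ultimately have "3 * CARD('n) + multiplicity (int p) (det (hess s3 y3))
      = 2 * m + CARD('n) + multiplicity (int p) (det (hess s x))"
    using eq by (metis mult.assoc)
  then have "multiplicity (int p) (det (hess s3 y3)) < multiplicity (int p) (det (hess s x))"
    using m9 by linarith
  then show ?thesis
    using that 3(4) 3(5) D3 by blast
qed

theorem padic_zero_exists:
  fixes s :: "'n::finite \<Rightarrow> 'n \<Rightarrow> 'n \<Rightarrow> int"
  assumes "CARD('n) \<ge> 10" "prime p" "integral_tensor s" "det (hess s x) \<noteq> 0"
  shows "padic_zero p s"
  using assms(3,4)
proof (induction "multiplicity (int p) (det (hess s x))" arbitrary: s x rule: less_induct)
  case less
  show ?case
  proof (rule ccontr)
    assume nz: "\<not> padic_zero p s"
    obtain s' :: "'n \<Rightarrow> 'n \<Rightarrow> 'n \<Rightarrow> int" and y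
      where "integral_tensor s'" "\<not> padic_zero p s'" "det (hess s' y) \<noteq> 0"
      "multiplicity (int p) (det (hess s' y)) < multiplicity (int p) (det (hess s x))"
      by (rule hessian_descent [OF assms(1,2) less.prems(1) nz less.prems(2)])
    then show False
      using less.hyps [of s' y] by simp
  qed
qed

section \<open>Gauss sums\<close>

definition e_mod :: "nat \<Rightarrow> int \<Rightarrow> complex" where
  "e_mod q k = e_fun (real_of_int k / real q)"

lemma e_fun_add: "e_fun (x + y) = e_fun x * e_fun y"
  by (simp add: e_fun_def exp_add [symmetric] algebra_simps)

lemma e_fun_cis: "e_fun x = cis (2 * pi * x)"
  by (simp add: e_fun_def cis_conv_exp mult_ac)

lemma e_fun_of_int: "e_fun (of_int k) = 1"
  by (simp add: e_fun_cis cis_multiple_2pi)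

lemma e_mod_add: "e_mod q (a + b) = e_mod q a * e_mod q b"
  by (simp add: e_mod_def e_fun_add add_divide_distrib)

lemma e_mod_0 [simp]: "e_mod q 0 = 1"
  by (simp add: e_mod_def e_fun_def)

lemma norm_e_mod [simp]: "norm (e_mod q a) = 1"
  by (simp add: e_mod_def e_fun_cis)

lemma cnj_e_mod: "cnj (e_mod q a) = e_mod q (- a)"
  by (simp add: e_mod_def e_fun_cis cis_cnj)

lemma e_mod_cong:
  assumes "[a = b] (mod int q)"
  shows "e_mod q a = e_mod q b"
proof (cases "q = 0")
  case True
  then show ?thesis
    using assms by (simp add: cong_def)
next
  case False
  obtain k where "a = b + int q * k"
    using assms by (metis cong_iff_lin cong_sym mult.commute)
  then have "real_of_int a / real q = real_of_int b / real q + of_int k"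
    using False by (simp add: field_simps)
  then show ?thesis
    by (simp add: e_mod_def e_fun_add e_fun_of_int)
qed

lemma e_mod_power: "e_mod q (int m * k) = e_mod q k ^ m"
  by (induction m) (simp_all add: e_mod_add distrib_right)

lemma e_mod_eq_1_iff:
  assumes "q > 0"
  shows "e_mod q k = 1 \<longleftrightarrow> int q dvd k"
proof
  assume "e_mod q k = 1"
  then have "cos (2 * pi * (real_of_int k / real q)) = 1"
    by (simp add: e_mod_def e_fun_cis complex_eq_iff)
  then obtain m where "2 * pi * (real_of_int k / real q) = of_int m * 2 * pi"
    by (auto simp: cos_one_2pi_int)
  then have "real_of_int k = real_of_int (m * int q)"
    using assms by (simp add: field_simps)
  then have "k = m * int q"
    by linarith
  then show "int q dvd k"
    by simp
next
  assume "int q dvd k"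
  then have "e_mod q k = e_mod q 0"
    by (intro e_mod_cong) (simp add: cong_0_iff)
  then show "e_mod q k = 1"
    by simp
qed

text \<open>Orthogonality of characters: a geometric sum over the powers of a \<open>q\<close>-th
  root of unity.\<close>

lemma sum_e_mod:
  assumes "q > 0"
  shows "(\<Sum>t\<in>{0..<int q}. e_mod q (k * t)) = (if int q dvd k then of_nat q else 0)"
proof -
  have "(\<Sum>t\<in>{0..<int q}. e_mod q (k * t)) = (\<Sum>t<q. e_mod q k ^ t)"
    by (rule sum.reindex_bij_witness [of _ int nat]) (auto simp: e_mod_power [symmetric] mult.commute)
  moreover have "e_mod q k ^ q = 1"
    using assms by (simp add: e_mod_eq_1_iff flip: e_mod_power)
  ultimately show ?thesis
    using assms e_mod_eq_1_iff [OF assms, of k] by (auto simp: geometric_sum)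
qed

lemma e_mod_sum: "finite A \<Longrightarrow> e_mod q (\<Sum>i\<in>A. f i) = (\<Prod>i\<in>A. e_mod q (f i))"
  by (induction A rule: finite_induct) (auto simp: e_mod_add)

lemma sum_ibox_prod:
  fixes f :: "'n::finite \<Rightarrow> int \<Rightarrow> 'a::comm_semiring_1"
  shows "(\<Sum>x\<in>ibox q. \<Prod>i\<in>UNIV. f i (x$i)) = (\<Prod>i\<in>UNIV. \<Sum>t\<in>{0..<q}. f i t)"
proof -
  have "inj_on vec_lambda X" for X :: "('n \<Rightarrow> int) set"
    by (simp add: inj_on_def)
  then have "(\<Sum>x\<in>ibox q. \<Prod>i\<in>UNIV. f i (x$i)) = (\<Sum>g\<in>PiE UNIV (\<lambda>_. {0..<q}). \<Prod>i\<in>UNIV. f i (g i))"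
    unfolding ibox_vec by (subst sum.reindex) auto
  also have "\<dots> = (\<Prod>i\<in>UNIV. \<Sum>t\<in>{0..<q}. f i t)"
    by (subst prod_sum_PiE) auto
  finally show ?thesis .
qed

lemma sum_e_mod_linear:
  fixes u :: "int^'n"
  assumes "q > 0"
  shows "(\<Sum>x\<in>ibox (int q). e_mod q (\<Sum>i\<in>UNIV. u$i * x$i))
    = (if \<forall>i. int q dvd u$i then of_nat q ^ CARD('n) else 0)"
proof -
  have "(\<Sum>x\<in>ibox (int q). e_mod q (\<Sum>i\<in>UNIV. u$i * x$i)) = (\<Prod>i\<in>UNIV. \<Sum>t\<in>{0..<int q}. e_mod q (u$i * t))"
    by (simp add: e_mod_sum sum_ibox_prod [of "\<lambda>i t. e_mod q (u$i * t)"])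
  also have "\<dots> = (if \<forall>i. int q dvd u$i then of_nat q ^ CARD('n) else 0)"
    using assms by (auto simp: sum_e_mod)
  finally show ?thesis .
qed

section \<open>Sums of periodic functions over residue boxes\<close>

definition vcong :: "int \<Rightarrow> int^'n \<Rightarrow> int^'n \<Rightarrow> bool" where
  "vcong q x y \<longleftrightarrow> (\<forall>i. [x$i = y$i] (mod q))"

definition periodic :: "int \<Rightarrow> (int^'n \<Rightarrow> 'a) \<Rightarrow> bool" where
  "periodic q F \<longleftrightarrow> (\<forall>x y. vcong q x y \<longrightarrow> F x = F y)"

definition vmod :: "int^'n \<Rightarrow> int \<Rightarrow> int^'n" where
  "vmod x q = (\<chi> i. x$i mod q)"

lemma vcong_vmod [simp]: "vcong q (vmod x q) x"
  by (simp add: vcong_def vmod_def)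

lemma vmod_ibox [simp]: "q > 0 \<Longrightarrow> vmod x q \<in> ibox q"
  by (simp add: vmod_def ibox_def)

lemma vcong_add: "vcong q x y \<Longrightarrow> vcong q x' y' \<Longrightarrow> vcong q (x + x') (y + y')"
  by (auto simp: vcong_def intro: cong_add)

lemma sum_ibox_shift:
  fixes F :: "int^'n \<Rightarrow> 'a::comm_monoid_add"
  assumes "q > 0" "periodic q F"
  shows "(\<Sum>x\<in>ibox q. F (x + h)) = (\<Sum>x\<in>ibox q. F x)"
proof (rule sum.reindex_bij_witness [of _ "\<lambda>x. vmod (x - h) q" "\<lambda>x. vmod (x + h) q"])
  fix x :: "int^'n" assume x: "x \<in> ibox q"
  show "vmod (vmod (x + h) q - h) q = x"
    using x by (simp add: vmod_def vec_eq_iff ibox_def mod_diff_left_eq)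
  show "vmod (vmod (x - h) q + h) q = x"
    using x by (simp add: vmod_def vec_eq_iff ibox_def mod_add_left_eq)
  show "F (vmod (x + h) q) = F (x + h)"
    using assms(2) by (auto simp: periodic_def)
qed (use assms in auto)

text \<open>Each point of the large box is uniquely \<open>y + q z\<close> with \<open>y\<close> a
  residue modulo \<open>q\<close> and \<open>z\<close> in the box of side \<open>m\<close>;
  periodicity removes \<open>z\<close>.\<close>

lemma sum_ibox_multiple:
  fixes F :: "int^'n \<Rightarrow> 'a::comm_semiring_1"
  assumes "q > 0" "m > 0" "periodic (int q) F"
  shows "(\<Sum>x\<in>ibox (int (m * q)). F x) = of_nat m ^ CARD('n) * (\<Sum>x\<in>ibox (int q). F x)"
proof -
  have "(\<Sum>x\<in>ibox (int (m * q)). F x) = (\<Sum>(y, z)\<in>ibox (int q) \<times> (ibox (int m) :: (int^'n) set). F y)"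
  proof (rule sum.reindex_bij_witness [where
        i = "\<lambda>b :: (int^'n) \<times> (int^'n). case b of (y, z) \<Rightarrow> y + int q *s z" and
        j = "\<lambda>x :: int^'n. (vmod x (int q), (\<chi> i. x$i div int q) :: int^'n)"])
    fix x :: "int^'n" assume x: "x \<in> ibox (int (m * q))"
    show "(case (vmod x (int q), \<chi> i. x$i div int q) of (y, z) \<Rightarrow> y + int q *s z) = x"
      by (simp add: vmod_def vec_eq_iff)
    have "x$i div int q < int m" for i
    proof -
      have "int q * (x$i div int q) \<le> x$i"
        using assms(1) mult_div_mod_eq [of "int q" "x$i"] pos_mod_sign [of "int q" "x$i"] by linarith
      also have "x$i < int q * int m"
        using x by (simp add: ibox_def mult.commute)
      finally show ?thesis
        using assms(1) by (simp add: mult_less_cancel_left_pos)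
    qed
    moreover have "0 \<le> x$i div int q" for i
      using x assms(1) by (simp add: ibox_def pos_imp_zdiv_nonneg_iff)
    ultimately show "(vmod x (int q), \<chi> i. x$i div int q) \<in> ibox (int q) \<times> ibox (int m)"
      using assms(1) by (simp add: ibox_def [of "int m"])
    show "(case (vmod x (int q), \<chi> i. x$i div int q) of (y, z) \<Rightarrow> F y) = F x"
      using assms(3) by (auto simp: periodic_def)
  next
    fix b :: "(int^'n) \<times> (int^'n)" assume b: "b \<in> ibox (int q) \<times> ibox (int m)"
    obtain y z where yz: "b = (y, z)" "y \<in> ibox (int q)" "z \<in> ibox (int m)"
      using b by (cases b) auto
    show "(vmod (case b of (y, z) \<Rightarrow> y + int q *s z) (int q), \<chi> i. (case b of (y, z) \<Rightarrow> y + int q *s z)$i div int q) = (b :: (int^'n) \<times> (int^'n))"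
      using yz assms(1) by (auto simp: vmod_def vec_eq_iff ibox_def)
    have "y$i + int q * z$i < int (m * q)" for i
    proof -
      have "y$i + int q * z$i < int q + int q * z$i"
        using yz(2) by (simp add: ibox_def)
      also have "\<dots> = int q * (z$i + 1)"
        by (simp add: algebra_simps)
      also have "\<dots> \<le> int q * int m"
        using yz(3) by (intro mult_left_mono) (auto simp: ibox_def add1_zle_eq)
      finally show ?thesis
        by (simp add: mult.commute)
    qed
    then show "(case b of (y, z) \<Rightarrow> y + int q *s z) \<in> ibox (int (m * q))"
      using yz by (auto simp: ibox_def)
  qed
  also have "\<dots> = of_nat (card (ibox (int m) :: (int^'n) set)) * (\<Sum>x\<in>ibox (int q). F x)"
    by (simp add: sum.cartesian_product [symmetric] sum_distrib_left)
  finally show ?thesis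
    by (simp add: card_ibox)
qed

lemma tri_cong:
  assumes "vcong q x x'" "vcong q y y'" "vcong q z z'"
  shows "[tri c x y z = tri c x' y' z'] (mod q)"
  unfolding tri_def using assms unfolding vcong_def
  by (intro cong_sum cong_mult cong_refl) auto

lemma gauss_sum_ibox: "gauss_sum c q a = (\<Sum>x\<in>ibox (int q). e_mod q (a * tri c x x x))"
  unfolding gauss_sum_def e_mod_def
  by (rule sum.reindex_bij_witness [of _ "\<lambda>x. ($) x" vec_lambda]) 
     (auto simp: ibox_def cubic_form_def tri_def)

lemma periodic_gauss: "periodic (int q) (\<lambda>x. e_mod q (a * tri c x x x))"
  unfolding periodic_def by (auto intro!: e_mod_cong cong_mult tri_cong)

section \<open>Weyl differencing with short shifts\<close>

definition diff_box :: "nat \<Rightarrow> (int^'n) set" where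
  "diff_box H = {h. \<forall>i. \<bar>h$i\<bar> < int H}"

text \<open>The factor 6 is the one produced by second differences of \<open>tri c x x x\<close>. It
  also makes the coefficients an integral tensor, so the same matrix is the Hessian in the p-adic
  argument.\<close>

definition hm :: "('n::finite \<Rightarrow> 'n \<Rightarrow> 'n \<Rightarrow> int) \<Rightarrow> int^'n \<Rightarrow> int^'n^'n" where
  "hm c h = hess (\<lambda>i j k. 6 * c i j k) h"

lemma finite_diff_box [simp]: "finite (diff_box H :: (int^'n) set)"
proof (rule finite_subset)
  show "diff_box H \<subseteq> (\<lambda>x. x - (\<chi> i. int H)) ` (ibox (2 * int H) :: (int^'n) set)"
  proof
    fix h :: "int^'n" assume "h \<in> diff_box H"
    then have *: "\<bar>h$i\<bar> < int H" for i
      by (simp add: diff_box_def)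
    have "h + (\<chi> i. int H) \<in> ibox (2 * int H)"
      using * by (auto simp: ibox_def) (smt (verit) *)+
    then show "h \<in> (\<lambda>x. x - (\<chi> i. int H)) ` ibox (2 * int H)"
      by (intro image_eqI [of _ _ "h + (\<chi> i. int H)"]) auto
  qed
qed simp

text \<open>Only \<open>6 * tri c x h y\<close> depends on \<open>x\<close>, and it does so
  linearly. The bracket contributes a phase of modulus 1.\<close>

lemma tri_second_difference:
  assumes "symmetric_coeffs c"
  shows "tri c (x + y + h) (x + y + h) (x + y + h) - tri c (x + y) (x + y) (x + y)
      - (tri c (x + h) (x + h) (x + h) - tri c x x x)
    = 6 * tri c x h y + (3 * tri c h h y + 3 * tri c h y y)"
proof -
  have s: "tri c u v w = tri c v u w" "tri c u v w = tri c u w v" for u v w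
    by (rule tri_swap12 [OF assms], rule tri_swap23 [OF assms])
  have "tri c y x h = tri c x h y" "tri c y h x = tri c x h y" "tri c h x y = tri c x h y"
    "tri c h y x = tri c x h y" "tri c x y h = tri c x h y" "tri c y h h = tri c h h y" "tri c h y h = tri c h h y"
    "tri c y y h = tri c h y y" "tri c y h y = tri c h y y"
    using s by metis+
  then show ?thesis
    by (simp add: tri_linear)
qed

lemma tri_linear_form: "6 * a * tri c x h y = (\<Sum>i\<in>UNIV. (a * (hm c h *v y)$i) * x$i)"
  if "symmetric_coeffs c"
proof -
  have "tri c x h y = tri c h x y"
    by (rule tri_swap12 [OF that])
  also have "\<dots> = (\<Sum>j\<in>UNIV. \<Sum>i\<in>UNIV. \<Sum>k\<in>UNIV. c i j k * h$i * x$j * y$k)"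
    unfolding tri_def by (rule sum.swap)
  also have "\<dots> = (\<Sum>j\<in>UNIV. \<Sum>k\<in>UNIV. \<Sum>i\<in>UNIV. c i j k * h$i * x$j * y$k)"
    by (rule sum.cong [OF refl]) (rule sum.swap)
  finally show ?thesis
    by (simp add: hm_def hess_def matrix_vector_mult_def sum_distrib_left sum_distrib_right mult_ac)
qed

text \<open>Squaring the sum of first differences produces second differences, which are linear in
  \<open>x\<close>. The sum over \<open>x\<close> is then complete and vanishes unless
  \<open>y\<close> is in the kernel of \<open>hm c h\<close> modulo \<open>q\<close>; the factor
  \<open>a\<close> disappears because it is prime to \<open>q\<close>.\<close>

lemma norm_difference_sum_le:
  fixes c :: "'n::finite \<Rightarrow> 'n \<Rightarrow> 'n \<Rightarrow> int"
  assumes c: "symmetric_coeffs c" and q: "q > 0" and a: "coprime a (int q)"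
  defines "T \<equiv> \<lambda>h. \<Sum>x\<in>ibox (int q). e_mod q (a * (tri c (x + h) (x + h) (x + h) - tri c x x x))"
  shows "(norm (T h))\<^sup>2 \<le> real q ^ CARD('n) * real (card (kerq (int q) (hm c h)))"
proof -
  let ?X = "ibox (int q) :: (int^'n) set"
  define F where "F x = e_mod q (a * (tri c (x + h) (x + h) (x + h) - tri c x x x))" for x
  have F: "periodic (int q) F"
    unfolding periodic_def F_def
    by (auto intro!: e_mod_cong cong_mult cong_diff tri_cong vcong_add) (auto simp: vcong_def)
  have TF: "T h = (\<Sum>x\<in>?X. F x)"
    by (simp add: T_def F_def)
  have "complex_of_real ((norm (T h))\<^sup>2) = T h * cnj (T h)"
    by (rule complex_norm_square)
  also have "\<dots> = (\<Sum>x\<in>?X. (\<Sum>y\<in>?X. F y) * cnj (F x))"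
    by (simp add: TF sum_distrib_left)
  also have "\<dots> = (\<Sum>x\<in>?X. (\<Sum>y\<in>?X. F (y + x)) * cnj (F x))"
    using q by (simp add: sum_ibox_shift [OF _ F])
  also have "\<dots> = (\<Sum>y\<in>?X. \<Sum>x\<in>?X. F (x + y) * cnj (F x))"
    unfolding sum_distrib_right by (subst sum.swap) (simp add: add.commute)
  finally have "complex_of_real ((norm (T h))\<^sup>2) = (\<Sum>y\<in>?X. \<Sum>x\<in>?X. F (x + y) * cnj (F x))" .
  then have "(norm (T h))\<^sup>2 = norm (\<Sum>y\<in>?X. \<Sum>x\<in>?X. F (x + y) * cnj (F x))"
    by (metis norm_of_real abs_of_nonneg zero_le_power2)
  also have "\<dots> \<le> (\<Sum>y\<in>?X. norm (\<Sum>x\<in>?X. F (x + y) * cnj (F x)))"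
    by (rule norm_sum)
  also have "\<dots> = (\<Sum>y\<in>?X. if y \<in> kerq (int q) (hm c h) then real q ^ CARD('n) else 0)"
  proof (rule sum.cong [OF refl])
    fix y assume y: "y \<in> ?X"
    have "F (x + y) * cnj (F x) = e_mod q (a * (3 * tri c h h y + 3 * tri c h y y))
        * e_mod q (\<Sum>i\<in>UNIV. (\<chi> i. a * (hm c h *v y)$i)$i * x$i)" for x
    proof -
      have "F (x + y) * cnj (F x) = e_mod q (a * (tri c (x + y + h) (x + y + h) (x + y + h) - tri c (x + y) (x + y) (x + y)
        - (tri c (x + h) (x + h) (x + h) - tri c x x x)))"
        by (simp add: F_def cnj_e_mod algebra_simps flip: e_mod_add)
      also have "\<dots> = e_mod q (a * (3 * tri c h h y + 3 * tri c h y y)) * e_mod q (6 * a * tri c x h y)"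
        unfolding tri_second_difference [OF c] by (simp add: algebra_simps flip: e_mod_add)
      finally show ?thesis
        by (simp add: tri_linear_form [OF c])
    qed
    then have "norm (\<Sum>x\<in>?X. F (x + y) * cnj (F x))
        = norm (\<Sum>x\<in>?X. e_mod q (\<Sum>i\<in>UNIV. (\<chi> i. a * (hm c h *v y)$i)$i * x$i))"
      by (simp add: norm_mult flip: sum_distrib_left)
    also have "\<dots> = (if \<forall>i. int q dvd (hm c h *v y)$i then real q ^ CARD('n) else 0)"
      unfolding sum_e_mod_linear [OF q]
      using a by (auto simp: norm_power coprime_commute coprime_dvd_mult_right_iff)
    finally show "norm (\<Sum>x\<in>?X. F (x + y) * cnj (F x)) = (if y \<in> kerq (int q) (hm c h) then real q ^ CARD('n) else 0)"
      using y by (simp add: kerq_def)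
  qed
  also have "\<dots> = (\<Sum>y\<in>kerq (int q) (hm c h). real q ^ CARD('n))"
    by (rule sum.mono_neutral_cong_right) (auto simp: kerq_def)
  finally show ?thesis
    by (simp add: mult.commute)
qed

lemma sum_squared_le:
  fixes f :: "'a \<Rightarrow> real"
  shows "(\<Sum>i\<in>A. f i)\<^sup>2 \<le> real (card A) * (\<Sum>i\<in>A. (f i)\<^sup>2)"
  using Cauchy_Schwarz_ineq_sum [of "\<lambda>_. 1" f A] by simp

text \<open>Van der Corput's device: the complete sum is first averaged over \<open>H ^ n\<close>
  shifts, and only then is Cauchy-Schwarz applied. Hence only differences \<open>h\<close> of short
  vectors occur, and \<open>H\<close> remains a free parameter to be matched with the counts of the
  geometric condition.\<close>

lemma weyl_van_der_corput:
  fixes c :: "'n::finite \<Rightarrow> 'n \<Rightarrow> 'n \<Rightarrow> int"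
  assumes c: "symmetric_coeffs c" and q: "q > 0" and a: "coprime a (int q)" and H: "H > 0"
  shows "(norm (gauss_sum c q a))\<^sup>2 \<le> real q ^ CARD('n) / real H ^ CARD('n) *
    (\<Sum>h\<in>diff_box H. sqrt (real q ^ CARD('n) * real (card (kerq (int q) (hm c h)))))"
proof -
  let ?X = "ibox (int q) :: (int^'n) set" and ?H = "ibox (int H) :: (int^'n) set" and ?n = "CARD('n)"
  define E where "E x = e_mod q (a * tri c x x x)" for x
  define T where "T h = (\<Sum>x\<in>?X. E (x + h) * cnj (E x))" for h
  have E: "periodic (int q) E"
    unfolding E_def by (rule periodic_gauss)
  have "of_nat (H ^ ?n) * gauss_sum c q a = (\<Sum>h\<in>?H. \<Sum>x\<in>?X. E (x + h))"
  proof -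
    have "(\<Sum>h\<in>?H. \<Sum>x\<in>?X. E (x + h)) = (\<Sum>h\<in>?H. \<Sum>x\<in>?X. E x)"
      using q by (simp add: sum_ibox_shift [OF _ E])
    then show ?thesis
      by (simp add: gauss_sum_ibox E_def card_ibox)
  qed
  also have "\<dots> = (\<Sum>x\<in>?X. \<Sum>h\<in>?H. E (x + h))"
    by (rule sum.swap)
  finally have eq1: "of_nat (H ^ ?n) * gauss_sum c q a = (\<Sum>x\<in>?X. \<Sum>h\<in>?H. E (x + h))" .
  have "real (H ^ ?n) * norm (gauss_sum c q a) = norm (of_nat (H ^ ?n) * gauss_sum c q a)"
    by (simp only: norm_mult norm_of_nat)
  also have "\<dots> \<le> (\<Sum>x\<in>?X. norm (\<Sum>h\<in>?H. E (x + h)))"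
    unfolding eq1 by (rule norm_sum)
  finally have "(real (H ^ ?n) * norm (gauss_sum c q a))\<^sup>2 \<le> (\<Sum>x\<in>?X. norm (\<Sum>h\<in>?H. E (x + h)))\<^sup>2"
    by (intro power_mono) auto
  also have "\<dots> \<le> real (card ?X) * (\<Sum>x\<in>?X. (norm (\<Sum>h\<in>?H. E (x + h)))\<^sup>2)"
    by (rule sum_squared_le)
  also have "real (card ?X) = real q ^ ?n"
    by (simp add: card_ibox)
  also have "(\<Sum>x\<in>?X. (norm (\<Sum>h\<in>?H. E (x + h)))\<^sup>2) = norm (\<Sum>h2\<in>?H. \<Sum>h1\<in>?H. T (h1 - h2))"
  proof -
    have "complex_of_real (\<Sum>x\<in>?X. (norm (\<Sum>h\<in>?H. E (x + h)))\<^sup>2)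
        = (\<Sum>x\<in>?X. (\<Sum>h\<in>?H. E (x + h)) * cnj (\<Sum>h\<in>?H. E (x + h)))"
      by (simp add: complex_norm_square del: cnj_sum of_real_power)
    also have "\<dots> = (\<Sum>x\<in>?X. \<Sum>h2\<in>?H. \<Sum>h1\<in>?H. E (x + h1) * cnj (E (x + h2)))"
      by (simp add: sum_distrib_left sum_distrib_right)
    also have "\<dots> = (\<Sum>h2\<in>?H. \<Sum>x\<in>?X. \<Sum>h1\<in>?H. E (x + h1) * cnj (E (x + h2)))"
      by (rule sum.swap)
    also have "\<dots> = (\<Sum>h2\<in>?H. \<Sum>h1\<in>?H. \<Sum>x\<in>?X. E (x + h1) * cnj (E (x + h2)))"
      by (rule sum.cong [OF refl]) (rule sum.swap)
    also have "\<dots> = (\<Sum>h2\<in>?H. \<Sum>h1\<in>?H. T (h1 - h2))"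
    proof (intro sum.cong refl)
      fix h1 h2
      define G where "G x = E (x + (h1 - h2)) * cnj (E x)" for x
      have "periodic (int q) G"
      proof -
        have "G x = G y" if "vcong (int q) x y" for x y
        proof -
          have "vcong (int q) (x + (h1 - h2)) (y + (h1 - h2))"
            using that by (intro vcong_add) (auto simp: vcong_def)
          then have "E (x + (h1 - h2)) = E (y + (h1 - h2))" "E x = E y"
            using E that unfolding periodic_def by blast+
          then show ?thesis
            by (simp add: G_def)
        qed
        then show ?thesis
          by (simp add: periodic_def)
      qed
      then have "(\<Sum>x\<in>?X. G (x + h2)) = (\<Sum>x\<in>?X. G x)"
        using q by (intro sum_ibox_shift) auto
      then show "(\<Sum>x\<in>?X. E (x + h1) * cnj (E (x + h2))) = T (h1 - h2)"
        by (simp add: G_def T_def algebra_simps)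
    qed
    finally have "complex_of_real (\<Sum>x\<in>?X. (norm (\<Sum>h\<in>?H. E (x + h)))\<^sup>2) = (\<Sum>h2\<in>?H. \<Sum>h1\<in>?H. T (h1 - h2))" .
    then have "norm (complex_of_real (\<Sum>x\<in>?X. (norm (\<Sum>h\<in>?H. E (x + h)))\<^sup>2)) = norm (\<Sum>h2\<in>?H. \<Sum>h1\<in>?H. T (h1 - h2))"
      by (rule arg_cong)
    then show ?thesis
      unfolding norm_of_real by (simp add: sum_nonneg)
  qed
  \<comment> \<open>For fixed \<open>h2\<close> the differences \<open>h1 - h2\<close> are distinct
    elements of \<open>diff_box H\<close>; the remaining sum over \<open>h2\<close> costs the factor
    \<open>H ^ n\<close>.\<close>
  also have "norm (\<Sum>h2\<in>?H. \<Sum>h1\<in>?H. T (h1 - h2)) \<le> (\<Sum>h2\<in>?H. \<Sum>h\<in>diff_box H. norm (T h))"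
  proof (rule sum_norm_le)
    fix h2 assume h2: "h2 \<in> ?H"
    have "norm (\<Sum>h1\<in>?H. T (h1 - h2)) \<le> (\<Sum>h1\<in>?H. norm (T (h1 - h2)))"
      by (rule norm_sum)
    also have "\<dots> = (\<Sum>h\<in>(\<lambda>h1. h1 - h2) ` ?H. norm (T h))"
      by (subst sum.reindex) (auto simp: inj_on_def)
    also have "\<dots> \<le> (\<Sum>h\<in>diff_box H. norm (T h))"
    proof (rule sum_mono2)
      show "(\<lambda>h1. h1 - h2) ` ?H \<subseteq> diff_box H"
      proof
        fix h assume "h \<in> (\<lambda>h1. h1 - h2) ` ?H"
        then obtain h1 where h1: "h1 \<in> ?H" "h = h1 - h2"
          by blast
        have "\<bar>h1$i - h2$i\<bar> < int H" for i
        proof -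
          have "0 \<le> h1$i" "h1$i < int H" "0 \<le> h2$i" "h2$i < int H"
            using h1(1) h2 by (auto simp: ibox_def)
          then show ?thesis
            by linarith
        qed
        then show "h \<in> diff_box H"
          by (simp add: diff_box_def h1(2))
      qed
    qed auto
    finally show "norm (\<Sum>h1\<in>?H. T (h1 - h2)) \<le> (\<Sum>h\<in>diff_box H. norm (T h))" .
  qed
  also have "\<dots> = real H ^ ?n * (\<Sum>h\<in>diff_box H. norm (T h))"
    by (simp add: card_ibox)
  also have "(\<Sum>h\<in>diff_box H. norm (T h)) \<le> (\<Sum>h\<in>diff_box H. sqrt (real q ^ ?n * real (card (kerq (int q) (hm c h)))))"
  proof (rule sum_mono)
    fix h :: "int^'n"
    have "T h = (\<Sum>x\<in>ibox (int q). e_mod q (a * (tri c (x + h) (x + h) (x + h) - tri c x x x)))"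
      by (simp add: T_def E_def cnj_e_mod algebra_simps flip: e_mod_add)
    then show "norm (T h) \<le> sqrt (real q ^ ?n * real (card (kerq (int q) (hm c h))))"
      using norm_difference_sum_le [OF c q a, of h] by (intro real_le_rsqrt) simp
  qed
  finally have "(real (H ^ ?n) * norm (gauss_sum c q a))\<^sup>2 \<le> real q ^ ?n * (real H ^ ?n *
      (\<Sum>h\<in>diff_box H. sqrt (real q ^ ?n * real (card (kerq (int q) (hm c h))))))"
    by (simp add: mult_left_mono)
  then have "real H ^ ?n * (norm (gauss_sum c q a))\<^sup>2 * real H ^ ?n \<le> real q ^ ?n *
      (\<Sum>h\<in>diff_box H. sqrt (real q ^ ?n * real (card (kerq (int q) (hm c h))))) * real H ^ ?n"
    by (simp add: power_mult_distrib power2_eq_square mult_ac)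
  then have "real H ^ ?n * (norm (gauss_sum c q a))\<^sup>2 \<le> real q ^ ?n *
      (\<Sum>h\<in>diff_box H. sqrt (real q ^ ?n * real (card (kerq (int q) (hm c h)))))"
    using H by (simp add: mult_le_cancel_right)
  then show ?thesis
    using H by (simp add: field_simps)
qed

section \<open>The p-adic densities\<close>

lemma coprime_int_prime: "prime p \<Longrightarrow> \<not> int p dvd a \<Longrightarrow> coprime a (int p)"
  by (metis coprime_commute prime_imp_coprime prime_nat_int_transfer)

lemma gauss_sum_scale:
  fixes c :: "'n::finite \<Rightarrow> 'n \<Rightarrow> 'n \<Rightarrow> int"
  assumes "p > 0" "q > 0"
  shows "gauss_sum c (p * q) (int p * b) = of_nat p ^ CARD('n) * gauss_sum c q b"
proof -
  have "e_mod (p * q) (int p * b * t) = e_mod q (b * t)" for t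
    using assms by (simp add: e_mod_def mult.assoc)
  then show ?thesis
    using sum_ibox_multiple [OF assms(2,1) periodic_gauss [of q b c]] by (simp add: gauss_sum_ibox)
qed

definition zero_count :: "('n::finite \<Rightarrow> 'n \<Rightarrow> 'n \<Rightarrow> int) \<Rightarrow> nat \<Rightarrow> nat" where
  "zero_count c q = card {x \<in> ibox (int q). int q dvd tri c x x x}"

lemma sum_gauss_sum:
  assumes "q > 0"
  shows "(\<Sum>b\<in>{0..<int q}. gauss_sum c q b) = of_nat (q * zero_count c q)"
proof -
  have "(\<Sum>b\<in>{0..<int q}. gauss_sum c q b) = (\<Sum>x\<in>ibox (int q). \<Sum>b\<in>{0..<int q}. e_mod q (tri c x x x * b))"
    unfolding gauss_sum_ibox by (subst sum.swap) (simp add: mult.commute)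
  also have "\<dots> = (\<Sum>x\<in>ibox (int q). if int q dvd tri c x x x then of_nat q else 0)"
    using assms by (simp add: sum_e_mod)
  also have "\<dots> = of_nat (q * zero_count c q)"
    by (simp add: zero_count_def sum.inter_filter [symmetric] mult.commute)
  finally show ?thesis .
qed

text \<open>A residue modulo \<open>p ^ Suc k\<close> is either prime to \<open>p\<close> or
  \<open>p\<close> times a residue modulo \<open>p ^ k\<close>. By \<open>gauss_sum_scale\<close>
  the second kind reproduces the previous stage, so the partial sums telescope to the normalised
  number of zeros modulo \<open>p ^ k\<close>.\<close>

lemma sum_sing_term_prime_power:
  fixes c :: "'n::finite \<Rightarrow> 'n \<Rightarrow> 'n \<Rightarrow> int"
  assumes p: "prime p"
  shows "(\<Sum>j\<le>k. sing_term c (p ^ j)) = of_nat (p ^ k * zero_count c (p ^ k)) / of_nat (p ^ k) ^ CARD('n)"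
proof -
  have p0: "p > 0"
    using p by (simp add: prime_gt_0_nat)
  define B where "B k = (\<Sum>b\<in>{0..<int (p ^ k)}. gauss_sum c (p ^ k) b) / of_nat (p ^ k) ^ CARD('n)" for k
  have "(\<Sum>j\<le>k. sing_term c (p ^ j)) = B k"
  proof (induction k)
    case 0
    have "{a \<in> {0..<int 1}. coprime a (int 1)} = {0..<int 1}"
      by auto
    then show ?case
      by (simp add: B_def sing_term_def)
  next
    case (Suc k)
    let ?q = "p ^ k"
    have split: "{0..<int (p * ?q)} = {a \<in> {0..<int (p * ?q)}. coprime a (int (p * ?q))} \<union> (\<lambda>b. int p * b) ` {0..<int ?q}"
    proof (intro equalityI subsetI)
      fix a assume a: "a \<in> {0..<int (p * ?q)}"
      show "a \<in> {a \<in> {0..<int (p * ?q)}. coprime a (int (p * ?q))} \<union> (\<lambda>b. int p * b) ` {0..<int ?q}"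
      proof (cases "int p dvd a")
        case True
        then obtain b where "a = int p * b"
          by blast
        then show ?thesis
          using a p0 by (auto simp: zero_le_mult_iff)
      next
        case False
        then have "coprime a (int p)"
          using p by (simp add: coprime_int_prime)
        then show ?thesis
          using a by simp
      qed
    next
      fix a assume "a \<in> {a \<in> {0..<int (p * ?q)}. coprime a (int (p * ?q))} \<union> (\<lambda>b. int p * b) ` {0..<int ?q}"
      then show "a \<in> {0..<int (p * ?q)}"
        using p0 by auto
    qed
    have fin: "finite {a \<in> {0..<int (p * ?q)}. coprime a (int (p * ?q))}"
      by (rule finite_subset [of _ "{0..<int (p * ?q)}"]) auto
    have disj: "{a \<in> {0..<int (p * ?q)}. coprime a (int (p * ?q))} \<inter> (\<lambda>b. int p * b) ` {0..<int ?q} = {}"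
      using p by (auto simp: coprime_commute dest: coprime_common_divisor)
    have "(\<Sum>b\<in>{0..<int (p * ?q)}. gauss_sum c (p * ?q) b)
      = (\<Sum>a\<in>{a \<in> {0..<int (p * ?q)}. coprime a (int (p * ?q))}. gauss_sum c (p * ?q) a)
        + (\<Sum>b\<in>(\<lambda>b. int p * b) ` {0..<int ?q}. gauss_sum c (p * ?q) b)"
      by (subst split, rule sum.union_disjoint [OF fin _ disj]) simp
    also have "(\<Sum>b\<in>(\<lambda>b. int p * b) ` {0..<int ?q}. gauss_sum c (p * ?q) b)
        = (\<Sum>b\<in>{0..<int ?q}. of_nat p ^ CARD('n) * gauss_sum c ?q b)"
      using p0 by (subst sum.reindex) (auto simp: inj_on_def gauss_sum_scale)
    finally have "B (Suc k) = sing_term c (p * ?q) + B k"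
      using p0 by (simp add: B_def sing_term_def add_divide_distrib sum_divide_distrib [symmetric]
            sum_distrib_left [symmetric] power_mult_distrib)
    then show ?case
      using Suc.IH by (simp add: add.commute)
  qed
  then show ?thesis
    using p0 sum_gauss_sum [of "p ^ k" c] by (simp add: B_def)
qed

lemma tri_axis_expand:
  assumes "symmetric_coeffs c"
  shows "tri c (x + t *s y) (x + t *s y) (x + t *s y)
    = tri c x x x + t * (3 * tri c x x y) + t\<^sup>2 * (3 * tri c y y x + t * tri c y y y)"
  using tri_expand [OF assms, of x t y] by (simp add: power2_eq_square power3_eq_cube algebra_simps)

text \<open>Hensel lifting at a zero whose derivative has exact valuation \<open>l\<close>. All
  corrections run along \<open>y\<close> and are multiples of \<open>p ^ Suc l\<close>, so they
  leave the valuation of the derivative unchanged.\<close>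

lemma hensel_coordinate:
  fixes c :: "'n::finite \<Rightarrow> 'n \<Rightarrow> 'n \<Rightarrow> int"
  assumes p: "prime p" and c: "symmetric_coeffs c"
    and g: "int p ^ l dvd 3 * tri c x x y" "\<not> int p ^ Suc l dvd 3 * tri c x x y"
    and x: "int p ^ (2 * l + 1) dvd tri c x x x"
    and w: "vcong (int p ^ (2 * l + 1)) w x"
  shows "\<exists>t. int p ^ (2 * l + 1 + k) dvd tri c (w + (int p ^ Suc l * t) *s y) (w + (int p ^ Suc l * t) *s y) (w + (int p ^ Suc l * t) *s y)"
proof (induction k)
  case 0
  have "[tri c w w w = tri c x x x] (mod int p ^ (2 * l + 1))"
    by (intro tri_cong w)
  then have "int p ^ (2 * l + 1) dvd tri c w w w"
    using x cong_dvd_iff by blast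
  then show ?case
    by (intro exI [of _ 0]) simp
next
  case (Suc k)
  let ?K = "2 * l + 1 + k"
  obtain t where t: "int p ^ ?K dvd tri c (w + (int p ^ Suc l * t) *s y) (w + (int p ^ Suc l * t) *s y) (w + (int p ^ Suc l * t) *s y)"
    using Suc.IH by blast
  define z where "z = w + (int p ^ Suc l * t) *s y"
  obtain m where m: "tri c z z z = int p ^ ?K * m"
    using t by (auto simp: z_def)
  have zx: "vcong (int p ^ Suc l) z x"
  proof -
    have "int p ^ Suc l dvd int p ^ (2 * l + 1)"
      by (rule le_imp_power_dvd) simp
    then have "vcong (int p ^ Suc l) w x"
      using w by (auto simp: vcong_def intro: cong_dvd_modulus)
    moreover have "vcong (int p ^ Suc l) ((int p ^ Suc l * t) *s y) 0"
      by (simp add: vcong_def cong_0_iff mult.assoc)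
    ultimately show ?thesis
      using vcong_add by (fastforce simp: z_def)
  qed
  then have "[3 * tri c z z y = 3 * tri c x x y] (mod int p ^ Suc l)"
    by (intro cong_mult cong_refl tri_cong) (auto simp: vcong_def)
  then have gz: "\<not> int p ^ Suc l dvd 3 * tri c z z y" "int p ^ l dvd 3 * tri c z z y"
    using g cong_dvd_iff by blast (metis (no_types, opaque_lifting) \<open>[3 * tri c z z y = 3 * tri c x x y] (mod int p ^ Suc l)\<close> cong_dvd_iff cong_dvd_modulus dvd_triv_right g(1) power_Suc)
  obtain h where h: "3 * tri c z z y = int p ^ l * h"
    using gz(2) by blast
  have "\<not> int p dvd h"
    using gz(1) by (auto simp: h mult.commute)
  then have "coprime h (int p)"
    using p by (simp add: coprime_int_prime)
  then obtain d where d: "[h * d = 1] (mod int p)"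
    by (meson cong_solve_coprime_int)
  \<comment> \<open>With level \<open>2 * l + 1 + k\<close> reached, the correction
    \<open>p ^ (Suc l + k) * u\<close> meets the derivative \<open>p ^ l * h\<close> exactly at that
    level, where \<open>u\<close> cancels the value modulo \<open>p\<close>. The square of the
    correction has the higher exponent \<open>2 * l + 2 + 2 * k\<close>.\<close>
  define u where "u = - m * d"
  let ?r = "int p ^ (Suc l + k) * u"
  have "tri c (z + ?r *s y) (z + ?r *s y) (z + ?r *s y)
      = tri c z z z + ?r * (3 * tri c z z y) + ?r\<^sup>2 * (3 * tri c y y z + ?r * tri c y y y)"
    by (rule tri_axis_expand [OF c])
  moreover have "int p ^ Suc ?K dvd tri c z z z + ?r * (3 * tri c z z y)"
  proof -
    have "tri c z z z + ?r * (3 * tri c z z y) = int p ^ ?K * (m * (1 - h * d))"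
    proof -
      have "int p ^ (l * 2) = int p ^ l * int p ^ l"
        by (simp add: power_mult power2_eq_square)
      then show ?thesis
        by (simp add: m h u_def power_add algebra_simps)
    qed
    moreover have "int p dvd 1 - h * d"
      using d by (metis cong_iff_dvd_diff cong_sym)
    ultimately show ?thesis
      by (simp add: mult.commute mult_dvd_mono)
  qed
  moreover have "int p ^ Suc ?K dvd ?r\<^sup>2 * (3 * tri c y y z + ?r * tri c y y y)"
  proof -
    have "int p ^ Suc ?K dvd int p ^ (2 * (Suc l + k))"
      by (rule le_imp_power_dvd) simp
    moreover have "?r\<^sup>2 = int p ^ (2 * (Suc l + k)) * u\<^sup>2"
      by (simp only: power_mult_distrib power_mult [symmetric] mult.commute)
    ultimately show ?thesis
      by (metis dvd_mult2)
  qed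
  ultimately have "int p ^ Suc ?K dvd tri c (z + ?r *s y) (z + ?r *s y) (z + ?r *s y)"
    by (metis dvd_add)
  moreover have "z + ?r *s y = w + (int p ^ Suc l * (t + int p ^ k * u)) *s y"
    by (simp add: z_def vec_eq_iff power_add algebra_simps)
  ultimately show ?case
    by (intro exI [of _ "t + int p ^ k * u"]) (simp add: add.assoc)
qed

lemma card_supp_box:
  assumes "p \<ge> 0"
  shows "card (supp_box J p :: (int^'n) set) = nat p ^ card J"
proof -
  have "card (supp_box J p :: (int^'n) set) = (\<Prod>i\<in>UNIV. card (if i \<in> J then {0..<p} else {0}))"
    unfolding supp_box_eq by (subst card_image) (auto simp: inj_on_def card_PiE)
  also have "\<dots> = (\<Prod>i\<in>J. card (if i \<in> J then {0..<p} else {0}))"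
    by (rule prod.mono_neutral_right) auto
  finally show ?thesis
    by simp
qed

text \<open>The coordinates other than \<open>j\<close> may be perturbed freely by multiples of
  \<open>p ^ (2 * l + 1)\<close>, and coordinate \<open>j\<close> is then solved for. Corrections do
  not touch the free coordinates, so different perturbations give different zeros.\<close>

lemma zero_count_lower:
  fixes c :: "'n::finite \<Rightarrow> 'n \<Rightarrow> 'n \<Rightarrow> int"
  assumes p: "prime p" and c: "symmetric_coeffs c"
    and g: "int p ^ l dvd 3 * tri c x x (axis j 1)" "\<not> int p ^ Suc l dvd 3 * tri c x x (axis j 1)"
    and x: "int p ^ (2 * l + 1) dvd tri c x x x"
  shows "zero_count c (p ^ (2 * l + 1 + k)) \<ge> (p ^ k) ^ (CARD('n) - 1)"
proof -
  let ?e = "2 * l + 1"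
  let ?P = "int p ^ (?e + k)"
  have p0: "int p > 0"
    using p by (simp add: prime_gt_0_nat)
  define f where "f w = x + int p ^ ?e *s w" for w
  have "\<exists>t. ?P dvd tri c (f w + (int p ^ Suc l * t) *s axis j 1) (f w + (int p ^ Suc l * t) *s axis j 1) (f w + (int p ^ Suc l * t) *s axis j 1)" for w
    by (rule hensel_coordinate [OF p c g x]) (simp add: f_def vcong_def cong_iff_dvd_diff)
  then obtain t where t: "\<And>w. ?P dvd tri c (f w + (int p ^ Suc l * t w) *s axis j 1) (f w + (int p ^ Suc l * t w) *s axis j 1) (f w + (int p ^ Suc l * t w) *s axis j 1)"
    by metis
  define y where "y w = vmod (f w + (int p ^ Suc l * t w) *s axis j 1) ?P" for w
  have "inj_on y (supp_box (UNIV - {j}) (int (p ^ k)))"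
  proof (rule inj_onI)
    fix w w' assume w: "w \<in> supp_box (UNIV - {j}) (int (p ^ k))" "w' \<in> supp_box (UNIV - {j}) (int (p ^ k))" "y w = y w'"
    have "w$i = w'$i" for i
    proof (cases "i = j")
      case True
      then have "w$i \<in> {0}" "w'$i \<in> {0}"
        using w(1,2) unfolding supp_box_def by (smt (verit, best) DiffE mem_Collect_eq singletonI)+
      then show ?thesis
        by simp
    next
      case False
      have "y w$i = y w'$i"
        using w(3) by simp
      then have "(x$i + int p ^ ?e * w$i) mod ?P = (x$i + int p ^ ?e * w'$i) mod ?P"
        using False by (simp add: y_def vmod_def f_def axis_def)
      then have "int p ^ ?e * int p ^ k dvd int p ^ ?e * (w$i - w'$i)"
        by (simp add: mod_eq_dvd_iff power_add algebra_simps)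
      then have "int p ^ k dvd w$i - w'$i"
        using p0 by (subst (asm) dvd_mult_cancel_left) auto
      then have "[w$i = w'$i] (mod int p ^ k)"
        by (simp add: cong_iff_dvd_diff)
      moreover have "u$i \<in> {0..<int p ^ k}" if "u \<in> supp_box (UNIV - {j}) (int (p ^ k))" for u
      proof -
        have "u$i \<in> (if i \<in> UNIV - {j} then {0..<int (p ^ k)} else {0})"
          using that by (simp only: supp_box_def mem_Collect_eq)
        then show ?thesis
          using False by simp
      qed
      ultimately show ?thesis
        using w(1,2) by (intro cong_less_imp_eq_int) auto
    qed
    then show "w = w'"
      by (simp add: vec_eq_iff)
  qed
  moreover have "y ` supp_box (UNIV - {j}) (int (p ^ k)) \<subseteq> {z \<in> ibox (int (p ^ (?e + k))). int (p ^ (?e + k)) dvd tri c z z z}"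
  proof clarify
    fix w
    have "[tri c (y w) (y w) (y w) = tri c (f w + (int p ^ Suc l * t w) *s axis j 1) (f w + (int p ^ Suc l * t w) *s axis j 1) (f w + (int p ^ Suc l * t w) *s axis j 1)] (mod ?P)"
      by (intro tri_cong) (simp_all only: y_def vcong_vmod)
    then have "?P dvd tri c (y w) (y w) (y w)"
      using t cong_dvd_iff by blast
    moreover have "y w \<in> ibox ?P"
      using p0 by (simp only: y_def vmod_ibox zero_less_power)
    ultimately show "y w \<in> ibox (int (p ^ (?e + k))) \<and> int (p ^ (?e + k)) dvd tri c (y w) (y w) (y w)"
      by simp
  qed
  ultimately have "card (supp_box (UNIV - {j}) (int (p ^ k)) :: (int^'n) set) \<le> zero_count c (p ^ (?e + k))"
    unfolding zero_count_def by (intro card_inj_on_le) (auto intro: finite_subset [OF _ finite_ibox])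
  then show ?thesis
    by (simp add: card_supp_box card_Diff_singleton nat_power_eq)
qed

lemma padic_density_pos:
  fixes c :: "'n::finite \<Rightarrow> 'n \<Rightarrow> 'n \<Rightarrow> int"
  assumes n: "CARD('n) \<ge> 10" and p: "prime p" and c: "symmetric_coeffs c"
    and D: "det (hm c x0) \<noteq> 0" and summable: "summable (\<lambda>k. sing_term c (p ^ k))"
  shows "Im (padic_density c p) = 0" "Re (padic_density c p) > 0"
proof -
  define s where "s = (\<lambda>i j k. 6 * c i j k)"
  have s: "integral_tensor s"
    using c by (auto simp: s_def integral_tensor_def symmetric_coeffs_def)
  have p0: "p > 0"
    using p by (simp add: prime_gt_0_nat)
  have tri_s: "tri s x y z = 6 * tri c x y z" for x y z
    by (simp add: s_def tri_def sum_distrib_left mult_ac)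
  have cub_s: "cub s x = tri c x x x" and dcub_s: "dcub s x y = 3 * tri c x x y" for x y
    using cub_6 [OF s, of x] dcub_2 [OF s, of x y] by (simp_all add: tri_s)
  have "padic_zero p s"
    by (rule padic_zero_exists [OF n p s]) (use D in \<open>simp add: hm_def s_def\<close>)
  then obtain y l where yl: "\<And>K. \<exists>x. int p ^ K dvd tri c x x x \<and> \<not> int p ^ Suc l dvd 3 * tri c x x y"
    unfolding padic_zero_def cub_s dcub_s by blast
  obtain x where x: "int p ^ (2 * l + 1) dvd tri c x x x" "\<not> int p ^ Suc l dvd 3 * tri c x x y"
    using yl by blast
  \<comment> \<open>The derivative in direction \<open>y\<close> is an integral combination of
    partial derivatives, so one of these also fails to be divisible by
    \<open>p ^ Suc l\<close>.\<close>
  have "3 * tri c x x y = (\<Sum>j\<in>UNIV. y$j * (3 * tri c x x (axis j 1)))"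
  proof -
    have "y = (\<Sum>j\<in>UNIV. y$j *s axis j 1)"
      by (simp add: vec_eq_iff axis_def if_distrib cong: if_cong)
    then have "tri c x x y = (\<Sum>j\<in>UNIV. y$j * tri c x x (axis j 1))"
      by (metis (no_types, lifting) sum.cong tri_scale3 tri_sum3)
    then show ?thesis
      by (simp add: sum_distrib_left mult_ac)
  qed
  moreover have "int p ^ Suc l dvd (\<Sum>j\<in>UNIV. y$j * (3 * tri c x x (axis j 1)))"
    if "\<And>j. int p ^ Suc l dvd 3 * tri c x x (axis j 1)"
    by (rule dvd_sum, rule dvd_mult, rule that)
  ultimately obtain j where j: "\<not> int p ^ Suc l dvd 3 * tri c x x (axis j 1)"
    using x(2) by auto
  let ?g = "3 * tri c x x (axis j 1)"
  \<comment> \<open>The exact valuation of the chosen partial derivative. It is at most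
    \<open>l\<close>, so the zero modulo \<open>p ^ (2 * l + 1)\<close> is accurate enough to start
    lifting.\<close>
  define m where "m = (LEAST m. \<not> int p ^ Suc m dvd ?g)"
  have m1: "\<not> int p ^ Suc m dvd ?g"
    unfolding m_def using j by (rule LeastI)
  have ml: "m \<le> l"
    unfolding m_def using j by (rule Least_le)
  have m2: "int p ^ m dvd ?g"
  proof (cases m)
    case (Suc m')
    then show ?thesis
      using not_less_Least [of m' "\<lambda>m. \<not> int p ^ Suc m dvd ?g"] by (simp add: m_def)
  qed simp
  have "int p ^ (2 * m + 1) dvd int p ^ (2 * l + 1)"
    using ml by (intro le_imp_power_dvd) simp
  then have "int p ^ (2 * m + 1) dvd tri c x x x"
    using x(1) dvd_trans by blast
  then have lower: "zero_count c (p ^ (2 * m + 1 + k)) \<ge> (p ^ k) ^ (CARD('n) - 1)" for k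
    using zero_count_lower [OF p c m2 m1] by blast
  define S where "S k = (\<Sum>j\<le>k. sing_term c (p ^ j))" for k
  have lim: "S \<longlonglongrightarrow> padic_density c p"
    using summable_LIMSEQ' [OF summable] by (simp add: S_def [abs_def] padic_density_def)
  have S: "S k = complex_of_real (real (p ^ k * zero_count c (p ^ k)) / real (p ^ k) ^ CARD('n))" for k
    using sum_sing_term_prime_power [OF p, where c=c and k=k] by (simp add: S_def)
  have "(\<lambda>k. Im (S k)) \<longlonglongrightarrow> Im (padic_density c p)"
    by (intro tendsto_intros lim)
  then show "Im (padic_density c p) = 0"
    by (simp add: S LIMSEQ_const_iff)
  let ?e = "2 * m + 1"
  \<comment> \<open>At level \<open>e + k\<close> there are at least
    \<open>p ^ (k * (n - 1))\<close> zeros. After multiplication by \<open>p ^ (e + k)\<close> and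
    division by \<open>p ^ ((e + k) * n)\<close> the lower bound no longer depends on
    \<open>k\<close>.\<close>
  define \<delta> where "\<delta> = 1 / real p ^ (?e * (CARD('n) - 1))"
  have "\<delta> > 0"
    using p0 by (simp add: \<delta>_def)
  have ge: "Re (S (k + ?e)) \<ge> \<delta>" for k
  proof -
    obtain N where N: "CARD('n) = Suc N"
      using n by (cases "CARD('n)") auto
    have "real (p ^ (?e + k) * (p ^ k) ^ N) \<le> real (p ^ (?e + k) * zero_count c (p ^ (?e + k)))"
      using lower [of k] by (simp only: N diff_Suc_1 of_nat_le_iff mult_le_mono2)
    then have "real (p ^ (?e + k) * (p ^ k) ^ N) / real (p ^ (?e + k)) ^ CARD('n) \<le> Re (S (?e + k))"
      by (simp only: S Re_complex_of_real) (rule divide_right_mono, auto)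
    moreover have "real (p ^ (?e + k) * (p ^ k) ^ N) / real (p ^ (?e + k)) ^ CARD('n) = \<delta>"
    proof -
      have *: "(a * b) * b ^ N / (a * b) ^ Suc N = 1 / a ^ N" if "a > 0" "b > 0" for a b :: real
        using that by (simp add: power_mult_distrib)
      have "\<delta> = 1 / (real p ^ ?e) ^ N"
        by (simp only: \<delta>_def N diff_Suc_1 power_mult)
      moreover have "real (p ^ (?e + k) * (p ^ k) ^ N) = (real p ^ ?e * real p ^ k) * (real p ^ k) ^ N"
        "real (p ^ (?e + k)) = real p ^ ?e * real p ^ k"
        by (simp_all only: power_add of_nat_mult of_nat_power)
      ultimately show ?thesis
        by (simp only: N) (rule *, use p0 in auto)
    qed
    ultimately show ?thesis
      by (simp add: add.commute)
  qed
  have "(\<lambda>k. Re (S (k + ?e))) \<longlonglongrightarrow> Re (padic_density c p)"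
    using lim by (intro tendsto_intros LIMSEQ_ignore_initial_segment)
  then have "\<delta> \<le> Re (padic_density c p)"
    by (rule LIMSEQ_le_const) (use ge in auto)
  then show "Re (padic_density c p) > 0"
    using \<open>\<delta> > 0\<close> by linarith
qed

section \<open>Multiplicativity and the Euler product\<close>

definition runits :: "nat \<Rightarrow> int set" where
  "runits q = {a \<in> {0..<int q}. coprime a (int q)}"

lemma finite_runits [simp]: "finite (runits q)"
  unfolding runits_def by (rule finite_subset [of _ "{0..<int q}"]) auto

text \<open>The Chinese remainder theorem: reduction modulo both factors is injective on the box,
  and equal cardinalities make it bijective.\<close>

lemma sum_periodic_mult:
  fixes F1 F2 :: "int^'n \<Rightarrow> complex"
  assumes q: "q1 > 0" "q2 > 0" "coprime q1 q2"
    and F: "periodic (int q1) F1" "periodic (int q2) F2"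
  shows "(\<Sum>x\<in>ibox (int (q1 * q2)). F1 x * F2 x) = (\<Sum>x\<in>ibox (int q1). F1 x) * (\<Sum>x\<in>ibox (int q2). F2 x)"
proof -
  define \<phi> where "\<phi> x = (vmod x (int q1), vmod x (int q2))" for x :: "int^'n"
  have inj: "inj_on \<phi> (ibox (int (q1 * q2)))"
  proof (rule inj_onI)
    fix x y :: "int^'n" assume xy: "x \<in> ibox (int (q1 * q2))" "y \<in> ibox (int (q1 * q2))" "\<phi> x = \<phi> y"
    have "int q1 dvd x$i - y$i" "int q2 dvd x$i - y$i" for i
      using xy(3) by (auto simp: \<phi>_def vmod_def vec_eq_iff mod_eq_dvd_iff)
    then have "int q1 * int q2 dvd x$i - y$i" for i
      using q(3) by (intro divides_mult) auto
    then show "x = y"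
      using xy by (intro ibox_cong_imp_eq [of _ "int (q1 * q2)"]) auto
  qed
  have sub: "\<phi> ` ibox (int (q1 * q2)) \<subseteq> ibox (int q1) \<times> ibox (int q2)"
    using q by (auto simp: \<phi>_def)
  have "card (\<phi> ` ibox (int (q1 * q2))) = card ((ibox (int q1) :: (int^'n) set) \<times> (ibox (int q2) :: (int^'n) set))"
    unfolding card_image [OF inj]
    by (simp add: card_cartesian_product card_ibox power_mult_distrib nat_mult_distrib)
  then have "\<phi> ` ibox (int (q1 * q2)) = ibox (int q1) \<times> ibox (int q2)"
    using sub by (intro card_subset_eq) auto
  then have "(\<Sum>z\<in>ibox (int q1) \<times> ibox (int q2). F1 (fst z) * F2 (snd z))
      = (\<Sum>x\<in>ibox (int (q1 * q2)). F1 (vmod x (int q1)) * F2 (vmod x (int q2)))"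
    using sum.reindex [OF inj, of "\<lambda>z. F1 (fst z) * F2 (snd z)"] by (simp add: \<phi>_def)
  also have "\<dots> = (\<Sum>x\<in>ibox (int (q1 * q2)). F1 x * F2 x)"
    using F vcong_vmod unfolding periodic_def by metis
  finally show ?thesis
    by (simp add: sum_product sum.cartesian_product case_prod_beta)
qed

text \<open>The argument \<open>a1 * q2 + a2 * q1\<close> is chosen because divided by
  \<open>q1 * q2\<close> it is \<open>a1 / q1 + a2 / q2\<close>.\<close>

lemma gauss_sum_mult:
  assumes "q1 > 0" "q2 > 0" "coprime q1 q2"
  shows "gauss_sum c (q1 * q2) (a1 * int q2 + a2 * int q1) = gauss_sum c q1 a1 * gauss_sum c q2 a2"
proof -
  have "e_mod (q1 * q2) ((a1 * int q2 + a2 * int q1) * t) = e_mod q1 (a1 * t) * e_mod q2 (a2 * t)" for t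
    using assms by (simp add: e_mod_def field_simps flip: e_fun_add)
  then show ?thesis
    using sum_periodic_mult [OF assms periodic_gauss [of q1 a1 c] periodic_gauss [of q2 a2 c]]
    by (simp add: gauss_sum_ibox)
qed

lemma gauss_sum_cong: "[a = b] (mod int q) \<Longrightarrow> gauss_sum c q a = gauss_sum c q b"
  unfolding gauss_sum_ibox by (intro sum.cong refl e_mod_cong cong_mult cong_refl)

lemma coprime_crt_sum:
  fixes q1 q2 :: nat
  assumes "coprime q1 q2"
  shows "coprime (a1 * int q2 + a2 * int q1) (int (q1 * q2)) \<longleftrightarrow> coprime a1 (int q1) \<and> coprime a2 (int q2)"
proof -
  have "coprime (a1 * int q2 + a2 * int q1) (int q1) \<longleftrightarrow> coprime (a1 * int q2) (int q1)"
    by (metis coprime_iff_gcd_eq_1 gcd.commute gcd_add_mult mult.commute add.commute)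
  moreover have "coprime (a1 * int q2 + a2 * int q1) (int q2) \<longleftrightarrow> coprime (a2 * int q1) (int q2)"
    by (metis coprime_iff_gcd_eq_1 gcd.commute gcd_add_mult mult.commute add.commute)
  ultimately show ?thesis
    using assms by (auto simp: coprime_commute)
qed

lemma sum_runits_mult:
  fixes f :: "int \<Rightarrow> 'a::comm_monoid_add"
  assumes q: "q1 > 0" "q2 > 0" "coprime q1 q2"
    and f: "\<And>a b. [a = b] (mod int (q1 * q2)) \<Longrightarrow> f a = f b"
  shows "(\<Sum>a\<in>runits (q1 * q2). f a) = (\<Sum>(a1, a2)\<in>runits q1 \<times> runits q2. f (a1 * int q2 + a2 * int q1))"
proof -
  let ?Q = "int (q1 * q2)"
  define \<phi> where "\<phi> z = (case z of (a1, a2) \<Rightarrow> (a1 * int q2 + a2 * int q1) mod ?Q)" for z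
  have inj: "inj_on \<phi> ({0..<int q1} \<times> {0..<int q2})"
  proof (rule inj_onI)
    fix z w assume zw: "z \<in> {0..<int q1} \<times> {0..<int q2}" "w \<in> {0..<int q1} \<times> {0..<int q2}" "\<phi> z = \<phi> w"
    obtain a1 a2 b1 b2 where ab: "z = (a1, a2)" "w = (b1, b2)"
      by (metis surj_pair)
    have d: "?Q dvd (a1 * int q2 + a2 * int q1) - (b1 * int q2 + b2 * int q1)"
      using zw(3) by (simp add: ab \<phi>_def mod_eq_dvd_iff)
    have "int q1 dvd ((a1 - b1) * int q2 + (a2 - b2) * int q1)"
      using d by (auto simp: algebra_simps intro: dvd_trans [of _ ?Q])
    then have "int q1 dvd (a1 - b1) * int q2"
      by (simp add: dvd_add_left_iff)
    then have "int q1 dvd a1 - b1"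
      using q(3) by (simp add: coprime_dvd_mult_left_iff)
    moreover have "int q2 dvd ((a2 - b2) * int q1 + (a1 - b1) * int q2)"
      using d by (auto simp: algebra_simps intro: dvd_trans [of _ ?Q])
    then have "int q2 dvd (a2 - b2) * int q1"
      by (simp add: dvd_add_left_iff)
    then have "int q2 dvd a2 - b2"
      using q(3) by (simp add: coprime_dvd_mult_left_iff coprime_commute)
    ultimately have "[a1 = b1] (mod int q1)" "[a2 = b2] (mod int q2)"
      by (simp_all add: cong_iff_dvd_diff)
    then show "z = w"
      using zw(1,2) by (auto simp: ab intro: cong_less_imp_eq_int)
  qed
  have surj: "\<phi> ` ({0..<int q1} \<times> {0..<int q2}) = {0..<?Q}"
  proof (rule card_subset_eq)
    show "\<phi> ` ({0..<int q1} \<times> {0..<int q2}) \<subseteq> {0..<?Q}"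
      using q by (auto simp: \<phi>_def)
  qed (auto simp: card_image [OF inj] card_cartesian_product nat_mult_distrib)
  have "\<phi> z \<in> runits (q1 * q2) \<longleftrightarrow> z \<in> runits q1 \<times> runits q2"
    if "z \<in> {0..<int q1} \<times> {0..<int q2}" for z
  proof -
    obtain a1 a2 where a: "z = (a1, a2)"
      by (metis surj_pair)
    have "coprime (\<phi> z) ?Q \<longleftrightarrow> coprime (a1 * int q2 + a2 * int q1) ?Q"
      unfolding a \<phi>_def case_prod_conv by (metis coprime_mod_left_iff mod_0 q(1,2) nat_0_less_mult_iff of_nat_0_less_iff less_irrefl)
    moreover have "\<phi> z \<in> {0..<?Q}"
      using q by (auto simp: \<phi>_def a)
    ultimately show ?thesis
      using that unfolding runits_def a coprime_crt_sum [OF q(3)] by auto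
  qed
  note \<phi> = this
  have img: "\<phi> ` (runits q1 \<times> runits q2) = runits (q1 * q2)"
  proof (intro equalityI subsetI)
    fix a assume "a \<in> \<phi> ` (runits q1 \<times> runits q2)"
    then obtain z where z: "z \<in> runits q1 \<times> runits q2" "a = \<phi> z"
      by blast
    then have "z \<in> {0..<int q1} \<times> {0..<int q2}"
      by (auto simp: runits_def)
    then show "a \<in> runits (q1 * q2)"
      using z \<phi> by blast
  next
    fix a assume a: "a \<in> runits (q1 * q2)"
    then have "a \<in> {0..<?Q}"
      by (simp add: runits_def)
    then obtain z where "z \<in> {0..<int q1} \<times> {0..<int q2}" "a = \<phi> z"
      unfolding surj [symmetric] by blast
    then show "a \<in> \<phi> ` (runits q1 \<times> runits q2)"
      using a \<phi> by blast
  qed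
  have inj': "inj_on \<phi> (runits q1 \<times> runits q2)"
    by (rule inj_on_subset [OF inj]) (auto simp: runits_def)
  have "(\<Sum>a\<in>runits (q1 * q2). f a) = (\<Sum>z\<in>runits q1 \<times> runits q2. f (\<phi> z))"
    unfolding img [symmetric] by (subst sum.reindex [OF inj']) simp
  also have "\<dots> = (\<Sum>(a1, a2)\<in>runits q1 \<times> runits q2. f (a1 * int q2 + a2 * int q1))"
    by (intro sum.cong refl) (auto simp: \<phi>_def intro!: f)
  finally show ?thesis .
qed

lemma sing_term_runits: "sing_term c q = (\<Sum>a\<in>runits q. gauss_sum c q a) / of_nat q ^ CARD('n)"
  for c :: "'n::finite \<Rightarrow> 'n \<Rightarrow> 'n \<Rightarrow> int"
  by (simp add: sing_term_def runits_def sum_divide_distrib)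

lemma sing_abs_term_runits: "sing_abs_term c q = (\<Sum>a\<in>runits q. norm (gauss_sum c q a)) / real q ^ CARD('n)"
  for c :: "'n::finite \<Rightarrow> 'n \<Rightarrow> 'n \<Rightarrow> int"
  by (simp add: sing_abs_term_def runits_def sum_divide_distrib)

lemma sing_term_mult:
  fixes c :: "'n::finite \<Rightarrow> 'n \<Rightarrow> 'n \<Rightarrow> int"
  assumes "q1 > 0" "q2 > 0" "coprime q1 q2"
  shows "sing_term c (q1 * q2) = sing_term c q1 * sing_term c q2"
proof -
  have "(\<Sum>a\<in>runits (q1 * q2). gauss_sum c (q1 * q2) a)
      = (\<Sum>(a1, a2)\<in>runits q1 \<times> runits q2. gauss_sum c q1 a1 * gauss_sum c q2 a2)"
    by (subst sum_runits_mult [OF assms gauss_sum_cong]) (auto simp: gauss_sum_mult [OF assms])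
  then show ?thesis
    by (simp add: sing_term_runits sum_product sum.cartesian_product power_mult_distrib)
qed

lemma sing_abs_term_mult:
  fixes c :: "'n::finite \<Rightarrow> 'n \<Rightarrow> 'n \<Rightarrow> int"
  assumes "q1 > 0" "q2 > 0" "coprime q1 q2"
  shows "sing_abs_term c (q1 * q2) = sing_abs_term c q1 * sing_abs_term c q2"
proof -
  have cong: "norm (gauss_sum c (q1 * q2) a) = norm (gauss_sum c (q1 * q2) b)"
    if "[a = b] (mod int (q1 * q2))" for a b
    using gauss_sum_cong [OF that, of c] by simp
  have "(\<Sum>a\<in>runits (q1 * q2). norm (gauss_sum c (q1 * q2) a))
      = (\<Sum>(a1, a2)\<in>runits q1 \<times> runits q2. norm (gauss_sum c q1 a1 * gauss_sum c q2 a2))"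
    by (subst sum_runits_mult [OF assms cong]) (auto simp: gauss_sum_mult [OF assms])
  then show ?thesis
    by (simp add: sing_abs_term_runits sum_product sum.cartesian_product power_mult_distrib norm_mult)
qed

lemma runits_1: "runits 1 = {0}"
  by (auto simp: runits_def)

lemma ibox_1: "ibox 1 = {0 :: int^'n}"
proof -
  have "x = 0" if "\<forall>i. 0 \<le> x$i \<and> x$i < 1" for x :: "int^'n"
    unfolding vec_eq_iff
  proof
    fix i
    show "x$i = 0$i"
      using that [rule_format, of i] by simp
  qed
  then show ?thesis
    by (auto simp: ibox_def)
qed

lemma gauss_sum_1: "gauss_sum c 1 a = 1"
  by (simp add: gauss_sum_ibox ibox_1 tri_def)

lemma sing_term_1: "sing_term c 1 = 1"
  by (simp add: sing_term_runits runits_1 gauss_sum_1 del: One_nat_def)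

lemma sing_abs_term_1: "sing_abs_term c 1 = 1"
  by (simp add: sing_abs_term_runits runits_1 gauss_sum_1 del: One_nat_def)

lemma sing_abs_term_nonneg: "sing_abs_term c q \<ge> 0"
  by (simp add: sing_abs_term_runits sum_nonneg)

lemma norm_sing_term_le: "norm (sing_term c q) \<le> sing_abs_term c q"
  unfolding sing_term_runits sing_abs_term_runits norm_divide norm_power norm_of_nat
  by (intro divide_right_mono norm_sum) auto

section \<open>Euler products\<close>

definition smooth :: "nat set \<Rightarrow> nat set" where
  "smooth P = {q. q > 0 \<and> (\<forall>p. prime p \<longrightarrow> p dvd q \<longrightarrow> p \<in> P)}"

lemma smooth_empty: "smooth {} = {1}"
  using prime_factor_nat by (auto simp: smooth_def)

lemma smooth_insert:
  assumes "prime p" "p \<notin> P"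
  shows "bij_betw (\<lambda>(q, k). q * p ^ k) (smooth P \<times> UNIV) (smooth (insert p P))"
proof -
  have not_dvd: "\<not> p dvd q" if "q \<in> smooth P" for q
    using that assms by (auto simp: smooth_def)
  have p0: "p > 0"
    using assms by (simp add: prime_gt_0_nat)
  have "inj_on (\<lambda>(q, k). q * p ^ k) (smooth P \<times> UNIV)"
  proof (rule inj_onI, clarify)
    fix q k q' k' assume q: "q \<in> smooth P" "q' \<in> smooth P" "q * p ^ k = q' * p ^ k'"
    have "multiplicity p (q * p ^ k) = k" if "q \<in> smooth P" for q k
      using that not_dvd [OF that] assms p0
      by (simp add: prime_elem_multiplicity_mult_distrib not_dvd_imp_multiplicity_0 smooth_def)
    then have "k = k'"
      using q by metis
    then show "q = q' \<and> k = k'"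
      using q(3) p0 by simp
  qed
  moreover have "(\<lambda>(q, k). q * p ^ k) ` (smooth P \<times> UNIV) = smooth (insert p P)"
  proof (intro equalityI subsetI)
    fix m assume "m \<in> (\<lambda>(q, k). q * p ^ k) ` (smooth P \<times> UNIV)"
    then obtain q k where qk: "q \<in> smooth P" "m = q * p ^ k"
      by auto
    have "r \<in> insert p P" if "prime r" "r dvd m" for r
    proof (cases "r dvd q")
      case True
      then show ?thesis
        using that qk(1) by (simp add: smooth_def)
    next
      case False
      then have "r dvd p ^ k"
        using that qk(2) by (simp add: prime_dvd_mult_iff)
      then show ?thesis
        using that(1) assms(1) prime_dvd_power primes_dvd_imp_eq by blast
    qed
    then show "m \<in> smooth (insert p P)"
      using qk p0 by (auto simp: smooth_def)
  next
    fix m assume m: "m \<in> smooth (insert p P)"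
    then have m0: "m > 0"
      by (simp add: smooth_def)
    obtain q where q: "m = p ^ multiplicity p m * q" "\<not> p dvd q"
      using multiplicity_decompose' [of m p] m0 assms(1) by (metis not_prime_unit gr_implies_not0)
    have "r \<in> P" if "prime r" "r dvd q" for r
    proof -
      have "r dvd m"
        using that(2) by (subst q(1)) simp
      then have "r \<in> insert p P"
        using m that(1) by (simp add: smooth_def)
      then show ?thesis
        using q(2) that(2) by auto
    qed
    then have "q \<in> smooth P"
      using q(1) m0 by (auto simp: smooth_def intro: Nat.gr0I)
    then show "m \<in> (\<lambda>(q, k). q * p ^ k) ` (smooth P \<times> UNIV)"
      using q(1) by (intro image_eqI [of _ _ "(q, multiplicity p m)"]) (auto simp: mult.commute)
  qed
  ultimately show ?thesis
    by (simp add: bij_betw_def)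
qed

lemma infsum_nat_eq_suminf:
  fixes f :: "nat \<Rightarrow> 'a::banach"
  assumes "summable (\<lambda>k. norm (f k))"
  shows "infsum f UNIV = suminf f"
  by (intro infsumI norm_summable_imp_has_sum assms summable_sums summable_norm_cancel)

lemma abs_summable_on_times:
  fixes f :: "'b \<Rightarrow> 'a::{banach, real_normed_field}" and g :: "'c \<Rightarrow> 'a"
  assumes "(\<lambda>x. norm (f x)) summable_on A" "(\<lambda>x. norm (g x)) summable_on B"
  shows "(\<lambda>z. norm (case z of (x, y) \<Rightarrow> f x * g y)) summable_on A \<times> B"
proof -
  have "(\<lambda>x. norm (f x) * infsum (\<lambda>y. norm (g y)) B) summable_on A"
    using assms(1) by (rule summable_on_cmult_left)
  then show ?thesis
    using assms by (subst Infinite_Sum.abs_summable_on_Sigma_iff)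
      (auto simp: norm_mult infsum_cmult_right' summable_on_cmult_right abs_mult infsum_nonneg)
qed

text \<open>For finitely many primes the product can be expanded: a new prime \<open>p\<close> turns
  the index set into pairs of an old smooth number and an exponent, and Fubini for absolutely
  summable families factors the sum.\<close>

lemma euler_product_smooth:
  fixes f :: "nat \<Rightarrow> 'a::{banach, real_normed_field}"
  assumes f1: "f 1 = 1"
    and mult: "\<And>a b. a > 0 \<Longrightarrow> b > 0 \<Longrightarrow> coprime a b \<Longrightarrow> f (a * b) = f a * f b"
    and summ: "\<And>p. prime p \<Longrightarrow> summable (\<lambda>k. norm (f (p ^ k)))"
    and P: "finite P" "\<And>p. p \<in> P \<Longrightarrow> prime p"
  shows "(\<lambda>x. norm (f x)) summable_on (smooth P) \<and> infsum f (smooth P) = (\<Prod>p\<in>P. \<Sum>k. f (p ^ k))"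
  using P
proof (induction P rule: finite_induct)
  case empty
  then show ?case
    using f1 by (simp add: smooth_empty)
next
  case (insert p P)
  have p: "prime p"
    using insert.prems by simp
  have IH: "(\<lambda>x. norm (f x)) summable_on (smooth P)" "infsum f (smooth P) = (\<Prod>p\<in>P. \<Sum>k. f (p ^ k))"
    using insert by auto
  let ?h = "\<lambda>(q, k). q * p ^ k"
  note bij = smooth_insert [OF p insert.hyps(2)]
  have fh: "f (?h z) = (\<lambda>(q, k). f q * f (p ^ k)) z" if "z \<in> smooth P \<times> UNIV" for z
  proof -
    obtain q k where z: "z = (q, k)" "q \<in> smooth P"
      using \<open>z \<in> smooth P \<times> UNIV\<close> by auto
    have "\<not> p dvd q"
      using z(2) p insert.hyps(2) by (auto simp: smooth_def)
    then have "coprime q (p ^ k)"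
      using p by (metis coprime_commute coprime_power_right_iff prime_imp_coprime)
    then show ?thesis
      using z mult [of q "p ^ k"] p by (simp add: smooth_def prime_gt_0_nat)
  qed
  have sp: "(\<lambda>k. norm (f (p ^ k))) summable_on UNIV"
    using summ [OF p] by (simp add: norm_summable_imp_summable_on)
  have prod: "(\<lambda>z. norm (case z of (q, k) \<Rightarrow> f q * f (p ^ k))) summable_on smooth P \<times> UNIV"
    using abs_summable_on_times [OF IH(1) sp] by simp
  have "(\<lambda>z. norm (f (?h z))) summable_on smooth P \<times> UNIV"
    using prod by (rule summable_on_cong [THEN iffD1, rotated]) (simp only: fh)
  then have abs: "(\<lambda>x. norm (f x)) summable_on smooth (insert p P)"
    using summable_on_reindex_bij_betw [OF bij, of "\<lambda>q. norm (f q)"] by simp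
  have "infsum f (smooth (insert p P)) = infsum (\<lambda>z. f (?h z)) (smooth P \<times> UNIV)"
    by (rule infsum_reindex_bij_betw [OF bij, symmetric])
  also have "\<dots> = infsum (\<lambda>(q, k). f q * f (p ^ k)) (smooth P \<times> UNIV)"
    by (rule infsum_cong) (rule fh)
  also have "\<dots> = infsum (\<lambda>q. infsum (\<lambda>k. f q * f (p ^ k)) UNIV) (smooth P)"
    using infsum_Sigma_banach [OF abs_summable_summable [OF prod]] by simp
  also have "\<dots> = infsum f (smooth P) * (\<Sum>k. f (p ^ k))"
    by (simp add: infsum_cmult_right' infsum_cmult_left' infsum_nat_eq_suminf [OF summ [OF p]])
  finally show ?case
    using abs IH(2) insert.hyps by (simp add: mult.commute)
qed

lemma atLeastAtMost_subset_smooth: "{1..N} \<subseteq> smooth {p. prime p \<and> p \<le> N}"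
  by (auto simp: smooth_def dest: dvd_imp_le)

text \<open>The numbers up to \<open>N\<close> are smooth over the primes up to \<open>N\<close>, so
  the partial sum is at most a finite Euler product. The inequality \<open>1 + x \<le> exp x\<close>
  bounds that product by \<open>exp B\<close>.\<close>

lemma euler_product_summable:
  fixes g :: "nat \<Rightarrow> real"
  assumes g1: "g 1 = 1" and nonneg: "\<And>q. g q \<ge> 0"
    and mult: "\<And>a b. a > 0 \<Longrightarrow> b > 0 \<Longrightarrow> coprime a b \<Longrightarrow> g (a * b) = g a * g b"
    and summ: "\<And>p. prime p \<Longrightarrow> summable (\<lambda>k. g (p ^ k))"
    and bound: "\<And>N. (\<Sum>p | prime p \<and> p \<le> N. \<Sum>k. g (p ^ Suc k)) \<le> B"
  shows "summable (\<lambda>q. g (q + 1))"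
proof (rule summableI_nonneg_bounded)
  show "0 \<le> g (q + 1)" for q
    by (rule nonneg)
  fix N :: nat
  let ?P = "{p. prime p \<and> p \<le> N}"
  have fin: "finite ?P"
    by (rule finite_subset [of _ "{..N}"]) auto
  have summ': "summable (\<lambda>k. norm (g (p ^ k)))" if "prime p" for p
    using summ [OF that] nonneg by simp
  have ep1: "(\<lambda>x. norm (g x)) summable_on (smooth ?P)"
    by (rule conjunct1 [OF euler_product_smooth [OF g1 mult summ' fin]]) auto
  have ep2: "infsum g (smooth ?P) = (\<Prod>p\<in>?P. \<Sum>k. g (p ^ k))"
    by (rule conjunct2 [OF euler_product_smooth [OF g1 mult summ' fin]]) auto
  have "(\<Sum>q<N. g (q + 1)) = (\<Sum>q\<in>{1..N}. g q)"
    by (simp add: sum.atLeast1_atMost_eq)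
  also have "\<dots> = infsum g {1..N}"
    by simp
  also have "\<dots> \<le> infsum g (smooth ?P)"
    using atLeastAtMost_subset_smooth [of N] nonneg abs_summable_summable [OF ep1]
    by (intro infsum_mono_neutral) auto
  also have "\<dots> = (\<Prod>p\<in>?P. 1 + (\<Sum>k. g (p ^ Suc k)))"
    unfolding ep2
  proof (rule prod.cong [OF refl])
    fix p assume "p \<in> ?P"
    then show "(\<Sum>k. g (p ^ k)) = 1 + (\<Sum>k. g (p ^ Suc k))"
      using suminf_split_head [OF summ [of p]] g1 by simp
  qed
  also have "\<dots> \<le> (\<Prod>p\<in>?P. exp (\<Sum>k. g (p ^ Suc k)))"
  proof (rule prod_mono)
    fix p assume "p \<in> ?P"
    then have "summable (\<lambda>k. g (p ^ Suc k))"
      using summ [of p] by (subst summable_Suc_iff) auto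
    then have "0 \<le> (\<Sum>k. g (p ^ Suc k))"
      using nonneg by (intro suminf_nonneg)
    then show "0 \<le> 1 + (\<Sum>k. g (p ^ Suc k)) \<and> 1 + (\<Sum>k. g (p ^ Suc k)) \<le> exp (\<Sum>k. g (p ^ Suc k))"
      using exp_ge_add_one_self by simp
  qed
  also have "\<dots> = exp (\<Sum>p\<in>?P. \<Sum>k. g (p ^ Suc k))"
    by (rule exp_sum [symmetric, OF fin])
  also have "\<dots> \<le> exp B"
    using bound [of N] by simp
  finally show "(\<Sum>q<N. g (q + 1)) \<le> exp B" .
qed

text \<open>The finite Euler product is the sum over smooth numbers, which include all numbers up to
  \<open>N\<close>. The difference to the full series is at most the tail \<open>e N\<close> of the
  absolute series.\<close>

lemma euler_product_limit:
  fixes f :: "nat \<Rightarrow> 'a::{banach, real_normed_field}"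
  assumes f1: "f 1 = 1"
    and mult: "\<And>a b. a > 0 \<Longrightarrow> b > 0 \<Longrightarrow> coprime a b \<Longrightarrow> f (a * b) = f a * f b"
    and summ: "\<And>p. prime p \<Longrightarrow> summable (\<lambda>k. norm (f (p ^ k)))"
    and abs: "summable (\<lambda>q. norm (f (q + 1)))"
  shows "(\<lambda>N. \<Prod>p\<in>{p. prime p \<and> p \<le> N}. \<Sum>k. f (p ^ k)) \<longlonglongrightarrow> (\<Sum>q. f (q + 1))"
proof -
  define S where "S N = smooth {p. prime p \<and> p \<le> N}" for N
  have prod: "(\<Prod>p\<in>{p. prime p \<and> p \<le> N}. \<Sum>k. f (p ^ k)) = infsum f (S N)" for N
  proof -
    have fin: "finite {p. prime p \<and> p \<le> N}"
      by (rule finite_subset [of _ "{..N}"]) auto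
    have "infsum f (S N) = (\<Prod>p\<in>{p. prime p \<and> p \<le> N}. \<Sum>k. f (p ^ k))"
      unfolding S_def by (rule conjunct2 [OF euler_product_smooth [OF f1 mult summ fin]]) auto
    then show ?thesis ..
  qed
  have bij: "bij_betw (\<lambda>q. q + 1) UNIV {0::nat<..}"
    by (rule bij_betwI [of _ _ _ "\<lambda>q. q - 1"]) auto
  have abs': "(\<lambda>x. norm (f x)) summable_on {0<..}"
    using abs by (subst summable_on_reindex_bij_betw [OF bij, symmetric]) (simp add: norm_summable_imp_summable_on)
  have sub: "S N \<subseteq> {0<..}" for N
    by (auto simp: S_def smooth_def)
  have total: "infsum f {0<..} = (\<Sum>q. f (q + 1))"
    using infsum_reindex_bij_betw [OF bij, of f] infsum_nat_eq_suminf [OF abs] by simp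
  define e where "e N = infsum (\<lambda>q. norm (f q)) {0<..} - (\<Sum>q\<in>{1..N}. norm (f q))" for N
  have tot': "infsum (\<lambda>q. norm (f q)) {0<..} = (\<Sum>q. norm (f (q + 1)))"
    using infsum_reindex_bij_betw [OF bij, of "\<lambda>q. norm (f q)"] infsum_nat_eq_suminf [of "\<lambda>q. norm (f (q + 1))"] abs by simp
  have "(\<lambda>N. \<Sum>q<N. norm (f (q + 1))) \<longlonglongrightarrow> infsum (\<lambda>q. norm (f q)) {0<..}"
    unfolding tot' by (rule summable_LIMSEQ [OF abs])
  moreover have "(\<Sum>q<N. norm (f (q + 1))) = (\<Sum>q\<in>{1..N}. norm (f q))" for N
    by (simp add: sum.atLeast1_atMost_eq)
  ultimately have "(\<lambda>N. \<Sum>q\<in>{1..N}. norm (f q)) \<longlonglongrightarrow> infsum (\<lambda>q. norm (f q)) {0<..}"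
    by simp
  from tendsto_diff [OF tendsto_const [of "infsum (\<lambda>q. norm (f q)) {0<..}"] this] have e0: "e \<longlonglongrightarrow> 0"
    unfolding e_def by simp
  have "norm ((\<Sum>q. f (q + 1)) - infsum f (S N)) \<le> e N" for N
  proof -
    have sS: "(\<lambda>x. norm (f x)) summable_on S N"
      by (rule summable_on_subset_banach [OF abs' sub])
    have sR: "(\<lambda>x. norm (f x)) summable_on {0<..} - S N"
      by (rule summable_on_subset_banach [OF abs']) auto
    have "infsum f {0<..} = infsum f (S N) + infsum f ({0<..} - S N)"
      using infsum_Un_disjoint [OF abs_summable_summable [OF sS] abs_summable_summable [OF sR]] sub [of N]
      by (simp add: Un_absorb1 Un_Diff_cancel)
    then have "norm ((\<Sum>q. f (q + 1)) - infsum f (S N)) = norm (infsum f ({0<..} - S N))"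
      by (simp add: total)
    also have "\<dots> \<le> infsum (\<lambda>q. norm (f q)) ({0<..} - S N)"
      by (rule norm_infsum_bound [OF sR])
    also have "\<dots> \<le> infsum (\<lambda>q. norm (f q)) ({0<..} - {1..N})"
    proof (rule infsum_mono_neutral)
      show "(\<lambda>x. norm (f x)) summable_on {0<..} - {1..N}"
        by (rule summable_on_subset_banach [OF abs']) auto
      show "(\<lambda>q. norm (f q)) summable_on {0<..} - S N"
        by (rule sR)
    qed (use atLeastAtMost_subset_smooth [of N] in \<open>auto simp: S_def\<close>)
    also have "\<dots> = e N"
    proof -
      have s1: "(\<lambda>x. norm (f x)) summable_on {0<..} - {1..N}"
        by (rule summable_on_subset_banach [OF abs']) auto
      have "infsum (\<lambda>q. norm (f q)) ({1..N} \<union> ({0<..} - {1..N})) = infsum (\<lambda>q. norm (f q)) {1..N} + infsum (\<lambda>q. norm (f q)) ({0<..} - {1..N})"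
        by (rule infsum_Un_disjoint [OF _ s1]) auto
      moreover have "{1..N} \<union> ({0<..} - {1..N}) = {0<..}"
        by auto
      ultimately show ?thesis
        by (simp add: e_def)
    qed
    finally show ?thesis .
  qed
  then have "(\<lambda>N. (\<Sum>q. f (q + 1)) - infsum f (S N)) \<longlonglongrightarrow> 0"
    by (intro Lim_null_comparison [OF _ e0]) auto
  from tendsto_diff [OF tendsto_const [of "\<Sum>q. f (q + 1)"] this] show ?thesis
    unfolding prod by simp
qed

section \<open>Counting kernels through the rational rank\<close>

text \<open>\<open>B\<close> consists of a maximal independent set of rows of \<open>A\<close>,
  completed by unit vectors to a basis. Up to sign its determinant is a nonzero minor of
  \<open>A\<close> of size \<open>rank A\<close>, packaged as a full square matrix.\<close>

lemma row_selection:
  fixes A :: "int^'n^'n"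
  obtains B R where "card R = rank (real_mat A)" "\<And>i. i \<in> R \<Longrightarrow> \<exists>k. B$i = A$k"
    "\<And>i. i \<notin> R \<Longrightarrow> \<exists>j. B$i = axis j 1" "det B \<noteq> 0" "det A \<noteq> 0 \<Longrightarrow> B = A"
proof (cases "det A = 0")
  case False
  then have "rank (real_mat A) = CARD('n)"
    using det_eq_0_rank [of "real_mat A"] rank_bound [of "real_mat A"] by (simp add: det_real_mat)
  then show ?thesis
    by (intro that [of UNIV A]) (use False in auto)
next
  case True
  let ?A = "real_mat A"
  obtain S where S: "S \<subseteq> rows ?A" "independent S" "card S = rank ?A"
    using basis_exists [of "rows ?A"] by (metis row_rank_def)
  \<comment> \<open>Extending inside \<open>S \<union> Basis\<close> guarantees that every added row
    is a unit vector and thus integral.\<close>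
  obtain S' where S': "S \<subseteq> S'" "S' \<subseteq> S \<union> Basis" "independent S'" "S \<union> Basis \<subseteq> span S'"
    using maximal_independent_subset_extend [of S "S \<union> Basis"] S(2) by blast
  have "span S' = UNIV"
    using S'(4) by (metis Un_subset_iff span_Basis span_mono span_span top.extremum_uniqueI)
  then have cardS': "card S' = CARD('n)" "dim S' = CARD('n)"
    using S'(3) by (metis dim_UNIV DIM_cart DIM_real dim_eq_card_independent dim_span mult.right_neutral)+
  have "finite S'"
    using S'(3) independent_imp_finite by blast
  then obtain \<beta> where \<beta>: "bij_betw \<beta> (UNIV :: 'n set) S'"
    using cardS'(1) by (metis finite_same_card_bij finite)
  define R where "R = {i. \<beta> i \<in> S}"
  have "bij_betw \<beta> R S"
    using \<beta> S'(1) unfolding R_def bij_betw_def by (auto simp: inj_on_def)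
  then have "card R = rank ?A"
    using S(3) bij_betw_same_card by metis
  moreover have "\<exists>w. (if i \<in> R then (\<exists>k. w = A$k) else (\<exists>j. w = axis j 1)) \<and> \<beta> i = real_vec w" for i
  proof (cases "i \<in> R")
    case True
    then obtain k where "\<beta> i = row k ?A"
      using S(1) by (auto simp: R_def rows_def)
    then have "\<beta> i = real_vec (A$k)"
      by (simp add: row_def real_mat_def real_vec_def vec_eq_iff)
    with True show ?thesis
      by auto
  next
    case False
    moreover have "\<beta> i \<in> S'"
      using \<beta> by (auto simp: bij_betw_def)
    ultimately have "\<beta> i \<in> Basis"
      using S'(2) by (auto simp: R_def)
    then obtain j where "\<beta> i = axis j 1"
      by (auto simp: Basis_vec_def)
    then have "\<beta> i = real_vec (axis j 1)"
      by (simp add: axis_def real_vec_def vec_eq_iff)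
    with False show ?thesis
      by auto
  qed
  then obtain w where w: "\<And>i. if i \<in> R then (\<exists>k. w i = A$k) else (\<exists>j. w i = axis j 1)"
    "\<And>i. \<beta> i = real_vec (w i)"
    by metis
  define B where "B = (\<chi> i. w i)"
  have "rows (real_mat B) = S'"
  proof -
    have "row i (real_mat B) = \<beta> i" for i
      unfolding w(2) by (simp add: row_def real_mat_def real_vec_def vec_eq_iff B_def)
    then have "rows (real_mat B) = range \<beta>"
      by (auto simp: rows_def)
    then show ?thesis
      using \<beta> by (simp add: bij_betw_def)
  qed
  then have "rank (real_mat B) = CARD('n)"
    by (simp add: row_rank_def cardS'(2))
  then have "det B \<noteq> 0"
    using det_eq_0_rank [of "real_mat B"] by (simp add: det_real_mat)
  ultimately show ?thesis
    using that [of R B] w(1) True unfolding B_def by (metis vec_lambda_beta)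
qed

text \<open>In each term of the Leibniz formula only the rows in \<open>R\<close> contribute a
  factor \<open>M\<close>.\<close>

lemma abs_det_le:
  fixes B :: "int^'n^'n" and M :: real
  assumes "M \<ge> 1" "\<And>i j. i \<in> R \<Longrightarrow> real_of_int \<bar>B$i$j\<bar> \<le> M" "\<And>i j. i \<notin> R \<Longrightarrow> \<bar>B$i$j\<bar> \<le> 1"
  shows "real_of_int \<bar>det B\<bar> \<le> fact CARD('n) * M ^ card R"
proof -
  have "real_of_int \<bar>det B\<bar> \<le> real_of_int (\<Sum>p\<in>{p. p permutes (UNIV :: 'n set)}. \<bar>of_int (sign p) * (\<Prod>i\<in>UNIV. B$i$p i)\<bar>)"
    unfolding det_def of_int_le_iff by (rule sum_abs)
  also have "\<dots> = (\<Sum>p\<in>{p. p permutes (UNIV :: 'n set)}. \<Prod>i\<in>UNIV. real_of_int \<bar>B$i$p i\<bar>)"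
    by (auto simp: abs_mult abs_prod sign_def intro!: sum.cong)
  also have "\<dots> \<le> (\<Sum>p\<in>{p. p permutes (UNIV :: 'n set)}. M ^ card R)"
  proof (rule sum_mono)
    fix p :: "'n \<Rightarrow> 'n"
    have "(\<Prod>i\<in>UNIV. real_of_int \<bar>B$i$p i\<bar>) \<le> (\<Prod>i\<in>UNIV. if i \<in> R then M else 1)"
    proof (intro prod_mono conjI)
      fix i
      show "real_of_int \<bar>B$i$p i\<bar> \<le> (if i \<in> R then M else 1)"
        using assms(2) assms(3) [of i "p i"] by (cases "i \<in> R") (auto simp flip: of_int_abs)
    qed simp
    also have "\<dots> = (\<Prod>i\<in>R. M)"
      by (rule prod.mono_neutral_cong_right) auto
    finally show "(\<Prod>i\<in>UNIV. real_of_int \<bar>B$i$p i\<bar>) \<le> M ^ card R"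
      by simp
  qed
  also have "\<dots> = fact CARD('n) * M ^ card R"
    by (simp add: card_permutations)
  finally show ?thesis .
qed

text \<open>The unit rows of \<open>B\<close> pick out coordinates. Kernel vectors of
  \<open>A\<close> which agree in these coordinates differ by a kernel vector of \<open>B\<close>,
  and the coordinates take at most \<open>q ^ (n - card R)\<close> values.\<close>

lemma card_kerq_le_selection:
  fixes A B :: "int^'n^'n"
  assumes q: "q > 0" and R: "\<And>i. i \<in> R \<Longrightarrow> \<exists>k. B$i = A$k"
    and nR: "\<And>i. i \<notin> R \<Longrightarrow> \<exists>j. B$i = axis j 1"
  shows "card (kerq (int q) A) \<le> q ^ (CARD('n) - card R) * card (kerq (int q) B)"
proof -
  obtain j where j: "\<And>i. i \<notin> R \<Longrightarrow> B$i = axis (j i) 1"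
    using nR by metis
  define \<pi> where "\<pi> y = restrict (\<lambda>i. y$(j i)) (- R)" for y :: "int^'n"
  define F where "F v = {y \<in> kerq (int q) A. \<pi> y = v}" for v
  let ?V = "PiE (- R) (\<lambda>_. {0..<int q})"
  have F: "card (F v) \<le> card (kerq (int q) B)" for v
  proof (cases "F v = {}")
    case False
    then obtain y0 where y0: "y0 \<in> F v"
      by blast
    have row: "(B *v (y - y0))$i = (if i \<in> R then (A *v (y - y0))$(SOME k. B$i = A$k) else y$(j i) - y0$(j i))" for y i
    proof (cases "i \<in> R")
      case True
      then have "B$i = A$(SOME k. B$i = A$k)"
        using R by (metis (mono_tags) someI_ex)
      then show ?thesis
        using True by (simp add: matrix_vector_mult_def)
    next
      case False
      then show ?thesis
        by (simp add: matrix_vector_mult_def j axis_def if_distrib if_distribR cong: if_cong)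
    qed
    have inj: "inj_on (\<lambda>y. vmod (y - y0) (int q)) (F v)"
    proof (rule inj_onI)
      fix x y assume xy: "x \<in> F v" "y \<in> F v" "vmod (x - y0) (int q) = vmod (y - y0) (int q)"
      have "int q dvd x$i - y$i" for i
      proof -
        have "(x$i - y0$i) mod int q = (y$i - y0$i) mod int q"
          using xy(3) by (simp add: vmod_def vec_eq_iff)
        then show ?thesis
          by (simp add: mod_eq_dvd_iff)
      qed
      then show "x = y"
        using xy by (intro ibox_cong_imp_eq [of _ "int q"]) (auto simp: F_def kerq_def)
    qed
    have "(\<lambda>y. vmod (y - y0) (int q)) ` F v \<subseteq> kerq (int q) B"
    proof clarify
      fix y assume y: "y \<in> F v"
      have "int q dvd (A *v (y - y0))$i" for i
        using y y0 by (simp add: F_def kerq_def matrix_vector_mult_diff_distrib)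
      moreover have "y$(j i) = y0$(j i)" if "i \<notin> R" for i
      proof -
        have "\<pi> y i = \<pi> y0 i"
          using y y0 by (simp add: F_def)
        then show ?thesis
          using that by (simp add: \<pi>_def)
      qed
      ultimately have "int q dvd (B *v (y - y0))$i" for i
        by (simp add: row)
      moreover have "[(B *v vmod (y - y0) (int q))$i = (B *v (y - y0))$i] (mod int q)" for i
        by (rule mult_vec_cong) (simp add: vmod_def)
      ultimately have "int q dvd (B *v vmod (y - y0) (int q))$i" for i
        using cong_dvd_iff by blast
      then show "vmod (y - y0) (int q) \<in> kerq (int q) B"
        using q by (simp add: kerq_def)
    qed
    then show ?thesis
      by (intro card_inj_on_le [OF inj]) auto
  qed simp
  have fin: "finite ?V"
    by (simp add: finite_PiE)
  have "kerq (int q) A \<subseteq> (\<Union>v\<in>?V. F v)"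
    by (auto simp: F_def \<pi>_def kerq_def ibox_def)
  then have "card (kerq (int q) A) \<le> card (\<Union>v\<in>?V. F v)"
    by (intro card_mono finite_UN_I fin) (auto simp: F_def)
  also have "\<dots> \<le> (\<Sum>v\<in>?V. card (F v))"
    by (rule card_UN_le [OF fin])
  also have "\<dots> \<le> (\<Sum>v\<in>?V. card (kerq (int q) B))"
    by (rule sum_mono) (rule F)
  also have "\<dots> = q ^ (CARD('n) - card R) * card (kerq (int q) B)"
    by (simp add: card_PiE Compl_eq_Diff_UNIV card_Diff_subset)
  finally show ?thesis .
qed

section \<open>Kernel counts and rank statistics for the matrices of the form\<close>

definition rk :: "('n::finite \<Rightarrow> 'n \<Rightarrow> 'n \<Rightarrow> int) \<Rightarrow> int^'n \<Rightarrow> nat" where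
  "rk c h = rank (Mmat c (($) h))"

lemma rk_le: "rk c h \<le> CARD('n)" for c :: "'n::finite \<Rightarrow> 'n \<Rightarrow> 'n \<Rightarrow> int"
  unfolding rk_def using rank_bound [of "Mmat c (($) h)"] by simp

lemma rk_eq: "rk c h = rank (real_mat (hm c h))"
proof -
  let ?M = "Mmat c (($) h)" and ?A = "real_mat (hm c h)"
  have 1: "?A = ?M ** mat 6" and 2: "?M = ?A ** mat (1 / 6)"
    by (simp_all add: vec_eq_iff matrix_matrix_mult_def mat_def real_mat_def hm_def hess_def Mmat_def
        sum_distrib_left if_distrib mult_ac cong: if_cong)
  have "rank ?A \<le> rank ?M"
    by (subst 1) (rule rank_mul_le_left)
  moreover have "rank ?M \<le> rank ?A"
    by (subst 2) (rule rank_mul_le_left)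
  ultimately show ?thesis
    by (simp add: rk_def)
qed

definition coeff_size :: "('n::finite \<Rightarrow> 'n \<Rightarrow> 'n \<Rightarrow> int) \<Rightarrow> real" where
  "coeff_size c = 1 + 6 * (\<Sum>i\<in>UNIV. \<Sum>j\<in>UNIV. \<Sum>k\<in>UNIV. real_of_int \<bar>c i j k\<bar>)"

lemma coeff_size_ge_1: "coeff_size c \<ge> 1"
  by (simp add: coeff_size_def sum_nonneg)

lemma abs_hm_le:
  fixes c :: "'n::finite \<Rightarrow> 'n \<Rightarrow> 'n \<Rightarrow> int"
  assumes "\<And>i. real_of_int \<bar>h$i\<bar> \<le> M"
  shows "real_of_int \<bar>hm c h$j$k\<bar> \<le> coeff_size c * M"
proof -
  have M0: "M \<ge> 0"
    using assms [of undefined] by linarith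
  have "real_of_int \<bar>hm c h$j$k\<bar> \<le> real_of_int (\<Sum>i\<in>UNIV. \<bar>6 * c i j k * h$i\<bar>)"
    unfolding of_int_le_iff by (simp add: hm_def hess_def sum_abs)
  also have "\<dots> = (\<Sum>i\<in>UNIV. 6 * real_of_int \<bar>c i j k\<bar> * real_of_int \<bar>h$i\<bar>)"
    by (simp add: abs_mult)
  also have "\<dots> \<le> (\<Sum>i\<in>UNIV. 6 * real_of_int \<bar>c i j k\<bar> * M)"
    using assms by (intro sum_mono mult_left_mono) auto
  also have "\<dots> = 6 * (\<Sum>i\<in>UNIV. real_of_int \<bar>c i j k\<bar>) * M"
    by (simp add: sum_distrib_left sum_distrib_right)
  also have "\<dots> \<le> coeff_size c * M"
  proof (rule mult_right_mono [OF _ M0])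
    have "real_of_int \<bar>c i j k\<bar> \<le> (\<Sum>j\<in>UNIV. \<Sum>k\<in>UNIV. real_of_int \<bar>c i j k\<bar>)" for i
    proof -
      have "real_of_int \<bar>c i j k\<bar> \<le> (\<Sum>k\<in>UNIV. real_of_int \<bar>c i j k\<bar>)"
        by (rule member_le_sum) auto
      also have "\<dots> \<le> (\<Sum>j\<in>UNIV. \<Sum>k\<in>UNIV. real_of_int \<bar>c i j k\<bar>)"
        by (rule member_le_sum) (auto simp: sum_nonneg)
      finally show ?thesis .
    qed
    then have "(\<Sum>i\<in>UNIV. real_of_int \<bar>c i j k\<bar>) \<le> (\<Sum>i\<in>UNIV. \<Sum>j\<in>UNIV. \<Sum>k\<in>UNIV. real_of_int \<bar>c i j k\<bar>)"
      by (intro sum_mono)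
    then show "6 * (\<Sum>i\<in>UNIV. real_of_int \<bar>c i j k\<bar>) \<le> coeff_size c"
      by (simp add: coeff_size_def)
  qed
  finally show ?thesis .
qed

definition minor_const :: "('n::finite \<Rightarrow> 'n \<Rightarrow> 'n \<Rightarrow> int) \<Rightarrow> real" where
  "minor_const c = fact CARD('n) * coeff_size c ^ CARD('n)"

lemma minor_const_ge_1: "minor_const c \<ge> 1"
proof -
  have "1 \<le> coeff_size c ^ CARD('a)"
    using coeff_size_ge_1 by (rule one_le_power)
  moreover have "(1::real) \<le> fact CARD('a)"
    by simp
  ultimately show ?thesis
    unfolding minor_const_def by (metis mult_mono mult_1 zero_le_one order_trans)
qed

text \<open>\<open>\<Delta>\<close> is the determinant supplied by \<open>row_selection\<close>. The
  count valid for all prime powers loses the factor \<open>\<bar>\<Delta>\<bar>\<close>, the count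
  for primes not dividing \<open>\<Delta>\<close> loses nothing. One \<open>\<Delta>\<close> serves
  all primes at once, which is what confines the loss to few primes when averaging.\<close>

lemma kernel_count_rank:
  fixes c :: "'n::finite \<Rightarrow> 'n \<Rightarrow> 'n \<Rightarrow> int"
  assumes M: "M \<ge> 1" "\<And>i. real_of_int \<bar>h$i\<bar> \<le> M"
  shows "\<exists>\<Delta> :: int. \<Delta> \<noteq> 0 \<and> real_of_int \<bar>\<Delta>\<bar> \<le> minor_const c * M ^ rk c h \<and>
    (\<forall>p k. prime p \<longrightarrow> int (card (kerq (int (p ^ k)) (hm c h))) \<le> int (p ^ k) ^ (CARD('n) - rk c h) * \<bar>\<Delta>\<bar>) \<and>
    (\<forall>p. prime p \<longrightarrow> \<not> int p dvd \<Delta> \<longrightarrow> card (kerq (int p) (hm c h)) \<le> p ^ (CARD('n) - rk c h)) \<and>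
    (det (hm c h) \<noteq> 0 \<longrightarrow> \<Delta> = det (hm c h))"
proof -
  let ?A = "hm c h"
  obtain B R where B: "card R = rank (real_mat ?A)" "\<And>i. i \<in> R \<Longrightarrow> \<exists>k. B$i = ?A$k"
    "\<And>i. i \<notin> R \<Longrightarrow> \<exists>j. B$i = axis j 1" "det B \<noteq> 0" "det ?A \<noteq> 0 \<Longrightarrow> B = ?A"
    using row_selection [of ?A] by metis
  have R: "card R = rk c h"
    by (simp add: B(1) rk_eq)
  have "real_of_int \<bar>det B\<bar> \<le> fact CARD('n) * (coeff_size c * M) ^ card R"
  proof (rule abs_det_le)
    show "1 \<le> coeff_size c * M"
      using coeff_size_ge_1 [of c] M(1) by (metis mult_mono mult_1 zero_le_one order_trans)
    show "real_of_int \<bar>B$i$j\<bar> \<le> coeff_size c * M" if "i \<in> R" for i j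
      using B(2) [OF that] abs_hm_le [OF M(2)] by metis
    show "\<bar>B$i$j\<bar> \<le> 1" if "i \<notin> R" for i j
      using B(3) [OF that] by (auto simp: axis_def)
  qed
  also have "\<dots> = fact CARD('n) * (coeff_size c ^ rk c h * M ^ rk c h)"
    by (simp add: R power_mult_distrib)
  also have "\<dots> \<le> fact CARD('n) * (coeff_size c ^ CARD('n) * M ^ rk c h)"
    using coeff_size_ge_1 [of c] M(1) rk_le [of c h]
    by (intro mult_left_mono mult_right_mono power_increasing) auto
  finally have 1: "real_of_int \<bar>det B\<bar> \<le> minor_const c * M ^ rk c h"
    by (simp add: minor_const_def mult.assoc)
  have sel: "card (kerq (int q) ?A) \<le> q ^ (CARD('n) - rk c h) * card (kerq (int q) B)" if "q > 0" for q
    using card_kerq_le_selection [of q R B ?A] that B(2,3) by (simp add: R)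
  have 2: "int (card (kerq (int (p ^ k)) ?A)) \<le> int (p ^ k) ^ (CARD('n) - rk c h) * \<bar>det B\<bar>" if "prime p" for p k
  proof -
    have "int (card (kerq (int (p ^ k)) ?A)) \<le> int ((p ^ k) ^ (CARD('n) - rk c h) * card (kerq (int (p ^ k)) B))"
      using sel [of "p ^ k"] that by (simp only: of_nat_le_iff prime_gt_0_nat zero_less_power)
    also have "\<dots> = int (p ^ k) ^ (CARD('n) - rk c h) * int (card (kerq (int p ^ k) B))"
      by simp
    also have "\<dots> \<le> int (p ^ k) ^ (CARD('n) - rk c h) * \<bar>det B\<bar>"
      using that B(4) by (intro mult_left_mono card_kerq_le_det) auto
    finally show ?thesis .
  qed
  have 3: "card (kerq (int p) ?A) \<le> p ^ (CARD('n) - rk c h)" if p: "prime p" "\<not> int p dvd det B" for p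
  proof -
    have "coprime (int p) (det B)"
      using p coprime_int_prime coprime_commute by blast
    then have "y = 0" if "y \<in> kerq (int p) B" for y
    proof -
      have "int p dvd y$j - (0::int^'n)$j" for j
        using dvd_vec_if_dvd_mult_vec [of "int p" B y j] that \<open>coprime (int p) (det B)\<close> by (simp add: kerq_def)
      moreover have "0 \<in> ibox (int p)"
        using p(1) by (simp add: ibox_def prime_gt_0_nat)
      ultimately show ?thesis
        using that by (intro ibox_cong_imp_eq [of _ "int p"]) (auto simp: kerq_def)
    qed
    then have "kerq (int p) B \<subseteq> {0}"
      by blast
    then have "card (kerq (int p) B) \<le> card {0 :: int^'n}"
      by (intro card_mono) auto
    then have "p ^ (CARD('n) - rk c h) * card (kerq (int p) B) \<le> p ^ (CARD('n) - rk c h)"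
      by simp
    then show ?thesis
      using sel [of p] p(1) by (meson order_trans prime_gt_0_nat)
  qed
  show ?thesis
    using B(4,5) 1 2 3 by blast
qed

text \<open>As only finitely many ranks occur, a single constant works for all of them; larger
  values of \<open>\<rho>\<close> give empty sets.\<close>

lemma davenport_uniform:
  fixes c :: "'n::finite \<Rightarrow> 'n \<Rightarrow> 'n \<Rightarrow> int"
  assumes "davenport_geometric c" "\<epsilon> > 0"
  shows "\<exists>K>0. \<forall>\<rho> H. H > 0 \<longrightarrow>
    real (card {h \<in> diff_box H. rk c h = \<rho>}) \<le> K * real H powr (real \<rho> + \<epsilon>)"
proof -
  have "\<forall>\<rho>. \<exists>K. \<rho> \<le> CARD('n) \<longrightarrow> (\<forall>P\<ge>1. real (card {x :: 'n \<Rightarrow> int. (\<forall>i. real_of_int \<bar>x i\<bar> \<le> P) \<and> rank (Mmat c x) = \<rho>})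
      \<le> K * P powr (real \<rho> + \<epsilon>))"
    using assms unfolding davenport_geometric_def by blast
  from choice [OF this] obtain K where K: "\<And>\<rho> P. \<rho> \<le> CARD('n) \<Longrightarrow> P \<ge> 1 \<Longrightarrow>
      real (card {x :: 'n \<Rightarrow> int. (\<forall>i. real_of_int \<bar>x i\<bar> \<le> P) \<and> rank (Mmat c x) = \<rho>}) \<le> K \<rho> * P powr (real \<rho> + \<epsilon>)"
    by blast
  define K' where "K' = 1 + (\<Sum>\<rho>\<le>CARD('n). \<bar>K \<rho>\<bar>)"
  have "K' > 0"
    by (simp add: K'_def sum_nonneg add_pos_nonneg)
  moreover have "real (card {h \<in> diff_box H. rk c h = \<rho>}) \<le> K' * real H powr (real \<rho> + \<epsilon>)" if "H > 0" for \<rho> H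
  proof (cases "\<rho> \<le> CARD('n)")
    case False
    then have "{h \<in> diff_box H. rk c h = \<rho>} = {}"
      using rk_le by fastforce
    then show ?thesis
      using \<open>K' > 0\<close> by (simp only: card.empty) simp
  next
    case True
    let ?X = "{x :: 'n \<Rightarrow> int. (\<forall>i. real_of_int \<bar>x i\<bar> \<le> real H) \<and> rank (Mmat c x) = \<rho>}"
    have "finite ?X"
    proof (rule finite_subset)
      show "?X \<subseteq> PiE UNIV (\<lambda>_. {- int H..int H})"
      proof
        fix x assume "x \<in> ?X"
        then have "real_of_int \<bar>x i\<bar> \<le> real H" for i
          by blast
        then have "\<bar>x i\<bar> \<le> int H" for i
          by (metis of_int_le_iff of_int_of_nat_eq)
        then have "x i \<in> {- int H..int H}" for i
          by (metis abs_le_iff atLeastAtMost_iff minus_le_iff)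
        then show "x \<in> PiE UNIV (\<lambda>_. {- int H..int H})"
          by blast
      qed
    qed (simp add: finite_PiE)
    moreover have "($) ` {h \<in> diff_box H. rk c h = \<rho>} \<subseteq> ?X"
    proof clarify
      fix h :: "int^'n" assume h: "h \<in> diff_box H"
      have "real_of_int \<bar>h$i\<bar> \<le> real H" for i
      proof -
        have "\<bar>h$i\<bar> < int H"
          using h by (simp add: diff_box_def)
        then show ?thesis
          by linarith
      qed
      then show "(\<forall>i. real_of_int \<bar>h$i\<bar> \<le> real H) \<and> rank (Mmat c (($) h)) = rk c h"
        by (simp add: rk_def)
    qed
    moreover have "inj_on ($) {h \<in> diff_box H. rk c h = \<rho>}"
      by (auto simp: inj_on_def vec_eq_iff fun_eq_iff)
    ultimately have "card {h \<in> diff_box H. rk c h = \<rho>} \<le> card ?X"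
      by (intro card_inj_on_le)
    then have "real (card {h \<in> diff_box H. rk c h = \<rho>}) \<le> real (card ?X)"
      by simp
    also have "\<dots> \<le> K \<rho> * real H powr (real \<rho> + \<epsilon>)"
      using K [OF True, of "real H"] that by simp
    also have "\<dots> \<le> K' * real H powr (real \<rho> + \<epsilon>)"
    proof (rule mult_right_mono)
      have "\<bar>K \<rho>\<bar> \<le> (\<Sum>\<rho>\<le>CARD('n). \<bar>K \<rho>\<bar>)"
        using True by (intro member_le_sum) auto
      then show "K \<rho> \<le> K'"
        by (simp add: K'_def)
    qed simp
    finally show ?thesis .
  qed
  ultimately show ?thesis
    by blast
qed

lemma sum_diff_box_by_rank:
  fixes c :: "'n::finite \<Rightarrow> 'n \<Rightarrow> 'n \<Rightarrow> int"
  shows "(\<Sum>h\<in>diff_box H. F (rk c h)) = (\<Sum>\<rho>\<le>CARD('n). real (card {h \<in> diff_box H. rk c h = \<rho>}) * F \<rho>)"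
proof -
  have "(\<Sum>h\<in>diff_box H. F (rk c h)) = (\<Sum>\<rho>\<le>CARD('n). \<Sum>h\<in>{h \<in> diff_box H. rk c h = \<rho>}. F (rk c h))"
    using rk_le by (intro sum.group [symmetric]) auto
  also have "\<dots> = (\<Sum>\<rho>\<le>CARD('n). real (card {h \<in> diff_box H. rk c h = \<rho>}) * F \<rho>)"
    by (intro sum.cong refl) auto
  finally show ?thesis .
qed

section \<open>A pointwise bound for prime powers\<close>

lemma abs_diff_box: "h \<in> diff_box H \<Longrightarrow> real_of_int \<bar>h$i\<bar> \<le> real H"
proof -
  assume "h \<in> diff_box H"
  then have "\<bar>h$i\<bar> < int H"
    by (simp add: diff_box_def)
  then show ?thesis
    by linarith
qed

text \<open>Rank \<open>\<rho>\<close> occurs about \<open>H powr (\<rho> + \<epsilon>)\<close>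
  times, with a minor of size \<open>H ^ \<rho>\<close>. Its contribution is
  \<open>q ^ n * H powr \<epsilon> * (H ^ 3 / q) powr (\<rho> / 2)\<close>, so
  \<open>H = q powr (1 / 3)\<close> is the largest length at which no rank loses. All prime powers
  are treated alike, without asking which primes divide the minor.\<close>

lemma gauss_sum_prime_power_bound:
  fixes c :: "'n::finite \<Rightarrow> 'n \<Rightarrow> 'n \<Rightarrow> int"
  assumes c: "symmetric_coeffs c" and dav: "davenport_geometric c" and \<epsilon>: "\<epsilon> > 0"
    "\<epsilon> \<le> real CARD('n)"
  shows "\<exists>K>0. \<forall>p k a. prime p \<longrightarrow> coprime a (int (p ^ k)) \<longrightarrow>
    (norm (gauss_sum c (p ^ k) a))\<^sup>2 \<le> K * (real (p ^ k) ^ CARD('n))\<^sup>2 * real (p ^ k) powr (- (real CARD('n) - \<epsilon>) / 3)"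
proof -
  let ?n = "CARD('n)"
  obtain Kd where Kd: "Kd > 0" "\<And>\<rho> H. H > 0 \<Longrightarrow>
    real (card {h \<in> diff_box H. rk c h = \<rho>}) \<le> Kd * real H powr (real \<rho> + \<epsilon>)"
    using davenport_uniform [OF dav \<epsilon>(1)] by blast
  \<comment> \<open>The power of 8 absorbs the rounding of \<open>H\<close>: from
    \<open>H \<le> 2 * t\<close> follows \<open>H ^ 3 \<le> 8 * q\<close>.\<close>
  define Km where "Km = sqrt (minor_const c * 8 ^ ?n)"
  have Km: "Km > 0"
    using minor_const_ge_1 [of c] by (simp add: Km_def)
  define K where "K = real (?n + 1) * Kd * Km"
  have "(norm (gauss_sum c (p ^ k) a))\<^sup>2 \<le> K * (real (p ^ k) ^ ?n)\<^sup>2 * real (p ^ k) powr (- (real ?n - \<epsilon>) / 3)"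
    if p: "prime p" and a: "coprime a (int (p ^ k))" for p k a
  proof -
    define q where "q = p ^ k"
    have q: "q > 0" "real q \<ge> 1"
      using p by (auto simp: q_def prime_gt_0_nat Suc_leI)
    define t where "t = real q powr (1 / 3)"
    have t: "t \<ge> 1" "t ^ 3 = real q"
      using q by (simp_all add: t_def ge_one_powr_ge_zero powr_powr flip: powr_realpow)
    define H where "H = nat \<lceil>t\<rceil>"
    have H: "real H \<ge> t" "real H \<le> 2 * t" "H > 0"
      using t(1) unfolding H_def by linarith+
    have H1: "real H \<ge> 1"
      using H by simp
    have "real H ^ 3 \<le> (2 * t) ^ 3"
      using H by (intro power_mono) auto
    then have H3: "real H ^ 3 \<le> 8 * real q"
      using t(2) by (simp add: power_mult_distrib)
    define F where "F \<rho> = sqrt (real q ^ ?n * (real q ^ (?n - \<rho>) * (minor_const c * real H ^ \<rho>)))" for \<rho>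
    have summand: "sqrt (real q ^ ?n * real (card (kerq (int q) (hm c h)))) \<le> F (rk c h)" if h: "h \<in> diff_box H" for h
    proof -
      obtain \<Delta> :: int where \<Delta>: "real_of_int \<bar>\<Delta>\<bar> \<le> minor_const c * real H ^ rk c h"
        "\<And>p k. prime p \<Longrightarrow> int (card (kerq (int (p ^ k)) (hm c h))) \<le> int (p ^ k) ^ (?n - rk c h) * \<bar>\<Delta>\<bar>"
        using kernel_count_rank [OF H1 abs_diff_box [OF h], of c] by blast
      have "real_of_int (int (card (kerq (int q) (hm c h)))) \<le> real_of_int (int q ^ (?n - rk c h) * \<bar>\<Delta>\<bar>)"
        using \<Delta>(2) [OF p, of k] unfolding q_def of_int_le_iff .
      then have "real (card (kerq (int q) (hm c h))) \<le> real q ^ (?n - rk c h) * real_of_int \<bar>\<Delta>\<bar>"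
        by simp
      also have "\<dots> \<le> real q ^ (?n - rk c h) * (minor_const c * real H ^ rk c h)"
        using \<Delta>(1) by (intro mult_left_mono) auto
      finally show ?thesis
        unfolding F_def by (intro real_sqrt_le_mono mult_left_mono) auto
    qed
    have F: "real H ^ \<rho> * F \<rho> \<le> real q ^ ?n * Km" if "\<rho> \<le> ?n" for \<rho>
    proof -
      \<comment> \<open>Multiplication by \<open>q ^ \<rho>\<close> completes
        \<open>q ^ (n - \<rho>)\<close> to \<open>q ^ n\<close>, so the comparison avoids fractional
        exponents.\<close>
      have "real q ^ \<rho> * (real H ^ \<rho> * F \<rho>)\<^sup>2 = real q ^ (\<rho> + (?n - \<rho>)) * real q ^ ?n * minor_const c * (real H ^ 3) ^ \<rho>"
        using minor_const_ge_1 [of c] 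
        by (simp add: F_def power_mult_distrib power_add power_mult [symmetric] power3_eq_cube power2_eq_square mult_ac)
      also have "\<dots> \<le> real q ^ (\<rho> + (?n - \<rho>)) * real q ^ ?n * minor_const c * (8 * real q) ^ \<rho>"
        using minor_const_ge_1 [of c] H3 by (intro mult_left_mono power_mono) auto
      also have "\<dots> = real q ^ \<rho> * (real q ^ ?n * real q ^ ?n * (minor_const c * 8 ^ \<rho>))"
        using that by (simp add: power_mult_distrib mult_ac)
      also have "\<dots> \<le> real q ^ \<rho> * (real q ^ ?n * real q ^ ?n * (minor_const c * 8 ^ ?n))"
        using that minor_const_ge_1 [of c] by (intro mult_left_mono power_increasing) auto
      also have "\<dots> = real q ^ \<rho> * (real q ^ ?n * Km)\<^sup>2"
        using minor_const_ge_1 [of c] by (simp add: Km_def power_mult_distrib power2_eq_square mult_ac)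
      finally have "(real H ^ \<rho> * F \<rho>)\<^sup>2 \<le> (real q ^ ?n * Km)\<^sup>2"
        using q by simp
      then show ?thesis
        by (rule power2_le_imp_le) (use Km in auto)
    qed
    have Fpos: "F \<rho> \<ge> 0" for \<rho>
      using minor_const_ge_1 [of c] by (simp add: F_def)
    have "(\<Sum>h\<in>diff_box H. sqrt (real q ^ ?n * real (card (kerq (int q) (hm c h))))) \<le> (\<Sum>h\<in>diff_box H. F (rk c h))"
      by (rule sum_mono) (rule summand)
    also have "\<dots> = (\<Sum>\<rho>\<le>?n. real (card {h \<in> diff_box H. rk c h = \<rho>}) * F \<rho>)"
      by (rule sum_diff_box_by_rank)
    also have "\<dots> \<le> (\<Sum>\<rho>\<le>?n. Kd * real H powr \<epsilon> * (real q ^ ?n * Km))"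
    proof (rule sum_mono)
      fix \<rho> assume "\<rho> \<in> {..?n}"
      have "real (card {h \<in> diff_box H. rk c h = \<rho>}) * F \<rho> \<le> Kd * real H powr (real \<rho> + \<epsilon>) * F \<rho>"
        by (rule mult_right_mono [OF Kd(2) [OF H(3)] Fpos])
      also have "\<dots> = Kd * real H powr \<epsilon> * (real H ^ \<rho> * F \<rho>)"
        using H by (simp add: powr_add powr_realpow)
      also have "\<dots> \<le> Kd * real H powr \<epsilon> * (real q ^ ?n * Km)"
        using F [of \<rho>] \<open>\<rho> \<in> {..?n}\<close> Kd(1) by (intro mult_left_mono) auto
      finally show "real (card {h \<in> diff_box H. rk c h = \<rho>}) * F \<rho> \<le> Kd * real H powr \<epsilon> * (real q ^ ?n * Km)" .
    qed
    also have "\<dots> = K * real q ^ ?n * real H powr \<epsilon>"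
      by (simp add: K_def)
    finally have S: "(\<Sum>h\<in>diff_box H. sqrt (real q ^ ?n * real (card (kerq (int q) (hm c h))))) \<le> K * real q ^ ?n * real H powr \<epsilon>" .
    have "(norm (gauss_sum c q a))\<^sup>2 \<le> real q ^ ?n / real H ^ ?n * (K * real q ^ ?n * real H powr \<epsilon>)"
    proof (rule order_trans [OF weyl_van_der_corput [OF c q(1) _ H(3)]])
      show "coprime a (int q)"
        using a by (simp only: q_def)
    qed (rule mult_left_mono [OF S], simp)
    also have "\<dots> = K * (real q ^ ?n)\<^sup>2 * real H powr (\<epsilon> - real ?n)"
      using H by (simp add: powr_diff powr_realpow power2_eq_square field_simps)
    also have "\<dots> \<le> K * (real q ^ ?n)\<^sup>2 * t powr (\<epsilon> - real ?n)"
      using H t \<epsilon> Kd(1) Km by (intro mult_left_mono powr_mono2') (auto simp: K_def)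
    also have "t powr (\<epsilon> - real ?n) = real q powr (- (real ?n - \<epsilon>) / 3)"
      by (simp add: t_def powr_powr diff_divide_distrib)
    finally show ?thesis
      by (simp only: q_def)
  qed
  moreover have "K > 0"
    using Kd(1) Km by (simp add: K_def)
  ultimately show ?thesis
    by blast
qed

lemma sing_abs_term_le:
  fixes c :: "'n::finite \<Rightarrow> 'n \<Rightarrow> 'n \<Rightarrow> int"
  assumes "q > 0" "\<And>a. coprime a (int q) \<Longrightarrow> norm (gauss_sum c q a) \<le> real q ^ CARD('n) * B" "B \<ge> 0"
  shows "sing_abs_term c q \<le> real q * B"
proof -
  have "(\<Sum>a\<in>runits q. norm (gauss_sum c q a)) \<le> (\<Sum>a\<in>runits q. real q ^ CARD('n) * B)"
    by (rule sum_mono) (use assms(2) in \<open>auto simp: runits_def\<close>)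
  also have "\<dots> = real (card (runits q)) * (real q ^ CARD('n) * B)"
    by simp
  also have "\<dots> \<le> real q * (real q ^ CARD('n) * B)"
  proof (intro mult_right_mono)
    have "card (runits q) \<le> card {0..<int q}"
      by (rule card_mono) (auto simp: runits_def)
    then show "real (card (runits q)) \<le> real q"
      by simp
  qed (use assms(3) in auto)
  finally show ?thesis
    using assms(1) by (simp add: sing_abs_term_runits field_simps)
qed

lemma sing_abs_term_prime_power_bound:
  fixes c :: "'n::finite \<Rightarrow> 'n \<Rightarrow> 'n \<Rightarrow> int"
  assumes n: "CARD('n) \<ge> 10" and c: "symmetric_coeffs c" and dav: "davenport_geometric c"
  shows "\<exists>K>0. \<forall>p k. prime p \<longrightarrow> sing_abs_term c (p ^ k) \<le> K * real (p ^ k) powr (- 3 / 5)"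
proof -
  \<comment> \<open>With \<open>\<epsilon> = 2 / 5\<close> and \<open>n \<ge> 10\<close> the
    exponent \<open>(n - \<epsilon>) / 3\<close> is at least \<open>16 / 5\<close>. Its half is
    \<open>8 / 5\<close>, and summing over the residues \<open>a\<close> costs one power of
    \<open>q\<close>, leaving \<open>- 3 / 5\<close>.\<close>
  have "(0::real) < 2 / 5" "2 / 5 \<le> real CARD('n)"
    using n by linarith+
  then obtain K where K: "K > 0" "\<And>p k a. prime p \<Longrightarrow> coprime a (int (p ^ k)) \<Longrightarrow>
    (norm (gauss_sum c (p ^ k) a))\<^sup>2 \<le> K * (real (p ^ k) ^ CARD('n))\<^sup>2 * real (p ^ k) powr (- (real CARD('n) - 2 / 5) / 3)"
    using gauss_sum_prime_power_bound [OF c dav, of "2 / 5"] by blast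
  have "sing_abs_term c (p ^ k) \<le> sqrt K * real (p ^ k) powr (- 3 / 5)" if p: "prime p" for p k
  proof -
    let ?q = "p ^ k"
    have q: "?q > 0" "real ?q \<ge> 1"
      using p by (auto simp: prime_gt_0_nat Suc_leI simp flip: of_nat_power)
    have "sing_abs_term c ?q \<le> real ?q * (sqrt K * real ?q powr (- 8 / 5))"
    proof (rule sing_abs_term_le [OF q(1)])
      fix a assume a: "coprime a (int ?q)"
      have "(norm (gauss_sum c ?q a))\<^sup>2 \<le> K * (real ?q ^ CARD('n))\<^sup>2 * real ?q powr (- (real CARD('n) - 2 / 5) / 3)"
        by (rule K(2) [OF p a])
      also have "\<dots> \<le> K * (real ?q ^ CARD('n))\<^sup>2 * real ?q powr (- 16 / 5)"
        using q n K(1) by (intro mult_left_mono powr_mono) auto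
      also have "\<dots> = (real ?q ^ CARD('n) * (sqrt K * real ?q powr (- 8 / 5)))\<^sup>2"
      proof -
        have "real ?q powr (- 16 / 5) = (real ?q powr (- 8 / 5))\<^sup>2"
          using q by (simp add: power2_eq_square flip: powr_add)
        then show ?thesis
          using K(1) by (simp add: power_mult_distrib)
      qed
      finally show "norm (gauss_sum c ?q a) \<le> real ?q ^ CARD('n) * (sqrt K * real ?q powr (- 8 / 5))"
        by (rule power2_le_imp_le) (use K(1) in auto)
    qed (use K(1) in auto)
    also have "\<dots> = sqrt K * (real ?q powr 1 * real ?q powr (- 8 / 5))"
      using q by simp
    also have "\<dots> = sqrt K * real ?q powr (- 3 / 5)"
      by (subst powr_add [symmetric]) simp
    finally show ?thesis .
  qed
  then show ?thesis
    using K(1) by (intro exI [of _ "sqrt K"]) simp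
qed

hide_const (open) up_ring.coeff up_ring.monom module.smult

section \<open>Integer polynomials with a root of high multiplicity modulo a prime\<close>

text \<open>Modulo \<open>p\<close> the polynomial is divisible by the \<open>k\<close>-th power of
  the variable, that is, 0 is a root of multiplicity at least \<open>k\<close>.\<close>

definition low_dvd :: "int \<Rightarrow> nat \<Rightarrow> int poly \<Rightarrow> bool" where
  "low_dvd p k F \<longleftrightarrow> (\<forall>i<k. p dvd coeff F i)"

lemma low_dvd_0 [simp]: "low_dvd p 0 F"
  by (simp add: low_dvd_def)

lemma low_dvd_mono: "low_dvd p k F \<Longrightarrow> j \<le> k \<Longrightarrow> low_dvd p j F"
  by (simp add: low_dvd_def)

lemma low_dvd_mult:
  assumes "low_dvd p a F" "low_dvd p b G"
  shows "low_dvd p (a + b) (F * G)"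
  unfolding low_dvd_def
proof (intro allI impI)
  fix i assume i: "i < a + b"
  show "p dvd coeff (F * G) i"
    unfolding coeff_mult
  proof (rule dvd_sum)
    fix j assume "j \<in> {..i}"
    then have "j < a \<or> i - j < b"
      using i by auto
    then show "p dvd coeff F j * coeff G (i - j)"
      using assms by (auto simp: low_dvd_def)
  qed
qed

lemma low_dvd_prod:
  assumes "finite A" "\<And>a. a \<in> A \<Longrightarrow> a \<in> B \<Longrightarrow> p dvd coeff (F a) 0"
  shows "low_dvd p (card (A \<inter> B)) (\<Prod>a\<in>A. F a)"
  using assms
proof (induction A rule: finite_induct)
  case (insert a A)
  then have IH: "low_dvd p (card (A \<inter> B)) (\<Prod>a\<in>A. F a)"
    by simp
  show ?case
  proof (cases "a \<in> B")
    case True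
    then have "low_dvd p 1 (F a)"
      using insert.prems by (simp add: low_dvd_def)
    then have "low_dvd p (1 + card (A \<inter> B)) (F a * (\<Prod>a\<in>A. F a))"
      using IH by (rule low_dvd_mult)
    then show ?thesis
      using insert.hyps True by simp
  next
    case False
    then show ?thesis
      using insert.hyps low_dvd_mult [of p 0 "F a", OF _ IH] by simp
  qed
qed simp

lemma low_dvd_sum: "(\<And>a. a \<in> A \<Longrightarrow> low_dvd p k (F a)) \<Longrightarrow> low_dvd p k (\<Sum>a\<in>A. F a)"
  by (auto simp: low_dvd_def coeff_sum intro: dvd_sum)

text \<open>Modulo \<open>p\<close> the polynomial \<open>f\<close> starts with its linear term, so
  \<open>f ^ e * g\<close> starts in degree \<open>e\<close> with the product of the leading
  contributions.\<close>

lemma coeff_power_mult_mod: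
  assumes f: "p dvd coeff f 0"
  shows "low_dvd p e (f ^ e * g) \<and> [coeff (f ^ e * g) e = coeff f 1 ^ e * coeff g 0] (mod p)"
proof (induction e)
  case (Suc e)
  have 1: "low_dvd p 1 f"
    using f by (simp add: low_dvd_def)
  have "low_dvd p (1 + e) (f * (f ^ e * g))"
    using Suc.IH by (intro low_dvd_mult 1) auto
  moreover have "[coeff (f * (f ^ e * g)) (Suc e) = coeff f 1 ^ Suc e * coeff g 0] (mod p)"
  proof -
    let ?G = "f ^ e * g"
    have "coeff (f * ?G) (Suc e) = (\<Sum>j\<le>Suc e. coeff f j * coeff ?G (Suc e - j))"
      by (simp add: coeff_mult)
    also have "\<dots> = coeff f 0 * coeff ?G (Suc e) + (\<Sum>j\<le>e. coeff f (Suc j) * coeff ?G (e - j))"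
      by (subst sum.atMost_Suc_shift) simp
    also have "(\<Sum>j\<le>e. coeff f (Suc j) * coeff ?G (e - j))
        = coeff f 1 * coeff ?G e + (\<Sum>j\<in>{1..e}. coeff f (Suc j) * coeff ?G (e - j))"
      by (simp add: atMost_atLeast0 sum.atLeast_Suc_atMost)
    finally have eq: "coeff (f * ?G) (Suc e) = coeff f 0 * coeff ?G (Suc e) + (coeff f 1 * coeff ?G e
        + (\<Sum>j\<in>{1..e}. coeff f (Suc j) * coeff ?G (e - j)))" .
    have "p dvd (\<Sum>j\<in>{1..e}. coeff f (Suc j) * coeff ?G (e - j))"
      using Suc.IH by (intro dvd_sum dvd_mult) (auto simp: low_dvd_def)
    then have "[coeff (f * ?G) (Suc e) = 0 + (coeff f 1 * (coeff f 1 ^ e * coeff g 0) + 0)] (mod p)"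
      unfolding eq using f Suc.IH by (intro cong_add cong_mult cong_refl) (auto simp: cong_0_iff)
    then show ?thesis
      by (simp add: mult.assoc)
  qed
  ultimately show ?case
    by (simp add: mult.assoc)
qed (simp add: low_dvd_def)

text \<open>A simple root of \<open>f\<close> modulo \<open>p\<close> that is no root of
  \<open>g\<close> has multiplicity exactly \<open>e\<close> in \<open>f ^ e * g\<close>.\<close>

lemma low_dvd_multiplicity_ge:
  assumes p: "prime p" and f: "p dvd coeff f 0" "\<not> p dvd coeff f 1" "\<not> p dvd coeff g 0"
    and k: "low_dvd p k (f ^ e * g)"
  shows "k \<le> e"
proof (rule ccontr)
  assume "\<not> k \<le> e"
  then have "p dvd coeff (f ^ e * g) e"
    using k by (simp add: low_dvd_def)
  then have "p dvd coeff f 1 ^ e * coeff g 0"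
    using coeff_power_mult_mod [OF f(1)] cong_dvd_iff by blast
  then show False
    using p f by (auto simp: prime_dvd_mult_iff dest: prime_dvd_power)
qed

text \<open>Lagrange's bound, with residue classes represented by pairwise incongruent integers.
  Splitting off the monic factor \<open>[:- s, 1:]\<close> preserves the leading coefficient, so the
  induction stays over the integers.\<close>

lemma card_roots_mod_prime:
  fixes g :: "int poly"
  assumes p: "prime p"
  shows "\<not> p dvd lead_coeff g \<Longrightarrow> finite T \<Longrightarrow> (\<And>t. t \<in> T \<Longrightarrow> p dvd poly g t) \<Longrightarrow>
    (\<And>s t. s \<in> T \<Longrightarrow> t \<in> T \<Longrightarrow> p dvd s - t \<Longrightarrow> s = t) \<Longrightarrow> card T \<le> degree g"
proof (induction "degree g" arbitrary: g T)
  case 0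
  then obtain a where "g = [:a:]"
    by (metis degree_eq_zeroE)
  then have "T = {}"
    using 0 by auto
  then show ?case
    by simp
next
  case (Suc d)
  show ?case
  proof (cases "T = {}")
    case False
    then obtain s where s: "s \<in> T"
      by blast
    define q where "q = synthetic_div g s"
    have g: "g = [:poly g s:] + [:- s, 1:] * q"
      using synthetic_div_correct' [of s g] by (simp add: q_def algebra_simps)
    have dq: "degree q = d"
      using Suc.hyps(2) by (simp add: q_def degree_synthetic_div)
    have "q \<noteq> 0"
    proof
      assume "q = 0"
      then have "degree g = 0"
        by (subst g) simp
      then show False
        using Suc.hyps(2) by simp
    qed
    then have "degree ([:- s, 1:] * q) = Suc d"
      using dq by (subst degree_mult_eq) auto
    moreover have "lead_coeff ([:- s, 1:] * q) = lead_coeff q"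
      by (subst lead_coeff_mult) simp
    moreover have "coeff g (Suc d) = coeff ([:- s, 1:] * q) (Suc d)"
      by (subst g) (simp only: coeff_add coeff_pCons_Suc coeff_0 add_0)
    ultimately have lc: "lead_coeff g = lead_coeff q"
      using Suc.hyps(2) by simp
    have "card (T - {s}) \<le> degree q"
    proof (rule Suc.hyps(1) [unfolded dq [symmetric]])
      show "\<not> p dvd lead_coeff q"
        using Suc.prems(1) lc by simp
      fix t assume t: "t \<in> T - {s}"
      have "poly g t = poly g s + (t - s) * poly q t"
        by (subst g) (simp add: algebra_simps)
      then have "p dvd (t - s) * poly q t"
        using Suc.prems(3) s t by (metis DiffD1 dvd_add_right_iff)
      moreover have "\<not> p dvd t - s"
        using Suc.prems(4) s t by blast
      ultimately show "p dvd poly q t"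
        using p prime_dvd_mult_iff by blast
    qed (use Suc.prems in auto)
    then show ?thesis
      using s Suc.prems(2) dq Suc.hyps(2) by (simp add: card_Diff_singleton)
  qed simp
qed

section \<open>Bounded Bezout identities and coefficients of factors\<close>

lemma poly_of_vector:
  fixes f :: "nat \<Rightarrow> int"
  shows "coeff (\<Sum>i<m. monom (f i) i) j = (if j < m then f j else 0)"
  by (simp add: coeff_sum if_distrib cong: if_cong)

text \<open>A pigeonhole (Siegel) argument replaces the resultant.\<close>

lemma bounded_bezout:
  fixes f q :: "int poly" and S :: nat
  assumes f: "prime_elem f" "degree f \<ge> 1" "\<not> f dvd q" and q: "q \<noteq> 0"
    and N: "degree f + degree q = N" and S: "S \<ge> 1"
    and cf: "\<And>i. \<bar>coeff f i\<bar> \<le> int S" and cq: "\<And>i. \<bar>coeff q i\<bar> \<le> int S"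
  obtains a b R where "a * f + b * q = [:R:]" "R \<noteq> 0" "\<bar>R\<bar> \<le> int ((2 * N * S + 1) ^ N)"
proof -
  let ?m = "degree f" and ?k = "degree q"
  \<comment> \<open>The size at which the pigeonhole works: each of the \<open>N - 1\<close>
    coefficients of positive degree takes at most
    \<open>2 * N * S * B + 1 \<le> (2 * N * S + 1) * B\<close> values, together at most
    \<open>B ^ N\<close>, fewer than the \<open>(B + 1) ^ N\<close> vectors in
    \<open>V\<close>.\<close>
  define B where "B = (2 * N * S + 1) ^ (N - 1)"
  have B1: "B \<ge> 1"
    by (simp add: B_def)
  have N1: "N \<ge> 1"
    using N f(2) by simp
  define pa where "pa x = (\<Sum>i<?k. monom (x i) i)" for x :: "nat \<Rightarrow> int"
  define pb where "pb x = (\<Sum>i<?m. monom (x (?k + i)) i)" for x :: "nat \<Rightarrow> int"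
  have ca: "coeff (pa x) i = (if i < ?k then x i else 0)" for x i
    by (simp add: pa_def poly_of_vector)
  have cb: "coeff (pb x) i = (if i < ?m then x (?k + i) else 0)" for x i
    using poly_of_vector [of "\<lambda>i. x (?k + i)"] by (simp add: pb_def)
  define G where "G x = pa x * f + pb x * q" for x
  have coeff_bound: "\<bar>coeff (G x) i\<bar> \<le> int (N * S * B)"
    if x: "\<And>j. j < N \<Longrightarrow> \<bar>x j\<bar> \<le> int B" for x i
  proof -
    have sa: "coeff (pa x * f) i = (\<Sum>j\<in>{..i} \<inter> {..<?k}. x j * coeff f (i - j))"
      by (simp add: coeff_mult ca if_distrib if_distribR sum.inter_restrict cong: if_cong)
    have sb: "coeff (pb x * q) i = (\<Sum>j\<in>{..i} \<inter> {..<?m}. x (?k + j) * coeff q (i - j))"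
      by (simp add: coeff_mult cb if_distrib if_distribR sum.inter_restrict cong: if_cong)
    have "\<bar>coeff (pa x * f) i\<bar> \<le> (\<Sum>j\<in>{..i} \<inter> {..<?k}. int B * int S)"
      unfolding sa
    proof (rule order_trans [OF sum_abs], rule sum_mono)
      fix j assume "j \<in> {..i} \<inter> {..<?k}"
      then show "\<bar>x j * coeff f (i - j)\<bar> \<le> int B * int S"
        using x [of j] cf N by (auto simp: abs_mult intro!: mult_mono)
    qed
    also have "\<dots> \<le> int ?k * (int B * int S)"
    proof -
      have "card ({..i} \<inter> {..<?k}) \<le> card {..<?k}"
        by (intro card_mono) auto
      then show ?thesis
        by (simp add: mult_right_mono)
    qed
    finally have 1: "\<bar>coeff (pa x * f) i\<bar> \<le> int ?k * (int B * int S)" .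
    have "\<bar>coeff (pb x * q) i\<bar> \<le> (\<Sum>j\<in>{..i} \<inter> {..<?m}. int B * int S)"
      unfolding sb
    proof (rule order_trans [OF sum_abs], rule sum_mono)
      fix j assume "j \<in> {..i} \<inter> {..<?m}"
      then show "\<bar>x (?k + j) * coeff q (i - j)\<bar> \<le> int B * int S"
        using x [of "?k + j"] cq N by (auto simp: abs_mult intro!: mult_mono)
    qed
    also have "\<dots> \<le> int ?m * (int B * int S)"
    proof -
      have "card ({..i} \<inter> {..<?m}) \<le> card {..<?m}"
        by (intro card_mono) auto
      then show ?thesis
        by (simp add: mult_right_mono)
    qed
    finally have 2: "\<bar>coeff (pb x * q) i\<bar> \<le> int ?m * (int B * int S)" .
    have "\<bar>coeff (G x) i\<bar> \<le> int ?k * (int B * int S) + int ?m * (int B * int S)"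
      using 1 2 by (simp add: G_def)
    also have "\<dots> = int (N * S * B)"
      by (simp add: N [symmetric] algebra_simps)
    finally show ?thesis .
  qed
  define V where "V = PiE {..<N} (\<lambda>_. {0..int B})"
  \<comment> \<open>The range starts at 1: the constant coefficient is left free, so a collision
    yields a combination of \<open>f\<close> and \<open>q\<close> that is constant.\<close>
  define W where "W = PiE {1..<N} (\<lambda>_. {- int (N * S * B)..int (N * S * B)})"
  define \<phi> where "\<phi> x = restrict (\<lambda>i. coeff (G x) i) {1..<N}" for x
  have "\<phi> ` V \<subseteq> W"
  proof clarify
    fix x assume "x \<in> V"
    then have "\<bar>x j\<bar> \<le> int B" if "j < N" for j
      using that by (auto simp: V_def PiE_iff)
    then have "\<bar>coeff (G x) i\<bar> \<le> int (N * S * B)" for i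
      by (rule coeff_bound)
    then show "\<phi> x \<in> W"
      by (auto simp: W_def \<phi>_def abs_le_iff minus_le_iff)
  qed
  moreover have "card W < card V"
  proof -
    have "card W = (2 * (N * S * B) + 1) ^ (N - 1)"
    proof -
      have "card {- int K..int K} = 2 * K + 1" for K
        by simp
      then have "card {- int (N * S * B)..int (N * S * B)} = 2 * (N * S * B) + 1" .
      then show ?thesis
        by (simp only: W_def card_PiE finite_atLeastLessThan prod_constant card_atLeastLessThan)
    qed
    also have "\<dots> \<le> ((2 * N * S + 1) * B) ^ (N - 1)"
      using B1 by (intro power_mono) (auto simp: algebra_simps)
    also have "\<dots> = B * B ^ (N - 1)"
      by (simp only: power_mult_distrib B_def [symmetric])
    also have "\<dots> = B ^ N"
      using N1 by (cases N) auto
    also have "\<dots> < (B + 1) ^ N"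
      using N1 by (intro power_strict_mono) auto
    also have "\<dots> = card V"
      by (simp add: V_def card_PiE nat_add_distrib)
    finally show ?thesis .
  qed
  moreover have "finite W"
    by (simp add: W_def finite_PiE)
  ultimately have "\<not> inj_on \<phi> V"
    using card_inj_on_le by (metis not_le)
  then obtain x y where xy: "x \<in> V" "y \<in> V" "\<phi> x = \<phi> y" "x \<noteq> y"
    by (auto simp: inj_on_def)
  define z where "z i = x i - y i" for i
  have z: "\<bar>z j\<bar> \<le> int B" if "j < N" for j
  proof -
    have "x j \<in> {0..int B}"
      using PiE_mem [OF xy(1) [unfolded V_def], of j] that by simp
    moreover have "y j \<in> {0..int B}"
      using PiE_mem [OF xy(2) [unfolded V_def], of j] that by simp
    ultimately show ?thesis
      by (auto simp: z_def)
  qed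
  have Gz: "G z = G x - G y"
  proof -
    have "pa z = pa x - pa y" "pb z = pb x - pb y"
      by (simp_all add: pa_def pb_def z_def sum_subtractf flip: diff_monom)
    then show ?thesis
      by (simp only: G_def) (simp add: left_diff_distrib)
  qed
  have dega: "degree (pa z) < ?k \<or> pa z = 0"
    using ca [of z "degree (pa z)"] by (metis leading_coeff_0_iff)
  have degb: "degree (pb z) < ?m \<or> pb z = 0"
    using cb [of z "degree (pb z)"] by (metis leading_coeff_0_iff)
  have "coeff (G z) i = 0" if "i \<ge> 1" for i
  proof (cases "i < N")
    case True
    then have "\<phi> x i = \<phi> y i"
      using xy(3) by simp
    then show ?thesis
      using True that by (simp add: \<phi>_def Gz)
  next
    case False
    have "degree (pa z * f) < N \<or> pa z = 0"
      using degree_mult_le [of "pa z" f] N dega by linarith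
    moreover have "degree (pb z * q) < N \<or> pb z = 0"
      using degree_mult_le [of "pb z" q] N degb by linarith
    ultimately have "coeff (pa z * f) i = 0" "coeff (pb z * q) i = 0"
      using False by (auto intro: coeff_eq_0)
    then show ?thesis
      by (simp add: G_def)
  qed
  then have Gc: "G z = [:coeff (G z) 0:]"
    by (intro poly_eqI) (auto simp: coeff_pCons split: nat.splits)
  \<comment> \<open>Otherwise the prime element \<open>f\<close> divides \<open>pb z * q\<close> and
    hence \<open>pb z\<close>, whose degree is smaller. Then both cofactors vanish and the colliding
    vectors coincide.\<close>
  moreover have "coeff (G z) 0 \<noteq> 0"
  proof
    assume "coeff (G z) 0 = 0"
    then have 0: "pa z * f + pb z * q = 0"
      using Gc by (simp add: G_def)
    then have "pb z * q = f * (- pa z)"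
      by (simp add: algebra_simps eq_neg_iff_add_eq_0)
    then have "f dvd pb z * q"
      by simp
    then have "f dvd pb z"
      using f prime_elem_dvd_mult_iff by blast
    then have pb0: "pb z = 0"
      using degb dvd_imp_degree_le [of f "pb z"] by linarith
    then have "pa z = 0"
      using 0 f by auto
    have "z i = 0" if "i < N" for i
    proof (cases "i < ?k")
      case True
      then show ?thesis
        using ca [of z i] \<open>pa z = 0\<close> by simp
    next
      case False
      then have "i - ?k < ?m"
        using that N by linarith
      then have "z (?k + (i - ?k)) = 0"
        using cb [of z "i - ?k"] pb0 by (simp only: if_True coeff_0)
      then show ?thesis
        using False by simp
    qed
    then have "x i = y i" for i
      using xy(1,2) by (cases "i < N") (auto simp: z_def V_def PiE_def extensional_def)
    then show False
      using xy(4) by blast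
  qed
  moreover have "\<bar>coeff (G z) 0\<bar> \<le> int ((2 * N * S + 1) ^ N)"
  proof -
    have "N * S * B \<le> (2 * N * S + 1) * B"
      by simp
    also have "\<dots> = (2 * N * S + 1) ^ N"
      using N1 by (cases N) (auto simp: B_def)
    finally show ?thesis
      using coeff_bound [of z 0] z by (meson of_nat_le_iff order_trans)
  qed
  ultimately show ?thesis
    using that [of "pa z" "pb z" "coeff (G z) 0"] by (simp add: G_def)
qed

section \<open>Bounds for factors through complex roots\<close>

lemma coeff_prod_roots_le:
  fixes A :: "complex multiset"
  assumes "\<And>x. x \<in># A \<Longrightarrow> norm x \<le> r" "r \<ge> 0"
  shows "norm (coeff (\<Prod>x\<in>#A. [:- x, 1:]) i) \<le> (1 + r) ^ size A"
  using assms(1)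
proof (induction A arbitrary: i)
  case empty
  then show ?case
    by (simp add: coeff_1)
next
  case (add x A)
  let ?P = "\<Prod>x\<in>#A. [:- x, 1:]"
  have IH: "norm (coeff ?P i) \<le> (1 + r) ^ size A" for i
    using add by simp
  have eq: "coeff ([:- x, 1:] * ?P) i = - x * coeff ?P i + (case i of 0 \<Rightarrow> 0 | Suc j \<Rightarrow> coeff ?P j)"
    by (simp add: coeff_pCons split: nat.splits)
  have "norm (coeff ([:- x, 1:] * ?P) i) \<le> norm (- x * coeff ?P i) + norm (case i of 0 \<Rightarrow> 0 | Suc j \<Rightarrow> coeff ?P j)"
    unfolding eq by (rule norm_triangle_ineq)
  also have "norm (- x * coeff ?P i) = norm x * norm (coeff ?P i)"
    by (simp add: norm_mult)
  also have "norm x * norm (coeff ?P i) + norm (case i of 0 \<Rightarrow> 0 | Suc j \<Rightarrow> coeff ?P j) \<le> r * (1 + r) ^ size A + (1 + r) ^ size A"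
    using IH add.prems assms(2) by (intro add_mono mult_mono) (auto split: nat.splits)
  finally show ?case
    by (simp add: algebra_simps)
qed

lemma poly_prod_roots_le:
  fixes A :: "complex multiset"
  assumes "\<And>x. x \<in># A \<Longrightarrow> norm x \<le> r" "norm t \<le> r"
  shows "norm (poly (\<Prod>x\<in>#A. [:- x, 1:]) t) \<le> (2 * r) ^ size A"
  using assms(1)
proof (induction A)
  case (add x A)
  have "norm (t - x) \<le> 2 * r"
    using add.prems [of x] assms(2) norm_triangle_ineq4 [of t x] by simp
  moreover have "norm (poly (\<Prod>x\<in>#A. [:- x, 1:]) t) \<le> (2 * r) ^ size A"
    using add by simp
  moreover have "poly (\<Prod>x\<in>#add_mset x A. [:- x, 1:]) t = (t - x) * poly (\<Prod>x\<in>#A. [:- x, 1:]) t"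
    by (simp add: algebra_simps)
  ultimately show ?case
    using order_trans [OF norm_ge_zero assms(2)] by (simp only: norm_mult size_add_mset power_Suc) (intro mult_mono, auto)
qed simp

lemma of_int_poly_mult:
  "map_poly of_int (f * h) = (map_poly of_int f * map_poly of_int h :: complex poly)"
  by (intro poly_eqI) (simp add: coeff_map_poly coeff_mult)

lemma poly_of_int_poly: "poly (map_poly of_int f) (of_int t :: complex) = of_int (poly f t)"
  by (induction f) (simp_all add: map_poly_pCons)

text \<open>The complex roots of a factor are roots of \<open>g\<close>, and its leading coefficient
  divides that of \<open>g\<close>. The coefficient bound feeds the Bezout identities; the value
  bound involves only \<open>degree f\<close>, and so is quadratic in \<open>r\<close> for factors
  of degree 2.\<close>

lemma factor_bounds:
  fixes f g :: "int poly" and r :: real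
  assumes "f dvd g" "g \<noteq> 0" "r \<ge> 0"
    and roots: "\<And>x :: complex. poly (map_poly of_int g) x = 0 \<Longrightarrow> norm x \<le> r"
  shows "real_of_int \<bar>coeff f i\<bar> \<le> real_of_int \<bar>lead_coeff g\<bar> * (1 + r) ^ degree g"
    and "real_of_int \<bar>t\<bar> \<le> r \<Longrightarrow> real_of_int \<bar>poly f t\<bar> \<le> real_of_int \<bar>lead_coeff g\<bar> * (2 * r) ^ degree f"
proof -
  obtain h where h: "g = f * h"
    using assms(1) by blast
  have f0: "f \<noteq> 0" "h \<noteq> 0"
    using h assms(2) by auto
  let ?f = "map_poly of_int f :: complex poly"
  have f': "?f \<noteq> 0" "degree ?f = degree f" "lead_coeff ?f = of_int (lead_coeff f)"
    using f0 by (simp_all add: map_poly_eq_0_iff degree_map_poly coeff_map_poly)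
  obtain A where A: "size A = degree ?f" "?f = smult (lead_coeff ?f) (\<Prod>x\<in>#A. [:- x, 1:])"
    using alg_closed_imp_factorization [OF f'(1)] by blast
  have Ar: "norm x \<le> r" if "x \<in># A" for x
  proof -
    have "poly ?f x = 0"
      using that by (subst A(2)) (auto simp: poly_prod_mset prod_mset_zero_iff)
    moreover have "map_poly of_int g = ?f * (map_poly of_int h :: complex poly)"
      by (simp add: h of_int_poly_mult)
    ultimately show ?thesis
      by (intro roots) simp
  qed
  have "lead_coeff g = lead_coeff f * lead_coeff h"
    by (simp add: h lead_coeff_mult)
  moreover have "\<bar>lead_coeff h\<bar> \<ge> 1"
    using f0 by (simp add: int_one_le_iff_zero_less)
  ultimately have lc: "\<bar>lead_coeff f\<bar> \<le> \<bar>lead_coeff g\<bar>"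
    by (simp add: abs_mult mult_le_cancel_left1)
  have deg: "degree f \<le> degree g"
    using h f0 by (simp add: degree_mult_eq)
  have "real_of_int \<bar>coeff f i\<bar> = norm (coeff ?f i)"
    by (simp add: coeff_map_poly)
  also have "\<dots> = real_of_int \<bar>lead_coeff f\<bar> * norm (coeff (\<Prod>x\<in>#A. [:- x, 1:]) i)"
    by (subst A(2)) (simp add: f'(3) norm_mult)
  also have "\<dots> \<le> real_of_int \<bar>lead_coeff g\<bar> * (1 + r) ^ degree g"
  proof (intro mult_mono)
    have "norm (coeff (\<Prod>x\<in>#A. [:- x, 1:]) i) \<le> (1 + r) ^ size A"
      using Ar assms(3) by (rule coeff_prod_roots_le)
    also have "\<dots> \<le> (1 + r) ^ degree g"
      using assms(3) deg by (intro power_increasing) (auto simp: A(1) f'(2))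
    finally show "norm (coeff (\<Prod>x\<in>#A. [:- x, 1:]) i) \<le> (1 + r) ^ degree g" .
  qed (use lc in auto)
  finally show "real_of_int \<bar>coeff f i\<bar> \<le> real_of_int \<bar>lead_coeff g\<bar> * (1 + r) ^ degree g" .
  assume t: "real_of_int \<bar>t\<bar> \<le> r"
  have "real_of_int \<bar>poly f t\<bar> = norm (poly ?f (of_int t))"
    by (simp add: poly_of_int_poly)
  also have "\<dots> = real_of_int \<bar>lead_coeff f\<bar> * norm (poly (\<Prod>x\<in>#A. [:- x, 1:]) (of_int t))"
    by (subst A(2)) (simp add: f'(3) norm_mult)
  also have "\<dots> \<le> real_of_int \<bar>lead_coeff g\<bar> * (2 * r) ^ size A"
  proof (rule mult_mono)
    show "norm (poly (\<Prod>x\<in>#A. [:- x, 1:]) (of_int t)) \<le> (2 * r) ^ size A"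
      by (rule poly_prod_roots_le [OF Ar]) (use t in auto)
  qed (use lc in auto)
  finally show "real_of_int \<bar>poly f t\<bar> \<le> real_of_int \<bar>lead_coeff g\<bar> * (2 * r) ^ degree f"
    by (simp add: A(1) f'(2))
qed

section \<open>Pencils of integer matrices\<close>

definition pencil :: "int^'n^'n \<Rightarrow> int^'n^'n \<Rightarrow> int poly" where
  "pencil A B = det (\<chi> i j. [:A$i$j, B$i$j:])"

lemma poly_det: "poly (det M) t = det (\<chi> i j. poly (M$i$j) t)"
  for M :: "int poly^'n^'n"
  by (simp add: det_def poly_sum poly_prod)

lemma poly_pencil: "poly (pencil A B) t = det (\<chi> i j. A$i$j + t * B$i$j)"
  by (simp add: pencil_def poly_det)

lemma pencil_shift: "pencil (\<chi> i j. A$i$j + t * B$i$j) B = pcompose (pencil A B) [:t, 1:]"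
proof -
  have "poly (pencil (\<chi> i j. A$i$j + t * B$i$j) B) s = poly (pcompose (pencil A B) [:t, 1:]) s" for s
    by (simp add: poly_pencil poly_pcompose algebra_simps)
  then show ?thesis
    by (simp add: poly_eq_poly_eq_iff [symmetric] fun_eq_iff)
qed

lemma linear_factors_coeff:
  fixes a b :: "'n \<Rightarrow> int"
  assumes "finite F"
  shows "degree (\<Prod>i\<in>F. [:a i, b i:]) \<le> card F \<and> coeff (\<Prod>i\<in>F. [:a i, b i:]) (card F) = (\<Prod>i\<in>F. b i)"
  using assms
proof (induction F rule: finite_induct)
  case (insert x F)
  let ?P = "\<Prod>i\<in>F. [:a i, b i:]"
  have "degree ([:a x, b x:] * ?P) \<le> degree [:a x, b x:] + degree ?P"
    by (rule degree_mult_le)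
  also have "\<dots> \<le> 1 + card F"
    using insert.IH by (intro add_mono) auto
  finally have "degree ([:a x, b x:] * ?P) \<le> card (insert x F)"
    using insert.hyps by simp
  moreover have "coeff ?P (Suc (card F)) = 0"
    using insert.IH by (intro coeff_eq_0) simp
  ultimately show ?case
    using insert by simp
qed simp

text \<open>With the weight \<open>H ^ k\<close> a coefficient is majorised by the product of the
  factors \<open>\<bar>a i\<bar> + \<bar>b i\<bar> * H\<close>, as if absolute values were taken and
  the variable were set to \<open>H\<close>.\<close>

lemma linear_factors_coeff_le:
  fixes a b :: "'n \<Rightarrow> int" and H M :: real
  assumes "finite F" "\<And>i. real_of_int \<bar>a i\<bar> + real_of_int \<bar>b i\<bar> * H \<le> M" "H \<ge> 0"
  shows "real_of_int \<bar>coeff (\<Prod>i\<in>F. [:a i, b i:]) k\<bar> * H ^ k \<le> M ^ card F"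
  using assms(1)
proof (induction F arbitrary: k rule: finite_induct)
  case empty
  then show ?case
    by (simp add: coeff_1)
next
  case (insert x F)
  let ?P = "\<Prod>i\<in>F. [:a i, b i:]"
  have M0: "M \<ge> 0"
    using assms(2) [of undefined] assms(3) by (meson abs_ge_zero add_nonneg_nonneg mult_nonneg_nonneg of_int_0_le_iff order_trans)
  have shift: "real_of_int \<bar>case k of 0 \<Rightarrow> 0 | Suc j \<Rightarrow> coeff ?P j\<bar> * H ^ k \<le> H * M ^ card F"
  proof (cases k)
    case 0
    then show ?thesis
      using assms(3) M0 by simp
  next
    case (Suc j)
    then show ?thesis
      using mult_left_mono [OF insert.IH [of j] assms(3)] by (simp add: mult_ac)
  qed
  have "coeff ([:a x, b x:] * ?P) k = a x * coeff ?P k + b x * (case k of 0 \<Rightarrow> 0 | Suc j \<Rightarrow> coeff ?P j)"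
    by (simp add: coeff_pCons split: nat.splits)
  then have "\<bar>coeff ([:a x, b x:] * ?P) k\<bar> \<le> \<bar>a x\<bar> * \<bar>coeff ?P k\<bar> + \<bar>b x\<bar> * \<bar>case k of 0 \<Rightarrow> 0 | Suc j \<Rightarrow> coeff ?P j\<bar>"
    by (simp only: abs_mult [symmetric] abs_triangle_ineq)
  then have "real_of_int \<bar>coeff ([:a x, b x:] * ?P) k\<bar> \<le> real_of_int (\<bar>a x\<bar> * \<bar>coeff ?P k\<bar> + \<bar>b x\<bar> * \<bar>case k of 0 \<Rightarrow> 0 | Suc j \<Rightarrow> coeff ?P j\<bar>)"
    by (simp only: of_int_le_iff)
  then have "real_of_int \<bar>coeff ([:a x, b x:] * ?P) k\<bar> * H ^ k
      \<le> (real_of_int \<bar>a x\<bar> * real_of_int \<bar>coeff ?P k\<bar> + real_of_int \<bar>b x\<bar> * real_of_int \<bar>case k of 0 \<Rightarrow> 0 | Suc j \<Rightarrow> coeff ?P j\<bar>) * H ^ k"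
    using assms(3) by (intro mult_right_mono) auto
  also have "\<dots> = real_of_int \<bar>a x\<bar> * (real_of_int \<bar>coeff ?P k\<bar> * H ^ k)
      + real_of_int \<bar>b x\<bar> * (real_of_int \<bar>case k of 0 \<Rightarrow> 0 | Suc j \<Rightarrow> coeff ?P j\<bar> * H ^ k)"
    by (simp add: algebra_simps)
  also have "\<dots> \<le> real_of_int \<bar>a x\<bar> * M ^ card F + real_of_int \<bar>b x\<bar> * (H * M ^ card F)"
    using insert.IH [of k] shift by (intro add_mono mult_left_mono) auto
  also have "\<dots> = (real_of_int \<bar>a x\<bar> + real_of_int \<bar>b x\<bar> * H) * M ^ card F"
    by (simp add: algebra_simps)
  also have "\<dots> \<le> M * M ^ card F"
    using assms(2) M0 by (intro mult_right_mono) auto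
  finally show ?case
    using insert.hyps by simp
qed

lemma coeff_of_int_mult: "coeff (of_int k * P) i = k * coeff P i" for P :: "int poly"
  by (simp add: of_int_poly)

lemma pencil_coeff:
  fixes A B :: "int^'n^'n"
  shows "degree (pencil A B) \<le> CARD('n)" "coeff (pencil A B) CARD('n) = det B"
proof -
  have lf: "degree (\<Prod>i\<in>UNIV. [:A$i$p i, B$i$p i:]) \<le> CARD('n)"
    "coeff (\<Prod>i\<in>UNIV. [:A$i$p i, B$i$p i:]) CARD('n) = (\<Prod>i\<in>UNIV. B$i$p i)" for p :: "'n \<Rightarrow> 'n"
    using linear_factors_coeff [of "UNIV :: 'n set" "\<lambda>i. A$i$p i" "\<lambda>i. B$i$p i"] by auto
  show "degree (pencil A B) \<le> CARD('n)"
    unfolding pencil_def det_def vec_lambda_beta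
  proof (intro degree_sum_le)
    fix p :: "'n \<Rightarrow> 'n"
    show "degree (of_int (sign p) * (\<Prod>i\<in>UNIV. [:A$i$p i, B$i$p i:])) \<le> CARD('n)"
      using lf(1) [of p] by (simp add: of_int_poly order_trans [OF degree_smult_le])
  qed (simp add: finite_permutations)
  show "coeff (pencil A B) CARD('n) = det B"
    unfolding pencil_def det_def vec_lambda_beta coeff_sum coeff_of_int_mult lf(2) by simp
qed

lemma pencil_coeff_le:
  fixes A B :: "int^'n^'n" and H M :: real
  assumes "\<And>i j. real_of_int \<bar>A$i$j\<bar> + real_of_int \<bar>B$i$j\<bar> * H \<le> M" "H \<ge> 0"
  shows "real_of_int \<bar>coeff (pencil A B) k\<bar> * H ^ k \<le> fact CARD('n) * M ^ CARD('n)"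
proof -
  let ?P = "\<lambda>p. \<Prod>i\<in>UNIV. [:A$i$p i, B$i$p i:]"
  have "real_of_int \<bar>coeff (pencil A B) k\<bar> \<le> real_of_int (\<Sum>p\<in>{p. p permutes (UNIV :: 'n set)}. \<bar>sign p * coeff (?P p) k\<bar>)"
    unfolding pencil_def det_def vec_lambda_beta coeff_sum coeff_of_int_mult of_int_le_iff by (rule sum_abs)
  also have "\<dots> = (\<Sum>p\<in>{p. p permutes (UNIV :: 'n set)}. real_of_int \<bar>coeff (?P p) k\<bar>)"
    by (auto simp: abs_mult sign_def intro!: sum.cong)
  finally have "real_of_int \<bar>coeff (pencil A B) k\<bar> * H ^ k
      \<le> (\<Sum>p\<in>{p. p permutes (UNIV :: 'n set)}. real_of_int \<bar>coeff (?P p) k\<bar>) * H ^ k"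
    using assms(2) by (intro mult_right_mono) auto
  also have "\<dots> = (\<Sum>p\<in>{p. p permutes (UNIV :: 'n set)}. real_of_int \<bar>coeff (?P p) k\<bar> * H ^ k)"
    by (simp add: sum_distrib_right)
  also have "\<dots> \<le> (\<Sum>p\<in>{p. p permutes (UNIV :: 'n set)}. M ^ CARD('n))"
    using assms by (intro sum_mono linear_factors_coeff_le) auto
  also have "\<dots> = fact CARD('n) * M ^ CARD('n)"
    by (simp add: card_permutations)
  finally show ?thesis .
qed

text \<open>Cauchy's bound for roots, rescaled by \<open>H\<close>. Beyond the stated radius the
  leading term dominates, because its coefficient \<open>det B\<close> is a nonzero integer.\<close>

lemma pencil_roots_le:
  fixes A B :: "int^'n^'n" and H K :: real
  assumes dB: "det B \<noteq> 0" and K: "\<And>k. real_of_int \<bar>coeff (pencil A B) k\<bar> * H ^ k \<le> K * H ^ CARD('n)"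
    and KH: "K \<ge> 1" "H \<ge> 1" and z: "poly (map_poly of_int (pencil A B)) z = (0 :: complex)"
  shows "norm z \<le> real CARD('n) * K * H"
proof (rule ccontr)
  assume "\<not> norm z \<le> real CARD('n) * K * H"
  then have zl: "norm z > real CARD('n) * K * H"
    by simp
  let ?n = "CARD('n)" and ?g = "pencil A B"
  obtain N where N: "?n = Suc N"
    by (metis zero_less_card_finite gr0_implies_Suc)
  have "real ?n * K \<ge> 1"
    using KH N by (simp add: mult_ge1_I)
  then have "real ?n * K * H \<ge> 1 * H"
    using KH by (intro mult_right_mono) auto
  then have zH: "H \<le> norm z" "norm z > 0"
    using zl KH by linarith+
  have lc: "coeff ?g ?n = det B"
    by (rule pencil_coeff)
  have deg: "degree ?g = ?n"
    by (rule order_antisym [OF pencil_coeff(1) le_degree]) (use lc dB in simp)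
  have "poly (map_poly of_int ?g) z = (\<Sum>i\<le>?n. of_int (coeff ?g i) * z ^ i)"
    by (simp add: poly_altdef degree_map_poly deg coeff_map_poly)
  also have "\<dots> = of_int (det B) * z ^ ?n + (\<Sum>i<?n. of_int (coeff ?g i) * z ^ i)"
    by (simp add: lc flip: lessThan_Suc_atMost)
  finally have "of_int (det B) * z ^ ?n = - (\<Sum>i<?n. of_int (coeff ?g i) * z ^ i)"
    using z by (simp add: add_eq_0_iff2)
  then have "norm (of_int (det B) * z ^ ?n) = norm (\<Sum>i<?n. of_int (coeff ?g i) * z ^ i)"
    by simp
  also have "\<dots> \<le> (\<Sum>i<?n. K * H * norm z ^ N)"
  proof (rule sum_norm_le)
    fix i assume "i \<in> {..<?n}"
    then have i: "i \<le> N"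
      using N by simp
    have "real_of_int \<bar>coeff ?g i\<bar> * H ^ i \<le> K * H ^ ?n"
      by (rule K)
    also have "H ^ ?n = H * H ^ (N - i) * H ^ i"
      using i by (simp add: N power_add [symmetric])
    finally have "real_of_int \<bar>coeff ?g i\<bar> \<le> K * H * H ^ (N - i)"
      using KH by simp
    also have "\<dots> \<le> K * H * norm z ^ (N - i)"
      using KH zH by (intro mult_left_mono power_mono) auto
    finally have "real_of_int \<bar>coeff ?g i\<bar> * norm z ^ i \<le> K * H * norm z ^ (N - i) * norm z ^ i"
      by (intro mult_right_mono) auto
    also have "\<dots> = K * H * norm z ^ N"
      using i by (simp add: power_add [symmetric] mult.assoc)
    finally show "norm (of_int (coeff ?g i) * z ^ i) \<le> K * H * norm z ^ N"
      by (simp add: norm_mult norm_power)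
  qed
  also have "\<dots> = real ?n * K * H * norm z ^ N"
    by simp
  also have "\<dots> < norm z * norm z ^ N"
    using zl zH by (intro mult_strict_right_mono) auto
  also have "\<dots> = 1 * norm z ^ ?n"
    by (simp add: N)
  also have "\<dots> \<le> norm (of_int (det B) * z ^ ?n)"
  proof -
    have "1 \<le> \<bar>det B\<bar>"
      using dB by linarith
    then have "(1::real) \<le> norm (of_int (det B) :: complex)"
      by (simp del: zero_less_abs_iff) 
    then show ?thesis
      unfolding norm_mult norm_power by (intro mult_right_mono) auto
  qed
  finally show False
    by simp
qed

text \<open>The columns in \<open>I\<close> of a basis adapted to the kernel span it modulo
  \<open>p\<close>, so a kernel vector is determined by its coordinates in \<open>I\<close> modulo
  \<open>p\<close>. Coordinates are taken of \<open>det U *s y\<close>, since \<open>U\<close> is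
  inverted only up to its determinant.\<close>

lemma card_kerq_le_adapted:
  fixes A :: "int^'n^'n"
  assumes p: "prime p"
  obtains U I where "\<not> int p dvd det U" "\<And>i. i \<in> I \<Longrightarrow> \<forall>k. int p dvd (A *v column i U)$k"
    "card (kerq (int p) A) \<le> p ^ card I"
proof -
  have pi: "prime (int p)"
    using p by simp
  have p0: "int p > 0"
    using p by (simp add: prime_gt_0_nat)
  define L where "L = {y. \<forall>k. int p dvd (A *v y)$k}"
  obtain U I where U: "\<not> int p dvd det U" "\<And>i. i \<in> I \<Longrightarrow> column i U \<in> L"
    "\<And>z j. U *v z \<in> L \<Longrightarrow> j \<notin> I \<Longrightarrow> int p dvd z$j"
  proof (rule adapted_basis [OF pi, of L])
    show "x + y \<in> L" if "x \<in> L" "y \<in> L" for x y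
      using that by (simp add: L_def matrix_vector_right_distrib)
    show "k *s x \<in> L" if "x \<in> L" for x k
      using that by (simp add: L_def matrix_vector_mult_smult)
  qed blast
  have "det U \<noteq> 0"
    using U(1) by auto
  then have "\<exists>z. U *v z = det U *s y" for y
    by (rule ex_mult_vec_eq_det)
  then obtain z where z: "\<And>y. U *v z y = det U *s y"
    by metis
  define \<psi> where "\<psi> y = restrict (\<lambda>i. z y$i mod int p) I" for y
  have "inj_on \<psi> (kerq (int p) A)"
  proof (rule inj_onI)
    fix x y assume xy: "x \<in> kerq (int p) A" "y \<in> kerq (int p) A" "\<psi> x = \<psi> y"
    have zL: "U *v z w \<in> L" if "w \<in> kerq (int p) A" for w
      using that by (simp add: z L_def kerq_def matrix_vector_mult_smult)
    have "int p dvd z x$i - z y$i" for i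
    proof (cases "i \<in> I")
      case True
      then have "\<psi> x i = \<psi> y i" "i \<in> I"
        using xy(3) by auto
      then show ?thesis
        by (simp add: \<psi>_def mod_eq_dvd_iff)
    next
      case False
      then show ?thesis
        using U(3) [OF zL [OF xy(1)] False] U(3) [OF zL [OF xy(2)] False] by simp
    qed
    then have "vcong (int p) (z x) (z y)"
      by (simp add: vcong_def cong_iff_dvd_diff)
    then have "[(U *v z x)$i = (U *v z y)$i] (mod int p)" for i
      by (intro mult_vec_cong) (simp add: vcong_def)
    then have "int p dvd det U * (x$i - y$i)" for i
      by (simp add: z cong_iff_dvd_diff algebra_simps)
    then have "int p dvd x$i - y$i" for i
      using U(1) pi prime_dvd_mult_iff by blast
    then show "x = y"
      using xy by (intro ibox_cong_imp_eq [of _ "int p"]) (auto simp: kerq_def)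
  qed
  moreover have "\<psi> ` kerq (int p) A \<subseteq> PiE I (\<lambda>_. {0..<int p})"
    using p0 by (auto simp: \<psi>_def)
  ultimately have "card (kerq (int p) A) \<le> card (PiE I (\<lambda>_. {0..<int p}))"
    by (intro card_inj_on_le) (auto simp: finite_PiE)
  also have "\<dots> = p ^ card I"
    by (simp add: card_PiE)
  finally show ?thesis
    using that [of U I] U(1,2) by (simp add: L_def)
qed

text \<open>In a basis adapted to the kernel of \<open>A\<close> modulo \<open>p\<close>, each
  kernel column of \<open>A + x B\<close> is divisible by \<open>x\<close> modulo \<open>p\<close>.
  The determinant collects one factor \<open>x\<close> per such column.\<close>

lemma pencil_low_dvd:
  fixes A B :: "int^'n^'n"
  assumes p: "prime p" and k: "card (kerq (int p) A) > p ^ k"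
  shows "low_dvd (int p) (Suc k) (pencil A B)"
proof -
  obtain U I where U: "\<not> int p dvd det U" "\<And>i. i \<in> I \<Longrightarrow> \<forall>k. int p dvd (A *v column i U)$k"
    "card (kerq (int p) A) \<le> p ^ card I"
    using card_kerq_le_adapted [OF p, of A] by blast
  have "p ^ k < p ^ card I"
    using k U(3) by linarith
  then have kI: "Suc k \<le> card I"
    using p by (metis Suc_leI power_strict_increasing_iff prime_gt_1_nat)
  let ?M = "\<chi> i j. [:A$i$j, B$i$j:]" and ?U = "\<chi> i j. [:U$i$j:]"
  have MU: "(?M ** ?U)$i$j = [:(A *v column j U)$i, (B *v column j U)$i:]" for i j
  proof -
    have "poly ((?M ** ?U)$i$j) t = poly [:(A *v column j U)$i, (B *v column j U)$i:] t" for t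
      by (simp add: matrix_matrix_mult_def matrix_vector_mult_def column_def poly_sum
          sum_distrib_left sum.distrib algebra_simps)
    then show ?thesis
      by (simp add: poly_eq_poly_eq_iff [symmetric] fun_eq_iff)
  qed
  have "poly (det ?U) t = poly [:det U:] t" for t
    by (simp add: poly_det)
  then have detU: "det ?U = [:det U:]"
    by (simp add: poly_eq_poly_eq_iff [symmetric] fun_eq_iff)
  have "low_dvd (int p) (card I) (det (?M ** ?U))"
    unfolding det_def
  proof (rule low_dvd_sum)
    fix s :: "'n \<Rightarrow> 'n" assume "s \<in> {s. s permutes UNIV}"
    then have s: "s permutes UNIV"
      by simp
    have "bij_betw s {i. s i \<in> I} I"
      using permutes_bij [OF s] by (auto simp: bij_betw_def inj_on_def bij_def surj_def image_iff)
    then have "card {i. s i \<in> I} = card I"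
      by (rule bij_betw_same_card)
    moreover have "low_dvd (int p) (card (UNIV \<inter> {i. s i \<in> I})) (\<Prod>i\<in>UNIV. (?M ** ?U)$i$s i)"
      by (rule low_dvd_prod) (use U(2) in \<open>auto simp: MU\<close>)
    ultimately have "low_dvd (int p) (0 + card I) (of_int (sign s) * (\<Prod>i\<in>UNIV. (?M ** ?U)$i$s i))"
      by (intro low_dvd_mult) auto
    then show "low_dvd (int p) (card I) (of_int (sign s) * (\<Prod>i\<in>UNIV. (?M ** ?U)$i$s i))"
      by simp
  qed
  then have "low_dvd (int p) (card I) (Polynomial.smult (det U) (pencil A B))"
    by (simp add: det_mul detU pencil_def mult.commute)
  then have "int p dvd det U * coeff (pencil A B) i" if "i < card I" for i
    using that by (simp add: low_dvd_def)
  then have "low_dvd (int p) (card I) (pencil A B)"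
    using U(1) p unfolding low_dvd_def by (meson prime_dvd_mult_iff prime_nat_int_transfer)
  then show ?thesis
    using kI by (rule low_dvd_mono)
qed

lemma card_le_degree_prod:
  fixes S :: "int poly set"
  assumes "finite S" "\<And>f. f \<in> S \<Longrightarrow> degree f \<ge> 1"
  shows "card S \<le> degree (\<Prod>S) \<and> \<Prod>S \<noteq> 0"
  using assms
proof (induction S rule: finite_induct)
  case (insert f S)
  then have f: "degree f \<ge> 1" "f \<noteq> 0"
    by fastforce+
  have "card S \<le> degree (\<Prod>S)" "\<Prod>S \<noteq> 0"
    using insert by auto
  then have "degree (f * \<Prod>S) = degree f + degree (\<Prod>S)" "f * \<Prod>S \<noteq> 0"
    using f(2) by (auto simp: degree_mult_eq)
  then show ?case
    using insert.hyps f(1) \<open>card S \<le> degree (\<Prod>S)\<close> by simp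
qed simp

text \<open>\<open>R\<close> is the product of two Bezout constants, for \<open>f\<close> with its
  cofactor in \<open>g\<close> and for \<open>f\<close> with its derivative; they play the part of a
  resultant and a discriminant. Evaluating both identities at \<open>t\<close> shows that a prime
  dividing \<open>f\<close> at \<open>t\<close> but not \<open>R\<close> divides neither the
  cofactor nor the derivative there.\<close>

lemma prime_factor_discriminant:
  fixes f g :: "int poly" and S n :: nat
  assumes g: "g \<noteq> 0" "degree g = n" and f: "f \<in> prime_factors g" "degree f \<ge> 1" and S: "S \<ge> 1"
    and bound: "\<And>h i. h dvd g \<Longrightarrow> real n * real_of_int \<bar>coeff h i\<bar> \<le> real S"
  obtains R where "R \<noteq> 0" "\<bar>R\<bar> \<le> int ((4 * n * S + 1) ^ (4 * n))"
    "\<And>p t. prime p \<Longrightarrow> int p dvd poly f t \<Longrightarrow> \<not> int p dvd R \<Longrightarrow>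
      \<not> int p dvd poly (pderiv f) t \<and> \<not> int p dvd poly (g div f ^ multiplicity f g) t"
proof -
  have fp: "prime f" "f dvd g"
    using f(1) by auto
  have fe: "prime_elem f"
    using fp(1) by simp
  obtain g1 where g1: "g = f ^ multiplicity f g * g1" "\<not> f dvd g1"
    using multiplicity_decompose' [of g f] g(1) fe by (metis prime_elem_not_unit)
  have gdiv: "g div f ^ multiplicity f g = g1"
    using g1(1) fe by (metis nonzero_mult_div_cancel_left power_not_zero prime_elem_not_zeroI)
  have n1: "n \<ge> 1"
    using f(2) dvd_imp_degree_le [OF fp(2) g(1)] g(2) by linarith
  have bnd: "\<bar>coeff h i\<bar> \<le> int S" "int n * \<bar>coeff h i\<bar> \<le> int S" if "h dvd g" for h i
  proof -
    have "real_of_int (int n * \<bar>coeff h i\<bar>) \<le> real_of_int (int S)"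
      using bound [OF that] by simp
    then show 1: "int n * \<bar>coeff h i\<bar> \<le> int S"
      by linarith
    have "1 * \<bar>coeff h i\<bar> \<le> int n * \<bar>coeff h i\<bar>"
      using n1 by (intro mult_right_mono) auto
    then show "\<bar>coeff h i\<bar> \<le> int S"
      using 1 by linarith
  qed
  have g1g: "g1 dvd g"
    using g1(1) by (metis dvd_triv_right)
  have degs: "degree f \<le> n" "degree g1 \<le> n"
    using dvd_imp_degree_le g fp(2) g1g by blast+
  have g10: "g1 \<noteq> 0"
    using g1(2) by auto
  have weak: "int ((2 * N * S + 1) ^ N) \<le> int ((4 * n * S + 1) ^ (2 * n))" if "N \<le> 2 * n" for N
  proof -
    have "(2 * N * S + 1) ^ N \<le> (4 * n * S + 1) ^ N"
      using that by (intro power_mono) auto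
    also have "\<dots> \<le> (4 * n * S + 1) ^ (2 * n)"
      using that by (intro power_increasing) auto
    finally show ?thesis
      by (simp only: of_nat_le_iff)
  qed
  obtain a1 b1 R1 where R1: "a1 * f + b1 * g1 = [:R1:]" "R1 \<noteq> 0" "\<bar>R1\<bar> \<le> int ((2 * (degree f + degree g1) * S + 1) ^ (degree f + degree g1))"
    using bounded_bezout [OF fe f(2) g1(2) g10 refl S] bnd(1) [OF fp(2)] bnd(1) [OF g1g] by metis
  have pd: "pderiv f \<noteq> 0" "\<not> f dvd pderiv f"
  proof -
    show "pderiv f \<noteq> 0"
      using f(2) by (simp add: pderiv_eq_0_iff)
    then show "\<not> f dvd pderiv f"
      using f(2) dvd_imp_degree_le [of f "pderiv f"] by (auto simp: degree_pderiv)
  qed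
  \<comment> \<open>The factor \<open>n\<close> in the assumed coefficient bound is there to absorb
    the factor \<open>Suc i\<close> of the derivative.\<close>
  have pdc: "\<bar>coeff (pderiv f) i\<bar> \<le> int S" for i
  proof (cases "Suc i \<le> degree f")
    case True
    then have "int (Suc i) * \<bar>coeff f (Suc i)\<bar> \<le> int n * \<bar>coeff f (Suc i)\<bar>"
      using degs(1) by (intro mult_right_mono) auto
    then show ?thesis
      using bnd(2) [OF fp(2), of "Suc i"] by (simp add: coeff_pderiv abs_mult)
  next
    case False
    then have "coeff f (Suc i) = 0"
      by (intro coeff_eq_0) simp
    then show ?thesis
      by (simp add: coeff_pderiv)
  qed
  obtain a2 b2 R2 where R2: "a2 * f + b2 * pderiv f = [:R2:]" "R2 \<noteq> 0" "\<bar>R2\<bar> \<le> int ((2 * (degree f + degree (pderiv f)) * S + 1) ^ (degree f + degree (pderiv f)))"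
    using bounded_bezout [OF fe f(2) pd(2) pd(1) refl S] bnd(1) [OF fp(2)] pdc by metis
  let ?Y = "int ((4 * n * S + 1) ^ (2 * n))"
  have "\<bar>R1\<bar> \<le> ?Y"
    by (rule order_trans [OF R1(3) weak]) (use degs in simp)
  moreover have "\<bar>R2\<bar> \<le> ?Y"
    by (rule order_trans [OF R2(3) weak]) (use degs in \<open>simp add: degree_pderiv\<close>)
  ultimately have "\<bar>R1\<bar> * \<bar>R2\<bar> \<le> ?Y * ?Y"
    by (intro mult_mono) auto
  also have "?Y * ?Y = int ((4 * n * S + 1) ^ (4 * n))"
    by (simp only: of_nat_mult [symmetric] power_add [symmetric]) simp
  finally have "\<bar>R1 * R2\<bar> \<le> int ((4 * n * S + 1) ^ (4 * n))"
    by (simp only: abs_mult)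
  moreover have "\<not> int p dvd poly (pderiv f) t \<and> \<not> int p dvd poly (g div f ^ multiplicity f g) t"
    if "int p dvd poly f t" "\<not> int p dvd R1 * R2" for p t
  proof -
    have "poly a1 t * poly f t + poly b1 t * poly g1 t = R1" "poly a2 t * poly f t + poly b2 t * poly (pderiv f) t = R2"
      using arg_cong [OF R1(1), of "\<lambda>h. poly h t"] arg_cong [OF R2(1), of "\<lambda>h. poly h t"] by auto
    then show ?thesis
      unfolding gdiv using that by (metis dvd_add dvd_mult dvd_mult2)
  qed
  ultimately show ?thesis
    using that [of "R1 * R2"] R1(2) R2(2) by simp
qed

lemma prod_primes_dvd:
  assumes "finite P" "\<And>p. p \<in> P \<Longrightarrow> prime p \<and> int p dvd R"
  shows "(\<Prod>p\<in>P. int p) dvd R"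
  using assms
proof (induction P rule: finite_induct)
  case (insert p P)
  have "coprime (int p) (\<Prod>p\<in>P. int p)"
    using insert by (intro prod_coprime_right) (auto intro!: primes_coprime)
  then show ?case
    using insert by (simp add: divides_mult)
qed simp

text \<open>Distinct primes dividing \<open>R\<close> have their product dividing \<open>R\<close>,
  and each of them exceeds \<open>X\<close>.\<close>

lemma card_large_primes:
  fixes R :: int and X :: real
  assumes "R \<noteq> 0" "X \<ge> 2" "real_of_int \<bar>R\<bar> \<le> X ^ k"
  shows "finite {p. prime p \<and> X < real p \<and> int p dvd R} \<and> card {p. prime p \<and> X < real p \<and> int p dvd R} \<le> k"
proof -
  let ?P = "{p. prime p \<and> X < real p \<and> int p dvd R}"
  have "?P \<subseteq> {..nat \<bar>R\<bar>}"
    using assms(1) by (auto dest!: dvd_imp_le_int simp: nat_le_iff le_nat_iff)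
  then have fin: "finite ?P"
    using finite_subset by blast
  have "(\<Prod>p\<in>?P. int p) dvd R"
    by (rule prod_primes_dvd [OF fin]) auto
  then have "\<bar>\<Prod>p\<in>?P. int p\<bar> \<le> \<bar>R\<bar>"
    using assms(1) by (rule dvd_imp_le_int [rotated])
  then have "real_of_int \<bar>\<Prod>p\<in>?P. int p\<bar> \<le> real_of_int \<bar>R\<bar>"
    by (simp only: of_int_le_iff)
  then have "(\<Prod>p\<in>?P. real p) \<le> X ^ k"
    using assms(3) by (simp add: abs_prod)
  moreover have "X ^ card ?P \<le> (\<Prod>p\<in>?P. real p)"
  proof -
    have "(\<Prod>p\<in>?P. X) \<le> (\<Prod>p\<in>?P. real p)"
      using assms(2) by (intro prod_mono) auto
    then show ?thesis
      by simp
  qed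
  ultimately have "X ^ card ?P \<le> X ^ k"
    by linarith
  then have "card ?P \<le> k"
    using assms(2) by (simp add: power_increasing_iff)
  then show ?thesis
    using fin by blast
qed

lemma pcompose_shift_power: "pcompose (f ^ e) q = pcompose f q ^ e" for f :: "int poly"
  by (induction e) (simp_all add: pcompose_mult pcompose_1)

lemma coeff_shift_0: "coeff (pcompose f [:t, 1:]) 0 = poly f t" for f :: "int poly"
  by (simp add: poly_pcompose flip: poly_0_coeff_0)

lemma coeff_shift_1: "coeff (pcompose f [:t, 1:]) 1 = poly (pderiv f) t" for f :: "int poly"
proof -
  have "coeff (pcompose f [:t, 1:]) 1 = coeff (pderiv (pcompose f [:t, 1:])) 0"
    by (simp add: coeff_pderiv)
  also have "pderiv (pcompose f [:t, 1:]) = pcompose (pderiv f) [:t, 1:]"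
    by (simp add: pderiv_pcompose pderiv_pCons)
  finally show ?thesis
    by (simp only: coeff_shift_0)
qed

lemma prime_factor_of_value:
  fixes g :: "int poly"
  assumes "g \<noteq> 0" "prime p" "p dvd poly g t"
  obtains f where "f \<in> prime_factors g" "p dvd poly f t"
proof -
  have "normalize (prod_mset (prime_factorization g)) = normalize g"
    using assms(1) by (rule prod_mset_prime_factorization_weak)
  then have "g dvd prod_mset (prime_factorization g)"
    by (metis dvd_normalize_iff normalize_dvd_iff dvd_refl)
  then have "poly g t dvd poly (prod_mset (prime_factorization g)) t"
    by (metis dvdE dvd_triv_left poly_mult)
  then have "p dvd poly (prod_mset (prime_factorization g)) t"
    using assms(3) dvd_trans by blast
  moreover have "poly (prod_mset M) t = prod_mset (image_mset (\<lambda>f. poly f t) M)" for M :: "int poly multiset"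
    by (induction M) auto
  ultimately have "p dvd prod_mset (image_mset (\<lambda>f. poly f t) (prime_factorization g))"
    by simp
  then obtain f where "f \<in># prime_factorization g" "p dvd poly f t"
    using assms(2) by (auto simp: prime_dvd_prod_mset_iff)
  then show ?thesis
    using that by blast
qed

lemma card_nonconstant_prime_factors:
  fixes g :: "int poly"
  assumes "g \<noteq> 0"
  shows "card {f \<in> prime_factors g. degree f \<ge> 1} \<le> degree g"
proof -
  let ?F = "{f \<in> prime_factors g. degree f \<ge> 1}"
  have fin: "finite ?F"
    by simp
  have "mset_set ?F \<subseteq># mset_set (prime_factors g)"
    by (rule subset_imp_msubset_mset_set) auto
  also have "\<dots> \<subseteq># prime_factorization g"
    by (rule mset_set_set_mset_msubset)
  finally have "prod_mset (mset_set ?F) dvd prod_mset (prime_factorization g)"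
    by (rule prod_mset_subset_imp_dvd)
  also have "prod_mset (prime_factorization g) dvd g"
    using prod_mset_prime_factorization_weak [OF assms] by (metis dvd_normalize_iff normalize_dvd_iff dvd_refl)
  finally have "\<Prod>?F dvd g"
    by (simp add: prod_unfold_prod_mset)
  then have "degree (\<Prod>?F) \<le> degree g"
    using assms by (rule dvd_imp_degree_le)
  moreover have "card ?F \<le> degree (\<Prod>?F)"
    using card_le_degree_prod [OF fin] by simp
  ultimately show ?thesis
    by linarith
qed

text \<open>Multiplicity at least \<open>n - 6\<close> forces the irreducible factor responsible for it to have
  degree at most \<open>n / (n - 6)\<close>, hence at most \<open>2\<close> since \<open>n \<ge> 10\<close>; its value at \<open>t\<close> is then
  smaller than \<open>p\<close>.\<close>

lemma pencil_discriminant: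
  fixes A B :: "int^'n^'n" and r :: real and S :: nat
  assumes n: "CARD('n) \<ge> 10" and dB: "det B \<noteq> 0" and r: "r \<ge> 1"
    and roots: "\<And>z :: complex. poly (map_poly of_int (pencil A B)) z = 0 \<Longrightarrow> norm z \<le> r"
    and S: "S \<ge> 1" "real CARD('n) * (real_of_int \<bar>det B\<bar> * (1 + r) ^ CARD('n)) \<le> real S"
  shows "\<exists>R. R \<noteq> 0 \<and> \<bar>R\<bar> \<le> int ((4 * CARD('n) * S + 1) ^ (4 * CARD('n) * CARD('n))) \<and>
    (\<forall>p t. prime p \<longrightarrow> real_of_int \<bar>t\<bar> \<le> r \<longrightarrow> real_of_int \<bar>det B\<bar> * (2 * r)\<^sup>2 < real p \<longrightarrow>
      poly (pencil A B) t \<noteq> 0 \<longrightarrow> low_dvd (int p) (CARD('n) - 6) (pcompose (pencil A B) [:t, 1:]) \<longrightarrow> int p dvd R)"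
proof -
  let ?n = "CARD('n)"
  define g where "g = pencil A B"
  have cg: "coeff g ?n = det B"
    unfolding g_def by (rule pencil_coeff)
  have dg: "degree g = ?n"
    unfolding g_def by (rule order_antisym [OF pencil_coeff(1) le_degree]) (use cg dB in \<open>simp add: g_def\<close>)
  have lg: "lead_coeff g = det B"
    by (simp add: dg cg)
  have g0: "g \<noteq> 0"
    using dg n by auto
  define F where "F = {f \<in> prime_factors g. degree f \<ge> 1}"
  define Y where "Y = int ((4 * ?n * S + 1) ^ (4 * ?n))"
  have bound: "real ?n * real_of_int \<bar>coeff h i\<bar> \<le> real S" if "h dvd g" for h i
  proof -
    have "real_of_int \<bar>coeff h i\<bar> \<le> real_of_int \<bar>lead_coeff g\<bar> * (1 + r) ^ degree g"
      using factor_bounds(1) [OF that g0 _ roots [folded g_def], of i] r by simp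
    then have "real ?n * real_of_int \<bar>coeff h i\<bar> \<le> real ?n * (real_of_int \<bar>det B\<bar> * (1 + r) ^ ?n)"
      unfolding lg unfolding dg by (intro mult_left_mono) auto
    then show ?thesis
      using S(2) by linarith
  qed
  have "\<exists>R. R \<noteq> 0 \<and> \<bar>R\<bar> \<le> Y \<and> (\<forall>p t. prime p \<longrightarrow> int p dvd poly f t \<longrightarrow> \<not> int p dvd R \<longrightarrow>
      \<not> int p dvd poly (pderiv f) t \<and> \<not> int p dvd poly (g div f ^ multiplicity f g) t)" if "f \<in> F" for f
  proof -
    have "f \<in> prime_factors g" "degree f \<ge> 1"
      using that by (auto simp: F_def)
    then show ?thesis
      using prime_factor_discriminant [OF g0 dg _ _ S(1) bound, of f] unfolding Y_def by metis
  qed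
  then obtain R where R: "\<And>f. f \<in> F \<Longrightarrow> R f \<noteq> 0" "\<And>f. f \<in> F \<Longrightarrow> \<bar>R f\<bar> \<le> Y"
    "\<And>f p t. f \<in> F \<Longrightarrow> prime p \<Longrightarrow> int p dvd poly f t \<Longrightarrow> \<not> int p dvd R f \<Longrightarrow>
      \<not> int p dvd poly (pderiv f) t \<and> \<not> int p dvd poly (g div f ^ multiplicity f g) t"
    by metis
  have finF: "finite F"
    by (simp add: F_def)
  have cardF: "card F \<le> ?n"
    using card_nonconstant_prime_factors [OF g0] by (simp add: F_def dg)
  have Y1: "Y \<ge> 1"
    by (simp add: Y_def)
  have "(\<Prod>f\<in>F. R f) \<noteq> 0"
    using R(1) finF by simp
  \<comment> \<open>There are at most \<open>n\<close> nonconstant prime factors, each with a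
    constant of exponent \<open>4 * n\<close>; this makes \<open>4 * n * n\<close>.\<close>
  moreover have "\<bar>\<Prod>f\<in>F. R f\<bar> \<le> int ((4 * ?n * S + 1) ^ (4 * ?n * ?n))"
  proof -
    have "\<bar>\<Prod>f\<in>F. R f\<bar> \<le> (\<Prod>f\<in>F. Y)"
      unfolding abs_prod using R(2) by (intro prod_mono) auto
    also have "\<dots> \<le> Y ^ ?n"
      using Y1 cardF by (simp add: power_increasing)
    also have "\<dots> = int ((4 * ?n * S + 1) ^ (4 * ?n * ?n))"
      by (simp only: Y_def of_nat_power power_mult)
    finally show ?thesis .
  qed
  moreover have "int p dvd (\<Prod>f\<in>F. R f)"
    if p: "prime p" and t: "real_of_int \<bar>t\<bar> \<le> r" and X: "real_of_int \<bar>det B\<bar> * (2 * r)\<^sup>2 < real p"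
      and gt: "poly g t \<noteq> 0" and low: "low_dvd (int p) (?n - 6) (pcompose g [:t, 1:])" for p t
  proof -
    have pi: "prime (int p)"
      using p by simp
    have "int p dvd coeff (pcompose g [:t, 1:]) 0"
      by (rule low [unfolded low_dvd_def, rule_format]) (use n in simp)
    then have "int p dvd poly g t"
      by (simp only: coeff_shift_0)
    then obtain f where f: "f \<in> prime_factors g" "int p dvd poly f t"
      using prime_factor_of_value [OF g0 pi] by blast
    have fdvd: "f dvd g"
      using f(1) by auto
    have dBp: "real_of_int \<bar>det B\<bar> < real p"
    proof -
      have "1 \<le> (2 * r)\<^sup>2"
        by (rule one_le_power) (use r in simp)
      then have "real_of_int \<bar>det B\<bar> * 1 \<le> real_of_int \<bar>det B\<bar> * (2 * r)\<^sup>2"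
        by (intro mult_left_mono) auto
      then show ?thesis
        using X by linarith
    qed
    \<comment> \<open>A constant prime factor divides the leading coefficient \<open>det B\<close>,
      which is too small to be divisible by \<open>p\<close>.\<close>
    have deg1: "degree f \<ge> 1"
    proof (rule ccontr)
      assume "\<not> degree f \<ge> 1"
      then obtain k where k: "f = [:k:]"
        by (metis One_nat_def Suc_leI degree_eq_zeroE neq0_conv)
      obtain h where "g = f * h"
        using fdvd by blast
      then have "det B = lead_coeff f * lead_coeff h"
        using lg by (metis lead_coeff_mult)
      moreover have "lead_coeff f = k"
        by (simp add: k)
      ultimately have "det B = k * lead_coeff h"
        by simp
      moreover have "int p dvd k"
        using f(2) k by simp
      ultimately have "int p dvd det B"
        by simp
      then have "int p \<le> \<bar>det B\<bar>"
        using dB dvd_imp_le_int [of "det B" "int p"] by simp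
      then show False
        using dBp by linarith
    qed
    have fF: "f \<in> F"
      using f(1) deg1 by (simp add: F_def)
    have "int p dvd R f"
    proof (rule ccontr)
      assume nd: "\<not> int p dvd R f"
      define e where "e = multiplicity f g"
      define g1 where "g1 = g div f ^ e"
      have g: "g = f ^ e * g1"
        using multiplicity_dvd [of f g] by (simp add: g1_def e_def)
      have nz: "\<not> int p dvd poly (pderiv f) t" "\<not> int p dvd poly g1 t"
        using R(3) [OF fF p f(2) nd] by (auto simp: g1_def e_def)
      have "?n - 6 \<le> e"
      proof (rule low_dvd_multiplicity_ge [OF pi])
        show "low_dvd (int p) (?n - 6) (pcompose f [:t, 1:] ^ e * pcompose g1 [:t, 1:])"
          using low arg_cong [OF g, of "\<lambda>h. pcompose h [:t, 1:]"] by (simp only: pcompose_mult pcompose_shift_power)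
      qed (use f(2) nz in \<open>simp_all only: coeff_shift_0 coeff_shift_1 not_False_eq_True\<close>)
      have f0: "f \<noteq> 0"
        using deg1 by auto
      have "g1 \<noteq> 0"
        using g g0 by (metis mult_zero_right)
      then have "?n = e * degree f + degree g1"
        using arg_cong [OF g, of degree] f0 by (simp only: degree_mult_eq degree_power_eq power_not_zero dg not_False_eq_True)
      then have "e * degree f \<le> ?n"
        by linarith
      then have "(?n - 6) * degree f \<le> ?n"
        using \<open>?n - 6 \<le> e\<close> by (meson le_trans mult_le_mono1)
      have deg2: "degree f \<le> 2"
      proof (rule ccontr)
        assume "\<not> degree f \<le> 2"
        then have "(?n - 6) * 3 \<le> (?n - 6) * degree f"
          by (intro mult_left_mono) auto
        then show False
          using \<open>(?n - 6) * degree f \<le> ?n\<close> n by linarith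
      qed
      have "real_of_int \<bar>poly f t\<bar> \<le> real_of_int \<bar>det B\<bar> * (2 * r) ^ degree f"
        using factor_bounds(2) [OF fdvd g0 _ roots [folded g_def] t] r by (simp add: lg)
      also have "\<dots> \<le> real_of_int \<bar>det B\<bar> * (2 * r)\<^sup>2"
        using r deg2 by (intro mult_left_mono power_increasing) auto
      finally have "real_of_int \<bar>poly f t\<bar> < real p"
        using X by linarith
      then have "\<bar>poly f t\<bar> < int p"
        by linarith
      then have "poly f t = 0"
        using f(2) dvd_imp_le_int [of "poly f t" "int p"] by (metis abs_of_nat not_le)
      then have "poly g t = 0"
        using fdvd by (metis dvdE mult_zero_left poly_mult)
      then show False
        using gt by blast
    qed
    then show ?thesis
      using finF fF by (meson dvd_prodI dvd_trans)
  qed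
  ultimately show ?thesis
    unfolding g_def by blast
qed

text \<open>One number \<open>R\<close> is attached to the whole line. At most \<open>k\<close>
  primes beyond \<open>X\<close> divide it, and for each of them \<open>t\<close> is a root of the
  pencil modulo \<open>p\<close>. Since \<open>2 * r \<le> X < p\<close>, different \<open>t\<close>
  are incongruent, which leaves at most \<open>n\<close> of them.\<close>

lemma line_count:
  fixes A B :: "int^'n^'n" and r X :: real and S :: nat
  assumes n: "CARD('n) \<ge> 10" and dB: "det B \<noteq> 0" and r: "r \<ge> 1"
    and roots: "\<And>z :: complex. poly (map_poly of_int (pencil A B)) z = 0 \<Longrightarrow> norm z \<le> r"
    and S: "S \<ge> 1" "real CARD('n) * (real_of_int \<bar>det B\<bar> * (1 + r) ^ CARD('n)) \<le> real S"
    and X: "X \<ge> 2" "real_of_int \<bar>det B\<bar> * (2 * r)\<^sup>2 \<le> X" "2 * r \<le> X"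
    and k: "real ((4 * CARD('n) * S + 1) ^ (4 * CARD('n) * CARD('n))) \<le> X ^ k"
  shows "finite {(t, p). real_of_int \<bar>t\<bar> \<le> r \<and> prime p \<and> X < real p \<and> det (\<chi> i j. A$i$j + t * B$i$j) \<noteq> 0 \<and>
      card (kerq (int p) (\<chi> i j. A$i$j + t * B$i$j)) > p ^ (CARD('n) - 7)} \<and>
    card {(t, p). real_of_int \<bar>t\<bar> \<le> r \<and> prime p \<and> X < real p \<and> det (\<chi> i j. A$i$j + t * B$i$j) \<noteq> 0 \<and>
      card (kerq (int p) (\<chi> i j. A$i$j + t * B$i$j)) > p ^ (CARD('n) - 7)} \<le> k * CARD('n)"
    (is "finite ?E \<and> card ?E \<le> _")
proof -
  let ?n = "CARD('n)"
  define g where "g = pencil A B"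
  obtain R where R: "R \<noteq> 0" "\<bar>R\<bar> \<le> int ((4 * ?n * S + 1) ^ (4 * ?n * ?n))"
    "\<And>p t. prime p \<Longrightarrow> real_of_int \<bar>t\<bar> \<le> r \<Longrightarrow> real_of_int \<bar>det B\<bar> * (2 * r)\<^sup>2 < real p \<Longrightarrow>
      poly g t \<noteq> 0 \<Longrightarrow> low_dvd (int p) (?n - 6) (pcompose g [:t, 1:]) \<Longrightarrow> int p dvd R"
    using pencil_discriminant [OF n dB r roots S] unfolding g_def by blast
  define P where "P = {p. prime p \<and> X < real p \<and> int p dvd R}"
  have "real_of_int \<bar>R\<bar> \<le> real_of_int (int ((4 * ?n * S + 1) ^ (4 * ?n * ?n)))"
    using R(2) by (simp only: of_int_le_iff)
  then have "real_of_int \<bar>R\<bar> \<le> X ^ k"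
    using k by simp
  then have P: "finite P" "card P \<le> k"
    using card_large_primes [OF R(1) X(1)] by (auto simp: P_def)
  define T where "T p = {t. real_of_int \<bar>t\<bar> \<le> r \<and> int p dvd poly g t}" for p
  have finT: "finite (T p)" for p
  proof (rule finite_subset)
    show "T p \<subseteq> {- \<lceil>r\<rceil>..\<lceil>r\<rceil>}"
    proof
      fix t assume "t \<in> T p"
      then have "real_of_int \<bar>t\<bar> \<le> r"
        by (simp add: T_def)
      then have "real_of_int \<bar>t\<bar> \<le> real_of_int \<lceil>r\<rceil>"
        using le_of_int_ceiling order_trans by blast
      then have "\<bar>t\<bar> \<le> \<lceil>r\<rceil>"
        by (simp only: of_int_le_iff)
      then show "t \<in> {- \<lceil>r\<rceil>..\<lceil>r\<rceil>}"
        by auto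
    qed
  qed simp
  have cg: "coeff g ?n = det B"
    unfolding g_def by (rule pencil_coeff)
  have dg: "degree g = ?n"
    unfolding g_def by (rule order_antisym [OF pencil_coeff(1) le_degree]) (use cg dB in \<open>simp add: g_def\<close>)
  have cardT: "card (T p) \<le> ?n" if p: "p \<in> P" for p
  proof -
    have pp: "prime (int p)" "X < real p"
      using p by (auto simp: P_def)
    have "\<not> int p dvd lead_coeff g"
    proof
      assume "int p dvd lead_coeff g"
      then have "int p \<le> \<bar>det B\<bar>"
        using dB dvd_imp_le_int [of "det B" "int p"] by (simp add: dg cg)
      moreover have "real_of_int \<bar>det B\<bar> * 1 \<le> real_of_int \<bar>det B\<bar> * (2 * r)\<^sup>2"
        by (rule mult_left_mono [OF one_le_power]) (use r in auto)
      ultimately show False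
        using X(2) pp(2) by linarith
    qed
    moreover have "s = t" if st: "s \<in> T p" "t \<in> T p" "int p dvd s - t" for s t
    proof (rule ccontr)
      assume "s \<noteq> t"
      then have "int p \<le> \<bar>s - t\<bar>"
        using st(3) dvd_imp_le_int [of "s - t" "int p"] by simp
      moreover have "real_of_int \<bar>s\<bar> \<le> r" "real_of_int \<bar>t\<bar> \<le> r"
        using st by (auto simp: T_def)
      ultimately show False
        using X(3) pp(2) by linarith
    qed
    ultimately have "card (T p) \<le> degree g"
      using finT by (intro card_roots_mod_prime [OF pp(1)]) (auto simp: T_def)
    then show ?thesis
      by (simp add: dg)
  qed
  have "?E \<subseteq> (\<lambda>(p, t). (t, p)) ` Sigma P T"
  proof clarify
    fix t p assume tp: "real_of_int \<bar>t\<bar> \<le> r" "prime p" "X < real p" "det (\<chi> i j. A$i$j + t * B$i$j) \<noteq> 0"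
      "card (kerq (int p) (\<chi> i j. A$i$j + t * B$i$j)) > p ^ (?n - 7)"
    \<comment> \<open>A kernel with strictly more than \<open>p ^ (n - 7)\<close> elements has
      dimension at least \<open>n - 6\<close>, the multiplicity required by
      \<open>pencil_discriminant\<close>.\<close>
    have "low_dvd (int p) (Suc (?n - 7)) (pcompose g [:t, 1:])"
      unfolding g_def pencil_shift [symmetric] by (rule pencil_low_dvd [OF tp(2,5)])
    moreover have "Suc (?n - 7) = ?n - 6"
      using n by linarith
    ultimately have low: "low_dvd (int p) (?n - 6) (pcompose g [:t, 1:])"
      by simp
    have "int p dvd R"
      using R(3) [OF tp(2,1) _ _ low] tp(3,4) X(2) by (simp add: g_def poly_pencil)
    moreover have "int p dvd coeff (pcompose g [:t, 1:]) 0"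
      by (rule low [unfolded low_dvd_def, rule_format]) (use n in simp)
    then have "int p dvd poly g t"
      by (simp only: coeff_shift_0)
    ultimately have "(p, t) \<in> Sigma P T"
      using tp by (simp add: P_def T_def)
    then show "(t, p) \<in> (\<lambda>(p, t). (t, p)) ` Sigma P T"
      by force
  qed
  moreover have fin: "finite (Sigma P T)"
    using P finT by blast
  ultimately have "finite ?E" "card ?E \<le> card (Sigma P T)"
    using finite_subset surj_card_le by blast+
  moreover have "card (Sigma P T) \<le> k * ?n"
  proof -
    have "card (Sigma P T) = (\<Sum>p\<in>P. card (T p))"
      using P finT by (simp add: card_SigmaI)
    also have "\<dots> \<le> (\<Sum>p\<in>P. ?n)"
      by (intro sum_mono cardT)
    also have "\<dots> \<le> k * ?n"
      using P by simp
    finally show ?thesis .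
  qed
  ultimately show ?thesis
    by linarith
qed

section \<open>Averaging over the primes\<close>

lemma hm_add_scale: "hm c (h + t *s v) = (\<chi> i j. hm c h$i$j + t * hm c v$i$j)"
  by (simp add: hm_def hess_def vec_eq_iff distrib_left sum.distrib sum_distrib_left mult_ac)

text \<open>The box is cut into lines in a direction \<open>v\<close> for which
  \<open>det (hm c v)\<close> is nonzero. There are about \<open>H ^ (n - 1)\<close> of them, and
  each carries at most \<open>k * n\<close> exceptional pairs, with \<open>k\<close> independent of
  \<open>H\<close>. The condition \<open>C * H ^ 2 \<le> X\<close> keeps the values of quadratic
  factors below the primes.\<close>

lemma special_count:
  fixes c :: "'n::finite \<Rightarrow> 'n \<Rightarrow> 'n \<Rightarrow> int"
  assumes n: "CARD('n) \<ge> 10" and v: "det (hm c v) \<noteq> 0"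
  shows "\<exists>C>0. \<forall>H X. H \<ge> 1 \<longrightarrow> X \<ge> C \<longrightarrow> C * (real H)\<^sup>2 \<le> X \<longrightarrow>
    finite {(h, p). h \<in> diff_box H \<and> prime p \<and> X < real p \<and> det (hm c h) \<noteq> 0 \<and> card (kerq (int p) (hm c h)) > p ^ (CARD('n) - 7)} \<and>
    real (card {(h, p). h \<in> diff_box H \<and> prime p \<and> X < real p \<and> det (hm c h) \<noteq> 0 \<and> card (kerq (int p) (hm c h)) > p ^ (CARD('n) - 7)})
      \<le> C * real H ^ (CARD('n) - 1)"
proof -
  let ?n = "CARD('n)"
  define D where "D = real_of_int \<bar>det (hm c v)\<bar>"
  have D1: "D \<ge> 1"
    using v unfolding D_def by linarith
  define V where "V = nat (1 + (\<Sum>i\<in>UNIV. \<bar>v$i\<bar>))"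
  have V1: "V \<ge> 1"
    by (simp add: V_def sum_nonneg nat_le_iff le_nat_iff)
  have vV: "\<bar>v$i\<bar> \<le> int V" for i
  proof -
    have "\<bar>v$i\<bar> \<le> (\<Sum>i\<in>UNIV. \<bar>v$i\<bar>)"
      by (rule member_le_sum) auto
    then show ?thesis
      by (simp add: V_def sum_nonneg)
  qed
  obtain i0 where i0: "v$i0 \<noteq> 0"
  proof (cases "v = 0")
    case True
    have "hm c v$i$j = 0" for i j
      using True by (simp add: hm_def hess_def)
    then have "int 0 dvd det (hm c v)"
      by (intro det_col_dvd) simp
    then show ?thesis
      using v by simp
  next
    case False
    then show ?thesis
      using that by (auto simp: vec_eq_iff)
  qed
  define cs where "cs = coeff_size c"
  have cs1: "cs \<ge> 1"
    unfolding cs_def by (rule coeff_size_ge_1)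
  \<comment> \<open>Entries of the base matrix are at most \<open>2 * cs * V * H\<close>, those in
    direction \<open>v\<close> weighted by \<open>H\<close> at most \<open>cs * V * H\<close>; this
    explains the factor 3.\<close>
  define K where "K = fact ?n * (3 * cs * real V) ^ ?n"
  have K1: "K \<ge> 1"
  proof -
    have "cs * real V \<ge> 1"
      using cs1 V1 by (simp add: mult_ge1_I)
    then have "(3 * cs * real V) ^ ?n \<ge> 1"
      by (intro one_le_power) simp
    then show ?thesis
      unfolding K_def by (intro mult_ge1_I) auto
  qed
  define C3 where "C3 = 4 * real ?n * (real ?n * (D * (2 * real ?n * K) ^ ?n) + 1) + 1"
  define C1 where "C1 = 2 + D * (2 * real ?n * K)\<^sup>2 + 2 * real ?n * K + C3"
  \<comment> \<open>The base \<open>4 * n * S + 1\<close> is at most \<open>C3 * H ^ n\<close>,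
    hence at most \<open>X ^ (n + 1)\<close>. Raising it to the exponent \<open>4 * n * n\<close>
    gives \<open>X ^ k\<close>.\<close>
  define k where "k = (?n + 1) * (4 * ?n * ?n)"
  define C2 where "C2 = (2 * real V + 1) * (5 * real V) ^ (?n - 1) * real (k * ?n)"
  define C where "C = C1 + C2"
  have C3pos: "C3 \<ge> 1"
    using D1 K1 by (simp add: C3_def)
  have pos: "D * (2 * real ?n * K)\<^sup>2 \<ge> 0" "2 * real ?n * K \<ge> 0" "C2 \<ge> 0"
    using D1 K1 by (auto simp: C2_def)
  have CC: "C \<ge> 2" "C \<ge> D * (2 * real ?n * K)\<^sup>2" "C \<ge> 2 * real ?n * K" "C \<ge> C3" "C \<ge> C2"
    using C3pos pos unfolding C_def C1_def by linarith+
  have main: "finite {(h, p). h \<in> diff_box H \<and> prime p \<and> X < real p \<and> det (hm c h) \<noteq> 0 \<and> card (kerq (int p) (hm c h)) > p ^ (?n - 7)} \<and>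
    real (card {(h, p). h \<in> diff_box H \<and> prime p \<and> X < real p \<and> det (hm c h) \<noteq> 0 \<and> card (kerq (int p) (hm c h)) > p ^ (?n - 7)})
      \<le> C * real H ^ (?n - 1)" (is "finite ?W \<and> _")
    if H: "H \<ge> 1" and XC: "X \<ge> C" and HX: "C * (real H)\<^sup>2 \<le> X" for H :: nat and X :: real
  proof -
    define r where "r = real ?n * K * real H"
    have Hr: "real H \<ge> 1"
      using H by simp
    have nK1: "real ?n * K \<ge> 1"
      using K1 n by (simp add: mult_ge1_I)
    have r1: "r \<ge> 1" "real H \<le> r"
    proof -
      have "1 * real H \<le> r"
        unfolding r_def using nK1 by (intro mult_right_mono) auto
      then show "real H \<le> r" "r \<ge> 1"
        using Hr by auto
    qed
    have H2: "real H \<le> (real H)\<^sup>2"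
      using Hr by (simp add: power2_eq_square)
    have HltX: "real H \<le> X"
    proof -
      have "1 * (real H)\<^sup>2 \<le> C * (real H)\<^sup>2"
        using CC(1) by (intro mult_right_mono) auto
      then show ?thesis
        using H2 HX by linarith
    qed
    define S where "S = nat \<lceil>real ?n * (D * (1 + r) ^ ?n)\<rceil>"
    have "1 \<le> (1 + r) ^ ?n"
      by (rule one_le_power) (use r1 in simp)
    then have "1 \<le> D * (1 + r) ^ ?n"
      using D1 by (simp add: mult_ge1_I)
    then have "1 \<le> real ?n * (D * (1 + r) ^ ?n)"
      using n by (simp add: mult_ge1_I)
    then have S: "S \<ge> 1" "real ?n * (D * (1 + r) ^ ?n) \<le> real S" "real S \<le> real ?n * (D * (1 + r) ^ ?n) + 1"
      unfolding S_def by linarith+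
    have X2: "X \<ge> 2" "D * (2 * r)\<^sup>2 \<le> X" "2 * r \<le> X"
    proof -
      show "X \<ge> 2"
        using CC XC by linarith
      have "D * (2 * r)\<^sup>2 = D * (2 * real ?n * K)\<^sup>2 * (real H)\<^sup>2"
        by (simp add: r_def power_mult_distrib)
      also have "\<dots> \<le> C * (real H)\<^sup>2"
        using CC(2) by (intro mult_right_mono) auto
      finally show "D * (2 * r)\<^sup>2 \<le> X"
        using HX by linarith
      have "2 * r = 2 * real ?n * K * real H"
        by (simp add: r_def)
      also have "\<dots> \<le> C * (real H)\<^sup>2"
        using CC(1,3) H2 pos by (intro mult_mono) auto
      finally show "2 * r \<le> X"
        using HX by linarith
    qed
    have kX: "real ((4 * ?n * S + 1) ^ (4 * ?n * ?n)) \<le> X ^ k"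
    proof -
      have Hn1: "1 \<le> real H ^ ?n"
        using Hr by (rule one_le_power)
      have "(1 + r) ^ ?n \<le> (2 * r) ^ ?n"
        using r1 by (intro power_mono) auto
      also have "\<dots> = (2 * real ?n * K) ^ ?n * real H ^ ?n"
        unfolding r_def power_mult_distrib [symmetric] by (simp add: mult_ac)
      finally have "real S \<le> real ?n * (D * ((2 * real ?n * K) ^ ?n * real H ^ ?n)) + 1 * 1"
        using S(3) D1 by (smt (verit) mult_left_mono of_nat_0_le_iff)
      also have "\<dots> \<le> real ?n * (D * ((2 * real ?n * K) ^ ?n * real H ^ ?n)) + 1 * real H ^ ?n"
        using Hn1 by linarith
      also have "\<dots> = (real ?n * (D * (2 * real ?n * K) ^ ?n) + 1) * real H ^ ?n"
        by (simp add: algebra_simps)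
      finally have "real S \<le> (real ?n * (D * (2 * real ?n * K) ^ ?n) + 1) * real H ^ ?n" .
      then have "4 * real ?n * real S \<le> 4 * real ?n * ((real ?n * (D * (2 * real ?n * K) ^ ?n) + 1) * real H ^ ?n)"
        by (intro mult_left_mono) auto
      then have "4 * real ?n * real S + 1 \<le> C3 * real H ^ ?n"
        using Hn1 by (simp add: C3_def algebra_simps)
      also have "\<dots> \<le> X * X ^ ?n"
        using CC XC HltX C3pos Hr by (intro mult_mono power_mono) auto
      finally have "real (4 * ?n * S + 1) \<le> X ^ (?n + 1)"
        by simp
      then have "real (4 * ?n * S + 1) ^ (4 * ?n * ?n) \<le> (X ^ (?n + 1)) ^ (4 * ?n * ?n)"
        by (intro power_mono) auto
      then show ?thesis
        by (simp only: k_def power_mult of_nat_power)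
    qed
    \<comment> \<open>Sizes of the base points of the lines: coordinate \<open>i0\<close> is a
      remainder modulo \<open>v$i0\<close>, the others are at most \<open>H + H * V\<close>.\<close>
    define b where "b i = (if i = i0 then int V else int (2 * V * H))" for i
    define L where "L = vec_lambda ` PiE UNIV (\<lambda>i. {- b i..b i})"
    have finL: "finite L"
      by (simp add: L_def finite_PiE)
    have cardL: "real (card L) \<le> (2 * real V + 1) * (5 * real V) ^ (?n - 1) * real H ^ (?n - 1)"
    proof -
      have "card L \<le> card (PiE UNIV (\<lambda>i. {- b i..b i}))"
        unfolding L_def by (intro card_image_le) (simp add: finite_PiE)
      also have "\<dots> = (\<Prod>i\<in>UNIV. card {- b i..b i})"
        by (simp add: card_PiE)
      also have "\<dots> = card {- b i0..b i0} * (\<Prod>i\<in>UNIV - {i0}. card {- b i..b i})"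
        by (simp add: prod.remove [of UNIV i0])
      also have "\<dots> = (2 * V + 1) * (4 * V * H + 1) ^ (?n - 1)"
      proof -
        have cc: "card {- int a..int a} = 2 * a + 1" for a
          by simp
        have "(\<Prod>i\<in>UNIV - {i0}. card {- b i..b i}) = (\<Prod>i\<in>UNIV - {i0}. 2 * (2 * V * H) + 1)"
        proof (rule prod.cong)
          fix i assume "i \<in> UNIV - {i0}"
          then have "b i = int (2 * V * H)"
            by (simp add: b_def)
          then show "card {- b i..b i} = 2 * (2 * V * H) + 1"
            by (simp only: cc)
        qed simp
        moreover have "card {- b i0..b i0} = 2 * V + 1"
          unfolding b_def using cc by simp
        ultimately show ?thesis
          by (simp only: mult.assoc) (simp add: card_Diff_singleton)
      qed
      finally have "real (card L) \<le> real ((2 * V + 1) * (4 * V * H + 1) ^ (?n - 1))"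
        by (simp only: of_nat_le_iff)
      also have "\<dots> = (2 * real V + 1) * (4 * real V * real H + 1) ^ (?n - 1)"
        by (simp only: of_nat_mult of_nat_power of_nat_add of_nat_1 of_nat_numeral)
      also have "\<dots> \<le> (2 * real V + 1) * (5 * real V * real H) ^ (?n - 1)"
      proof (intro mult_left_mono power_mono)
        have "1 \<le> real V * real H"
          using V1 Hr by (simp add: mult_ge1_I)
        then show "4 * real V * real H + 1 \<le> 5 * real V * real H"
          by linarith
      qed auto
      finally show ?thesis
        by (simp only: power_mult_distrib mult.assoc)
    qed
    define E where "E h0 = {(t, p). real_of_int \<bar>t\<bar> \<le> r \<and> prime p \<and> X < real p \<and> det (\<chi> i j. hm c h0$i$j + t * hm c v$i$j) \<noteq> 0 \<and>
      card (kerq (int p) (\<chi> i j. hm c h0$i$j + t * hm c v$i$j)) > p ^ (?n - 7)}" for h0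
    have E: "finite (E h0) \<and> card (E h0) \<le> k * ?n" if h0: "h0 \<in> L" for h0
      unfolding E_def
    proof (rule line_count [OF n v r1(1) _ S(1) _ X2(1) _ X2(3) kX])
      show "real_of_int \<bar>det (hm c v)\<bar> * (2 * r)\<^sup>2 \<le> X"
        using X2(2) by (simp only: D_def)
      show "real ?n * (real_of_int \<bar>det (hm c v)\<bar> * (1 + r) ^ ?n) \<le> real S"
        using S(2) by (simp only: D_def)
      have "\<bar>h0$i\<bar> \<le> int (2 * V * H)" for i
      proof -
        obtain f where f: "f \<in> PiE UNIV (\<lambda>i. {- b i..b i})" "h0 = vec_lambda f"
          using h0 unfolding L_def by blast
        then have "h0$i \<in> {- b i..b i}"
          by (simp add: PiE_iff)
        moreover have "b i \<le> int (2 * V * H)"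
        proof -
          have "V * 1 \<le> 2 * V * H"
            using H by (intro mult_mono) auto
          then have "int V \<le> int (2 * V * H)"
            by (simp only: mult_1_right of_nat_le_iff)
          then show ?thesis
            unfolding b_def by (cases "i = i0") (simp_all only: if_True if_False order_refl simp_thms)
        qed
        ultimately show ?thesis
          by (simp only: abs_le_iff atLeastAtMost_iff, linarith)
      qed
      then have "real_of_int \<bar>h0$i\<bar> \<le> real_of_int (int (2 * V * H))" for i
        by (simp only: of_int_le_iff)
      then have h0b: "real_of_int \<bar>h0$i\<bar> \<le> 2 * real V * real H" for i
        by simp
      have "real_of_int \<bar>v$i\<bar> \<le> real_of_int (int V)" for i
        using vV by (simp only: of_int_le_iff)
      then have vb: "real_of_int \<bar>v$i\<bar> \<le> real V" for i
        by simp
      have entry: "real_of_int \<bar>hm c h0$i$j\<bar> + real_of_int \<bar>hm c v$i$j\<bar> * real H \<le> 3 * cs * real V * real H" for i j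
      proof -
        have "real_of_int \<bar>hm c h0$i$j\<bar> \<le> cs * (2 * real V * real H)"
          unfolding cs_def by (rule abs_hm_le [OF h0b])
        moreover have "real_of_int \<bar>hm c v$i$j\<bar> * real H \<le> cs * real V * real H"
          unfolding cs_def by (intro mult_right_mono abs_hm_le [OF vb]) auto
        ultimately show ?thesis
          by (simp add: algebra_simps)
      qed
      have "real_of_int \<bar>coeff (pencil (hm c h0) (hm c v)) k\<bar> * real H ^ k \<le> K * real H ^ ?n" for k
        using pencil_coeff_le [OF entry, of k] by (simp add: K_def power_mult_distrib mult.assoc)
      then show "norm z \<le> r" if "poly (map_poly of_int (pencil (hm c h0) (hm c v))) z = (0 :: complex)" for z
        unfolding r_def by (rule pencil_roots_le [OF v _ K1 Hr that])
    qed
    \<comment> \<open>Euclidean division of coordinate \<open>i0\<close> by \<open>v$i0\<close>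
      selects the base point of the line and the parameter \<open>t\<close>.\<close>
    define \<psi> where "\<psi> = (\<lambda>(h :: int^'n, p :: nat). (h - (h$i0 div v$i0) *s v, (h$i0 div v$i0, p)))"
    have "inj_on \<psi> ?W"
    proof (rule inj_onI)
      fix x y assume "\<psi> x = \<psi> y"
      then show "x = y"
        by (cases x; cases y) (auto simp: \<psi>_def)
    qed
    moreover have "\<psi> ` ?W \<subseteq> Sigma L E"
    proof (rule image_subsetI)
      fix x assume "x \<in> ?W"
      then obtain h p where x: "x = (h, p)"
        and h: "h \<in> diff_box H" "prime p" "X < real p" "det (hm c h) \<noteq> 0" "card (kerq (int p) (hm c h)) > p ^ (?n - 7)"
        by blast
      define t where "t = h$i0 div v$i0"
      define h0 where "h0 = h - t *s v"
      have hH: "\<bar>h$i\<bar> \<le> int H" for i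
      proof -
        have "\<bar>h$i\<bar> < int H"
          using h(1) by (simp add: diff_box_def)
        then show ?thesis
          by simp
      qed
      have tH: "\<bar>t\<bar> \<le> int H"
      proof -
        have "\<bar>t\<bar> \<le> \<bar>h$i0\<bar>"
        proof (cases "h$i0 = 0")
          case False
          have eq: "h$i0 = v$i0 * t + h$i0 mod v$i0"
            by (simp add: t_def)
          have m: "\<bar>h$i0 mod v$i0\<bar> < \<bar>v$i0\<bar>"
            using i0 by (rule abs_mod_less)
          have vt: "\<bar>v$i0\<bar> * \<bar>t\<bar> \<le> \<bar>h$i0\<bar> + \<bar>v$i0\<bar> - 1"
            using eq m unfolding abs_mult [symmetric] by linarith
          show ?thesis
          proof (rule ccontr)
            assume "\<not> ?thesis"
            then have "\<bar>v$i0\<bar> * (\<bar>h$i0\<bar> + 1) \<le> \<bar>v$i0\<bar> * \<bar>t\<bar>"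
              by (intro mult_left_mono) auto
            moreover have "1 * \<bar>h$i0\<bar> \<le> \<bar>v$i0\<bar> * \<bar>h$i0\<bar>"
              using i0 by (intro mult_right_mono) auto
            ultimately show False
              using vt by (simp add: algebra_simps)
          qed
        qed (simp add: t_def)
        then show ?thesis
          using hH [of i0] by linarith
      qed
      have "\<bar>h0$i\<bar> \<le> b i" for i
      proof (cases "i = i0")
        case True
        have "h0$i0 = h$i0 mod v$i0"
          by (simp add: h0_def t_def minus_div_mult_eq_mod)
        then have "\<bar>h0$i0\<bar> < \<bar>v$i0\<bar>"
          using abs_mod_less [OF i0] by simp
        then show ?thesis
          using vV [of i0] True by (simp add: b_def)
      next
        case False
        have "\<bar>h0$i\<bar> \<le> \<bar>h$i\<bar> + \<bar>t\<bar> * \<bar>v$i\<bar>"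
          unfolding h0_def by (simp flip: abs_mult add: abs_triangle_ineq4)
        also have "\<dots> \<le> int H + int H * int V"
          using hH tH vV by (intro add_mono mult_mono) auto
        also have "\<dots> \<le> int H * int V + int H * int V"
          using V1 by (simp add: mult_le_cancel_left1)
        finally show ?thesis
          using False by (simp add: b_def mult_ac)
      qed
      then have "(\<lambda>i. h0$i) \<in> PiE UNIV (\<lambda>i. {- b i..b i})"
        by (auto simp: abs_le_iff minus_le_iff)
      then have "h0 \<in> L"
        unfolding L_def by (intro image_eqI [of _ _ "\<lambda>i. h0$i"]) auto
      moreover have "(t, p) \<in> E h0"
      proof -
        have "h = h0 + t *s v"
          by (simp add: h0_def)
        then have "hm c h = (\<chi> i j. hm c h0$i$j + t * hm c v$i$j)"
          using hm_add_scale [of c h0 t v] by simp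
        moreover have "real_of_int \<bar>t\<bar> \<le> r"
        proof -
          have "real_of_int \<bar>t\<bar> \<le> real_of_int (int H)"
            using tH by (simp only: of_int_le_iff)
          then show ?thesis
            using r1(2) by simp
        qed
        ultimately show ?thesis
          using h by (simp add: E_def)
      qed
      ultimately show "\<psi> x \<in> Sigma L E"
        by (simp add: x \<psi>_def t_def h0_def)
    qed
    moreover have finS: "finite (Sigma L E)"
      using finL E by blast
    ultimately have fW: "finite ?W" and cW: "card ?W \<le> card (Sigma L E)"
      using inj_on_finite card_inj_on_le by blast+
    have "card (Sigma L E) = (\<Sum>h0\<in>L. card (E h0))"
      using finL E by (simp add: card_SigmaI)
    also have "\<dots> \<le> (\<Sum>h0\<in>L. k * ?n)"
      using E by (intro sum_mono) blast
    finally have "card ?W \<le> card L * (k * ?n)"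
      using cW by simp
    then have "real (card ?W) \<le> real (card L) * real (k * ?n)"
      by (simp only: of_nat_mult [symmetric] of_nat_le_iff)
    also have "\<dots> \<le> (2 * real V + 1) * (5 * real V) ^ (?n - 1) * real H ^ (?n - 1) * real (k * ?n)"
      by (rule mult_right_mono [OF cardL]) simp
    also have "\<dots> = C2 * real H ^ (?n - 1)"
      by (simp add: C2_def mult_ac)
    also have "\<dots> \<le> C * real H ^ (?n - 1)"
      using CC(5) by (rule mult_right_mono) simp
    finally show ?thesis
      using fW by blast
  qed
  moreover have "C > 0"
    using CC(1) by linarith
  ultimately show ?thesis
    by blast
qed

lemma card_diff_box_le: "card (diff_box H :: (int^'n) set) \<le> (2 * H) ^ CARD('n)"
proof -
  have "inj_on (\<lambda>h. h + (\<chi> i. int H)) (diff_box H :: (int^'n) set)"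
    by (simp add: inj_on_def)
  moreover have "(\<lambda>h. h + (\<chi> i. int H)) ` (diff_box H :: (int^'n) set) \<subseteq> ibox (int (2 * H))"
  proof clarify
    fix h :: "int^'n" assume "h \<in> diff_box H"
    then have *: "\<bar>h$i\<bar> < int H" for i
      by (simp add: diff_box_def)
    have "0 \<le> h$i + int H \<and> h$i + int H < int (2 * H)" for i
      using * [of i] by linarith
    then show "h + (\<chi> i. int H) \<in> ibox (int (2 * H))"
      by (simp add: ibox_def)
  qed
  ultimately have "card (diff_box H :: (int^'n) set) \<le> card (ibox (int (2 * H)) :: (int^'n) set)"
    by (intro card_inj_on_le) auto
  then show ?thesis
    by (simp add: card_ibox nat_mult_distrib)
qed

text \<open>Otherwise every matrix has rank below \<open>n\<close>, and with
  \<open>\<epsilon> = 1 / 2\<close> the geometric condition allows only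
  \<open>O(H powr (n - 1 / 2))\<close> vectors in a box with at least \<open>H ^ n\<close> of
  them.\<close>

lemma exists_nonsingular:
  fixes c :: "'n::finite \<Rightarrow> 'n \<Rightarrow> 'n \<Rightarrow> int"
  assumes dav: "davenport_geometric c"
  shows "\<exists>v. det (hm c v) \<noteq> 0"
proof (rule ccontr)
  assume "\<not> ?thesis"
  then have "rk c h \<noteq> CARD('n)" for h
    using det_eq_0_rank [of "real_mat (hm c h)"] by (simp add: rk_eq det_real_mat)
  then have rk: "rk c h < CARD('n)" for h
    using rk_le [of c h] by (simp add: le_neq_implies_less)
  let ?n = "CARD('n)"
  obtain K where K: "K > 0" "\<And>\<rho> H. H > 0 \<Longrightarrow> real (card {h \<in> diff_box H. rk c h = \<rho>}) \<le> K * real H powr (real \<rho> + 1 / 2)"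
    using davenport_uniform [OF dav, of "1 / 2"] by auto
  \<comment> \<open>Chosen so that \<open>sqrt H\<close> exceeds \<open>n * K\<close>, the constant
    against which it is finally compared.\<close>
  define H where "H = nat \<lceil>(real ?n * K)\<^sup>2\<rceil> + 1"
  have H: "H > 0"
    unfolding H_def by (rule less_le_trans [OF zero_less_one le_add2])
  then have H0: "H > 0" "real H \<ge> 1"
    by simp_all
  have "(real ?n * K)\<^sup>2 \<le> real (nat \<lceil>(real ?n * K)\<^sup>2\<rceil>)"
    by (rule of_nat_ceiling)
  then have "real H > (real ?n * K)\<^sup>2"
    by (simp only: H_def of_nat_add of_nat_1)
  then have Hbig: "sqrt (real H) > real ?n * K"
    by (rule real_less_rsqrt)
  have "(ibox (int H) :: (int^'n) set) \<subseteq> diff_box H"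
    by (auto simp: ibox_def diff_box_def)
  then have "card (ibox (int H) :: (int^'n) set) \<le> card (diff_box H :: (int^'n) set)"
    by (intro card_mono) auto
  then have "real H ^ ?n \<le> real (card (diff_box H :: (int^'n) set))"
    by (simp add: card_ibox flip: of_nat_power)
  also have "\<dots> = (\<Sum>h\<in>(diff_box H :: (int^'n) set). 1)"
    by simp
  also have "\<dots> = (\<Sum>\<rho>\<le>?n. real (card {h \<in> diff_box H. rk c h = \<rho>}))"
    using sum_diff_box_by_rank [where F="\<lambda>_. 1" and H=H and c=c] by simp
  also have "\<dots> = (\<Sum>\<rho><?n. real (card {h \<in> diff_box H. rk c h = \<rho>}))"
  proof -
    have "rk c h \<noteq> ?n" for h
      using rk [of h] by simp
    then have "card {h \<in> diff_box H. rk c h = ?n} = 0"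
      by (simp only: simp_thms Collect_empty_eq card.empty empty_def [symmetric])
    then show ?thesis
      by (simp only: lessThan_Suc_atMost [symmetric] sum.lessThan_Suc of_nat_0 add_0_right)
  qed
  also have "\<dots> \<le> (\<Sum>\<rho><?n. K * real H powr (real ?n - 1 / 2))"
  proof (rule sum_mono)
    fix \<rho> assume "\<rho> \<in> {..<?n}"
    then have "real \<rho> + 1 / 2 \<le> real ?n - 1 / 2"
      by simp
    then have "K * real H powr (real \<rho> + 1 / 2) \<le> K * real H powr (real ?n - 1 / 2)"
      using K(1) H0 by (intro mult_left_mono powr_mono) auto
    then show "real (card {h \<in> diff_box H. rk c h = \<rho>}) \<le> K * real H powr (real ?n - 1 / 2)"
      using K(2) [OF H0(1), of \<rho>] by linarith
  qed
  also have "\<dots> = real ?n * K * (real H ^ ?n / sqrt (real H))"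
    using H0 by (simp add: powr_diff powr_realpow powr_half_sqrt)
  finally have "real H ^ ?n * sqrt (real H) \<le> real ?n * K * real H ^ ?n"
    using H0 by (simp add: field_simps)
  then have "sqrt (real H) \<le> real ?n * K"
    using H0 by (simp add: mult.commute)
  then show False
    using Hbig by linarith
qed

text \<open>Normalised so that a kernel of dimension \<open>n - m\<close> has weight
  \<open>p powr (- m / 2)\<close>, and so that the Weyl bound depends only on the mean of the
  weights over \<open>h\<close>.\<close>

definition kernel_weight :: "('n::finite \<Rightarrow> 'n \<Rightarrow> 'n \<Rightarrow> int) \<Rightarrow> nat \<Rightarrow> int^'n \<Rightarrow> real" where
  "kernel_weight c p h = sqrt (real (card (kerq (int p) (hm c h))) / real p ^ CARD('n))"

lemma kernel_weight_nonneg: "kernel_weight c p h \<ge> 0"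
  by (simp add: kernel_weight_def)

lemma kernel_weight_le:
  fixes c :: "'n::finite \<Rightarrow> 'n \<Rightarrow> 'n \<Rightarrow> int"
  assumes "real (card (kerq (int p) (hm c h))) \<le> B * real p ^ (CARD('n) - m)" "m \<le> CARD('n)" "p > 0"
    "B / real p ^ m \<le> D\<^sup>2" "D \<ge> 0"
  shows "kernel_weight c p h \<le> D"
proof -
  have "real (card (kerq (int p) (hm c h))) / real p ^ CARD('n) \<le> B * real p ^ (CARD('n) - m) / real p ^ CARD('n)"
    using assms(1) by (intro divide_right_mono) auto
  also have "\<dots> = B / real p ^ m"
    using assms(2,3) by (simp add: power_diff)
  finally have "real (card (kerq (int p) (hm c h))) / real p ^ CARD('n) \<le> D\<^sup>2"
    using assms(4) by linarith
  then show ?thesis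
    unfolding kernel_weight_def using assms(5) by (rule real_le_lsqrt [OF _ _, rotated])
qed

lemma sing_abs_term_prime_le:
  fixes c :: "'n::finite \<Rightarrow> 'n \<Rightarrow> 'n \<Rightarrow> int"
  assumes c: "symmetric_coeffs c" and p: "p > 0" and H: "H > 0"
  shows "sing_abs_term c p \<le> real p * sqrt ((\<Sum>h\<in>diff_box H. kernel_weight c p h) / real H ^ CARD('n))"
proof (rule sing_abs_term_le [OF p])
  let ?V = "(\<Sum>h\<in>diff_box H. kernel_weight c p h) / real H ^ CARD('n)"
  have V: "?V \<ge> 0"
    by (intro divide_nonneg_nonneg sum_nonneg kernel_weight_nonneg) auto
  then show "sqrt ?V \<ge> 0"
    by simp
  fix a assume a: "coprime a (int p)"
  have "sqrt (real p ^ CARD('n) * N) = real p ^ CARD('n) * sqrt (N / real p ^ CARD('n))" for N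
  proof -
    have "real p ^ CARD('n) * N = (real p ^ CARD('n))\<^sup>2 * (N / real p ^ CARD('n))"
      using p by (simp add: power2_eq_square)
    then show ?thesis
      by (simp only: real_sqrt_mult) simp
  qed
  then have "(\<Sum>h\<in>diff_box H. sqrt (real p ^ CARD('n) * real (card (kerq (int p) (hm c h))))) =
    real p ^ CARD('n) * (\<Sum>h\<in>diff_box H. kernel_weight c p h)"
    by (simp only: kernel_weight_def sum_distrib_left)
  then have "(norm (gauss_sum c p a))\<^sup>2 \<le> real p ^ CARD('n) / real H ^ CARD('n) * (real p ^ CARD('n) * (\<Sum>h\<in>diff_box H. kernel_weight c p h))"
    using weyl_van_der_corput [OF c p a H] by simp
  also have "\<dots> = (real p ^ CARD('n))\<^sup>2 * ?V"
    by (simp add: power2_eq_square)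
  also have "\<dots> = (real p ^ CARD('n) * sqrt ?V)\<^sup>2"
    using V by (simp only: power_mult_distrib real_sqrt_pow2)
  finally show "norm (gauss_sum c p a) \<le> real p ^ CARD('n) * sqrt ?V"
    by (rule power2_le_imp_le) (use V in simp)
qed

text \<open>\<open>E\<close> collects the primes beyond \<open>Z ^ 200\<close> dividing the minor;
  the minor is at most \<open>(Z ^ 200) ^ (n + 1)\<close>, so there are at most
  \<open>n + 1\<close>. In general the weight is about \<open>(H / p) powr (r / 2)\<close>, where
  \<open>59 = (200 - 82) / 2\<close>. Outside \<open>E\<close> it is
  \<open>p powr (- r / 2)\<close>, where \<open>100 = 200 / 2\<close>.\<close>

lemma kernel_weight_by_rank:
  fixes c :: "'n::finite \<Rightarrow> 'n \<Rightarrow> 'n \<Rightarrow> int"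
  assumes Z: "Z \<ge> 2" "minor_const c \<le> Z" and H: "Z ^ 82 \<le> real H" "real H \<le> 2 * Z ^ 82" and h: "h \<in> diff_box H"
  shows "\<exists>E. finite E \<and> card E \<le> CARD('n) + 1 \<and> (\<forall>p. prime p \<longrightarrow> Z ^ 200 < real p \<longrightarrow>
    kernel_weight c p h \<le> sqrt (minor_const c * 2 ^ CARD('n)) / Z ^ (59 * rk c h) \<and>
    (p \<notin> E \<longrightarrow> kernel_weight c p h \<le> 1 / Z ^ (100 * rk c h)))"
proof -
  let ?n = "CARD('n)" and ?r = "rk c h" and ?mc = "minor_const c"
  have mc: "?mc \<ge> 1"
    by (rule minor_const_ge_1)
  have Z1: "Z \<ge> 1"
    using Z by simp
  have H1: "real H \<ge> 1"
    using H(1) one_le_power [OF Z1, of 82] by linarith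
  obtain \<Delta> :: int where \<Delta>: "\<Delta> \<noteq> 0" "real_of_int \<bar>\<Delta>\<bar> \<le> ?mc * real H ^ ?r"
    "\<And>p k. prime p \<Longrightarrow> int (card (kerq (int (p ^ k)) (hm c h))) \<le> int (p ^ k) ^ (?n - ?r) * \<bar>\<Delta>\<bar>"
    "\<And>p. prime p \<Longrightarrow> \<not> int p dvd \<Delta> \<Longrightarrow> card (kerq (int p) (hm c h)) \<le> p ^ (?n - ?r)"
    using kernel_count_rank [OF H1 abs_diff_box [OF h], of c] by blast
  define E where "E = {p. prime p \<and> Z ^ 200 < real p \<and> int p dvd \<Delta>}"
  have Z200: "Z ^ 200 \<ge> Z" "Z ^ 200 \<ge> 2 * Z ^ 82"
  proof -
    have "Z ^ 1 \<le> Z ^ 200"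
      using Z1 by (rule power_increasing [rotated]) simp
    then show "Z ^ 200 \<ge> Z"
      by simp
    have "2 * Z ^ 82 \<le> Z * Z ^ 82"
      using Z by (intro mult_right_mono) auto
    also have "\<dots> = Z ^ 83"
      by (simp flip: power_Suc)
    also have "\<dots> \<le> Z ^ 200"
      using Z1 by (intro power_increasing) auto
    finally show "Z ^ 200 \<ge> 2 * Z ^ 82" .
  qed
  have "?mc * real H ^ ?r \<le> Z ^ 200 * (Z ^ 200) ^ ?r"
    using Z H Z200 mc by (intro mult_mono power_mono) auto
  also have "\<dots> = (Z ^ 200) ^ (?r + 1)"
    by simp
  also have "\<dots> \<le> (Z ^ 200) ^ (?n + 1)"
    using rk_le [of c h] Z1 by (intro power_increasing one_le_power) auto
  finally have "real_of_int \<bar>\<Delta>\<bar> \<le> (Z ^ 200) ^ (?n + 1)"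
    using \<Delta>(2) by linarith
  moreover have "Z ^ 200 \<ge> 2"
    using Z200 Z by linarith
  ultimately have E: "finite E \<and> card E \<le> ?n + 1"
    unfolding E_def using card_large_primes [OF \<Delta>(1)] by blast
  have "kernel_weight c p h \<le> sqrt (?mc * 2 ^ ?n) / Z ^ (59 * ?r)" if p: "prime p" "Z ^ 200 < real p" for p
  proof (rule kernel_weight_le [OF _ rk_le])
    have "real_of_int (int (card (kerq (int p) (hm c h)))) \<le> real_of_int (int p ^ (?n - ?r) * \<bar>\<Delta>\<bar>)"
      using \<Delta>(3) [OF p(1), of 1] unfolding of_int_le_iff power_one_right .
    then have "real (card (kerq (int p) (hm c h))) \<le> real_of_int \<bar>\<Delta>\<bar> * real p ^ (?n - ?r)"
      by (simp add: mult.commute)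
    also have "\<dots> \<le> (?mc * real H ^ ?r) * real p ^ (?n - ?r)"
      using \<Delta>(2) by (intro mult_right_mono) auto
    finally show "real (card (kerq (int p) (hm c h))) \<le> (?mc * real H ^ ?r) * real p ^ (?n - ?r)" .
    have "?mc * real H ^ ?r / real p ^ ?r \<le> ?mc * (2 * Z ^ 82) ^ ?r / (Z ^ 200) ^ ?r"
      using mc H p Z by (intro frac_le mult_left_mono power_mono) auto
    also have "\<dots> = ?mc * (2 * Z ^ 82 / Z ^ 200) ^ ?r"
      by (simp only: power_divide times_divide_eq_right)
    also have "2 * Z ^ 82 / Z ^ 200 = 2 / Z ^ 118"
      using Z by (simp add: field_simps)
    also have "?mc * (2 / Z ^ 118) ^ ?r = ?mc * 2 ^ ?r / Z ^ (118 * ?r)"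
      by (simp only: power_divide times_divide_eq_right power_mult)
    also have "\<dots> \<le> ?mc * 2 ^ ?n / Z ^ (118 * ?r)"
      using mc Z rk_le [of c h] by (intro divide_right_mono mult_left_mono power_increasing) auto
    also have "\<dots> = (sqrt (?mc * 2 ^ ?n) / Z ^ (59 * ?r))\<^sup>2"
      using mc by (simp add: power_divide flip: power_mult)
    finally show "?mc * real H ^ ?r / real p ^ ?r \<le> (sqrt (?mc * 2 ^ ?n) / Z ^ (59 * ?r))\<^sup>2" .
  qed (use p mc Z in \<open>auto simp: prime_gt_0_nat\<close>)
  moreover have "kernel_weight c p h \<le> 1 / Z ^ (100 * ?r)" if p: "prime p" "Z ^ 200 < real p" "p \<notin> E" for p
  proof (rule kernel_weight_le [OF _ rk_le])
    have "card (kerq (int p) (hm c h)) \<le> p ^ (?n - ?r)"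
      using p \<Delta>(4) by (auto simp: E_def)
    then show "real (card (kerq (int p) (hm c h))) \<le> 1 * real p ^ (?n - ?r)"
      by (simp only: mult_1 of_nat_power [symmetric] of_nat_le_iff)
    have "1 / real p ^ ?r \<le> 1 / (Z ^ 200) ^ ?r"
      using p Z by (intro frac_le power_mono) auto
    also have "\<dots> = (1 / Z ^ (100 * ?r))\<^sup>2"
      by (simp add: power_divide flip: power_mult)
    finally show "1 / real p ^ ?r \<le> (1 / Z ^ (100 * ?r))\<^sup>2" .
  qed (use p Z in \<open>auto simp: prime_gt_0_nat\<close>)
  ultimately show ?thesis
    using E by blast
qed

lemma divide_le_divide_cross: "0 < b \<Longrightarrow> 0 < d \<Longrightarrow> a * d \<le> c * b \<Longrightarrow> a / b \<le> c / (d :: real)"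
  by (simp add: divide_simps mult.commute)

text \<open>Any saving of a fixed power of \<open>X = Z ^ 200\<close> suffices, since it decays
  geometrically along dyadic intervals. The large exponents merely make all quantities integral
  powers of \<open>Z\<close>.\<close>

lemma prime_average:
  fixes c :: "'n::finite \<Rightarrow> 'n \<Rightarrow> 'n \<Rightarrow> int"
  assumes n: "CARD('n) \<ge> 10" and c: "symmetric_coeffs c" and dav: "davenport_geometric c"
  shows "\<exists>C Z0. C > 0 \<and> (\<forall>Z\<ge>Z0. (\<Sum>p | prime p \<and> Z ^ 200 < real p \<and> real p \<le> 2 * Z ^ 200. sing_abs_term c p) \<le> C / Z ^ 4)"
proof -
  let ?n = "CARD('n)"
  obtain v where v: "det (hm c v) \<noteq> 0"
    using exists_nonsingular [OF dav] by blast
  obtain Cs where Cs: "Cs > 0" "\<And>H X. H \<ge> 1 \<Longrightarrow> X \<ge> Cs \<Longrightarrow> Cs * (real H)\<^sup>2 \<le> X \<Longrightarrow>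
    finite {(h, p). h \<in> diff_box H \<and> prime p \<and> X < real p \<and> det (hm c h) \<noteq> 0 \<and> card (kerq (int p) (hm c h)) > p ^ (?n - 7)} \<and>
    real (card {(h, p). h \<in> diff_box H \<and> prime p \<and> X < real p \<and> det (hm c h) \<noteq> 0 \<and> card (kerq (int p) (hm c h)) > p ^ (?n - 7)})
      \<le> Cs * real H ^ (?n - 1)"
    using special_count [OF n v] by blast
  \<comment> \<open>The loss \<open>H powr (1 / 41)\<close> is then at most
    \<open>2 * Z ^ 2\<close>, because \<open>82 / 41 = 2\<close>.\<close>
  obtain K where K: "K > 0" "\<And>\<rho> H. H > 0 \<Longrightarrow> real (card {h \<in> diff_box H. rk c h = \<rho>}) \<le> K * real H powr (real \<rho> + 1 / 41)"
    using davenport_uniform [OF dav, of "1 / 41"] by auto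
  define mc where "mc = minor_const c"
  have mc: "mc \<ge> 1"
    unfolding mc_def by (rule minor_const_ge_1)
  define Km where "Km = sqrt (mc * 2 ^ ?n)"
  have Km: "Km \<ge> 0"
    using mc by (simp add: Km_def)
  \<comment> \<open>The summands come from ranks below \<open>n\<close>, from full rank with small
    kernel, and from the exceptional pairs \<open>W\<close>.\<close>
  define C1 where "C1 = real ?n * (2 * K * (2 + real (?n + 1) * Km)) + 2 ^ ?n * (2 + real (?n + 1)) + Cs * Km"
  have C1: "C1 \<ge> 0"
    using K(1) Km Cs(1) by (simp add: C1_def)
  have "(\<Sum>p | prime p \<and> Z ^ 200 < real p \<and> real p \<le> 2 * Z ^ 200. sing_abs_term c p) \<le> (C1 + 2) / Z ^ 4"
    if Z0: "Z \<ge> 2 + mc + 4 * Cs" for Z :: real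
  proof -
    have Z: "Z \<ge> 2" "Z \<ge> mc" "Z \<ge> 4 * Cs" "Z \<ge> 1" "Z > 0"
      using Z0 mc Cs(1) by linarith+
    define X where "X = Z ^ 200"
    define H where "H = nat \<lceil>Z ^ 82\<rceil>"
    have Z82: "Z ^ 82 \<ge> 1"
      using Z by (intro one_le_power)
    have H: "Z ^ 82 \<le> real H" "real H \<le> 2 * Z ^ 82" "H > 0"
      using Z82 unfolding H_def by linarith+
    define P where "P = {p. prime p \<and> X < real p \<and> real p \<le> 2 * X}"
    have X1: "X \<ge> 1"
      unfolding X_def using Z by (intro one_le_power)
    have P_sub: "P \<subseteq> {1..nat \<lfloor>2 * X\<rfloor>}"
      unfolding P_def using X1 by (auto simp: le_nat_floor prime_ge_1_nat)
    then have finP: "finite P"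
      by (rule finite_subset) simp
    have cardP: "real (card P) \<le> 2 * X"
    proof -
      have "card P \<le> nat \<lfloor>2 * X\<rfloor>"
        using card_mono [OF _ P_sub] by simp
      then show ?thesis
        using X1 by linarith
    qed
    define W where "W = {(h, p). h \<in> diff_box H \<and> prime p \<and> X < real p \<and> det (hm c h) \<noteq> 0 \<and> card (kerq (int p) (hm c h)) > p ^ (?n - 7)}"
    have XCs: "X \<ge> Cs" "Cs * (real H)\<^sup>2 \<le> X"
    proof -
      have Z1: "Z \<le> Z ^ 36"
        using power_increasing [of 1 36 Z] Z by simp
      have "(real H)\<^sup>2 \<le> (2 * Z ^ 82)\<^sup>2"
        using H by (intro power_mono) auto
      also have "\<dots> = 4 * Z ^ 164"
        by (simp add: power_mult_distrib flip: power_mult)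
      finally have "Cs * (real H)\<^sup>2 \<le> Cs * (4 * Z ^ 164)"
        using Cs(1) by (intro mult_left_mono) auto
      also have "\<dots> = (4 * Cs) * Z ^ 164"
        by simp
      also have "\<dots> \<le> Z ^ 36 * Z ^ 164"
        using Z Z1 by (intro mult_right_mono) auto
      also have "\<dots> = X"
        by (simp add: X_def flip: power_add)
      finally show "Cs * (real H)\<^sup>2 \<le> X" .
      have "Z \<le> X"
        using power_increasing [of 1 200 Z] Z by (simp add: X_def)
      then show "X \<ge> Cs"
        using Z Cs(1) by linarith
    qed
    have W: "finite W" "real (card W) \<le> Cs * real H ^ (?n - 1)"
      unfolding W_def using Cs(2) [OF _ XCs] H(3) by auto
    \<comment> \<open>For full rank: all primes with the generic weight, plus the at most
      \<open>n + 1\<close> primes dividing the minor when the kernel has dimension at most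
      \<open>n - 7\<close>. The weight \<open>b\<close> is used only for the pairs in
      \<open>W\<close>.\<close>
    define a where "a = 2 * X / Z ^ (100 * ?n) + real (?n + 1) / Z ^ 700"
    define b where "b = Km / Z ^ (59 * ?n)"
    define F where "F \<rho> = 2 * X / Z ^ (100 * \<rho>) + real (?n + 1) * Km / Z ^ (59 * \<rho>)" for \<rho>
    define G where "G \<rho> = (if \<rho> < ?n then F \<rho> else a)" for \<rho>
    have b0: "b \<ge> 0"
      using Km Z by (simp add: b_def)
    have S: "(\<Sum>p\<in>P. kernel_weight c p h) \<le> G (rk c h) + real (card {p. (h, p) \<in> W}) * b" if h: "h \<in> diff_box H" for h
    proof -
      have mcZ: "minor_const c \<le> Z"
        using Z(2) by (simp only: mc_def)
      have "\<exists>E. finite E \<and> card E \<le> ?n + 1 \<and> (\<forall>p. prime p \<longrightarrow> X < real p \<longrightarrow>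
          kernel_weight c p h \<le> Km / Z ^ (59 * rk c h) \<and> (p \<notin> E \<longrightarrow> kernel_weight c p h \<le> 1 / Z ^ (100 * rk c h)))"
        unfolding X_def Km_def mc_def by (rule kernel_weight_by_rank [OF Z(1) mcZ H(1,2) h])
      then obtain E where E: "finite E" "card E \<le> ?n + 1"
        "\<And>p. prime p \<Longrightarrow> X < real p \<Longrightarrow> kernel_weight c p h \<le> Km / Z ^ (59 * rk c h)"
        "\<And>p. prime p \<Longrightarrow> X < real p \<Longrightarrow> p \<notin> E \<Longrightarrow> kernel_weight c p h \<le> 1 / Z ^ (100 * rk c h)"
        by blast
      have cE: "real (card (P \<inter> E)) \<le> real (?n + 1)"
        using card_mono [OF E(1), of "P \<inter> E"] E(2) by simp
      have split: "(\<Sum>p\<in>P. kernel_weight c p h) = (\<Sum>p\<in>P \<inter> E. kernel_weight c p h) + (\<Sum>p\<in>P - E. kernel_weight c p h)"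
        using sum.Int_Diff [OF finP] by blast
      have "(\<Sum>p\<in>P - E. kernel_weight c p h) \<le> (\<Sum>p\<in>P - E. 1 / Z ^ (100 * rk c h))"
        using E(4) by (intro sum_mono) (auto simp: P_def)
      also have "\<dots> = real (card (P - E)) * (1 / Z ^ (100 * rk c h))"
        by simp
      also have "\<dots> \<le> 2 * X * (1 / Z ^ (100 * rk c h))"
      proof (rule mult_right_mono)
        have "card (P - E) \<le> card P"
          using finP by (intro card_mono) auto
        then show "real (card (P - E)) \<le> 2 * X"
          using cardP by linarith
      qed (use Z in simp)
      finally have good: "(\<Sum>p\<in>P - E. kernel_weight c p h) \<le> 2 * X / Z ^ (100 * rk c h)"
        by simp
      show ?thesis
      proof (cases "rk c h < ?n")
        case True
        have "(\<Sum>p\<in>P \<inter> E. kernel_weight c p h) \<le> (\<Sum>p\<in>P \<inter> E. Km / Z ^ (59 * rk c h))"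
          using E(3) by (intro sum_mono) (auto simp: P_def)
        also have "\<dots> = real (card (P \<inter> E)) * (Km / Z ^ (59 * rk c h))"
          by simp
        also have "\<dots> \<le> real (?n + 1) * (Km / Z ^ (59 * rk c h))"
          using Km Z by (intro mult_right_mono [OF cE]) auto
        finally have "(\<Sum>p\<in>P \<inter> E. kernel_weight c p h) \<le> real (?n + 1) * Km / Z ^ (59 * rk c h)"
          by simp
        moreover have "real (card {p. (h, p) \<in> W}) * b \<ge> 0"
          using b0 by simp
        moreover have "G (rk c h) = F (rk c h)"
          using True by (simp only: G_def if_True)
        ultimately show ?thesis
          using split good unfolding F_def by linarith
      next
        case False
        then have r: "rk c h = ?n"
          using rk_le [of c h] by simp
        then have d: "det (hm c h) \<noteq> 0"
          using det_eq_0_rank [of "real_mat (hm c h)"] by (simp add: rk_eq det_real_mat)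
        have "kernel_weight c p h \<le> 1 / Z ^ 700 + of_bool ((h, p) \<in> W) * b" if p: "p \<in> P \<inter> E" for p
        proof (cases "(h, p) \<in> W")
          case True
          have "kernel_weight c p h \<le> b"
            using E(3) p by (simp add: P_def b_def r)
          then show ?thesis
            using True Z by (simp add: add_increasing)
        next
          case False
          have "kernel_weight c p h \<le> 1 / Z ^ 700"
          proof (rule kernel_weight_le [where m=7])
            have "card (kerq (int p) (hm c h)) \<le> p ^ (?n - 7)"
              using False p d h by (auto simp: W_def P_def)
            then show "real (card (kerq (int p) (hm c h))) \<le> 1 * real p ^ (?n - 7)"
              by (simp only: mult_1 of_nat_power [symmetric] of_nat_le_iff)
            have "1 / real p ^ 7 \<le> 1 / X ^ 7"
              using p X1 by (intro frac_le power_mono) (auto simp: P_def)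
            also have "\<dots> = (1 / Z ^ 700)\<^sup>2"
              by (simp add: X_def power_divide flip: power_mult)
            finally show "1 / real p ^ 7 \<le> (1 / Z ^ 700)\<^sup>2" .
          qed (use n p Z in \<open>auto simp: P_def prime_gt_0_nat\<close>)
          then show ?thesis
            using False by simp
        qed
        then have "(\<Sum>p\<in>P \<inter> E. kernel_weight c p h) \<le> (\<Sum>p\<in>P \<inter> E. 1 / Z ^ 700 + of_bool ((h, p) \<in> W) * b)"
          by (rule sum_mono)
        also have "\<dots> = real (card (P \<inter> E)) * (1 / Z ^ 700) + (\<Sum>p\<in>P \<inter> E. of_bool ((h, p) \<in> W)) * b"
          by (simp only: sum.distrib sum_distrib_right sum_constant)
        also have "(\<Sum>p\<in>P \<inter> E. of_bool ((h, p) \<in> W)) = real (card (P \<inter> E \<inter> {p. (h, p) \<in> W}))"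
          using finP by (subst sum_of_bool_eq) simp_all
        also have "real (card (P \<inter> E)) * (1 / Z ^ 700) + real (card (P \<inter> E \<inter> {p. (h, p) \<in> W})) * b
          \<le> real (?n + 1) * (1 / Z ^ 700) + real (card {p. (h, p) \<in> W}) * b"
        proof (intro add_mono mult_right_mono cE b0)
          have "{p. (h, p) \<in> W} \<subseteq> snd ` W"
            by force
          then have "finite {p. (h, p) \<in> W}"
            using W(1) finite_subset by blast
          then have "card (P \<inter> E \<inter> {p. (h, p) \<in> W}) \<le> card {p. (h, p) \<in> W}"
            by (rule card_mono) auto
          then show "real (card (P \<inter> E \<inter> {p. (h, p) \<in> W})) \<le> real (card {p. (h, p) \<in> W})"
            by simp
        qed (use Z in simp)
        finally have "(\<Sum>p\<in>P \<inter> E. kernel_weight c p h) \<le> real (?n + 1) / Z ^ 700 + real (card {p. (h, p) \<in> W}) * b"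
          by simp
        moreover have "G (rk c h) = a"
          by (simp add: G_def r)
        ultimately show ?thesis
          using split good unfolding a_def r by linarith
      qed
    qed
    have cnt: "real (card {h \<in> diff_box H. rk c h = \<rho>}) * G \<rho> \<le> real H ^ ?n * (2 * K * (2 + real (?n + 1) * Km) / Z ^ 610)" if \<rho>: "\<rho> < ?n" for \<rho>
    proof -
      have "real H powr (1 / 41) \<le> (2 * Z ^ 82) powr (1 / 41)"
        using H by (intro powr_mono2) auto
      also have "\<dots> = 2 powr (1 / 41) * (Z ^ 82) powr (1 / 41)"
        using Z by (intro powr_mult)
      also have "(Z ^ 82) powr (1 / 41) = Z ^ 2"
      proof -
        have "(Z powr real 82) powr (1 / 41) = Z powr real 2"
          by (simp only: powr_powr) simp
        then show ?thesis
          unfolding powr_realpow [OF Z(5)] .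
      qed
      also have "2 powr (1 / 41) * Z ^ 2 \<le> 2 powr 1 * Z ^ 2"
        by (intro mult_right_mono powr_mono) auto
      finally have He: "real H powr (1 / 41) \<le> 2 * Z ^ 2"
        by simp
      have "real (card {h \<in> diff_box H. rk c h = \<rho>}) \<le> K * (real H ^ \<rho> * real H powr (1 / 41))"
        using K(2) [OF H(3), of \<rho>] H(3) by (simp add: powr_add powr_realpow)
      also have "\<dots> \<le> K * (real H ^ \<rho> * (2 * Z ^ 2))"
        using K(1) He by (intro mult_left_mono) auto
      finally have "real (card {h \<in> diff_box H. rk c h = \<rho>}) * F \<rho> \<le> K * (real H ^ \<rho> * (2 * Z ^ 2)) * F \<rho>"
        using Km Z X1 by (intro mult_right_mono) (auto simp: F_def)
      also have "\<dots> = 2 * K * real H ^ \<rho> * (2 * (Z ^ 202 / Z ^ (100 * \<rho>)) + real (?n + 1) * Km * (Z ^ 2 / Z ^ (59 * \<rho>)))"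
      proof -
        have "Z ^ 2 * F \<rho> = 2 * (Z ^ 202 / Z ^ (100 * \<rho>)) + real (?n + 1) * Km * (Z ^ 2 / Z ^ (59 * \<rho>))"
        proof -
          have "Z ^ 202 = Z ^ 2 * Z ^ 200"
            by (simp flip: power_add)
          then show ?thesis
            unfolding F_def X_def distrib_left by (simp only: times_divide_eq_right mult_ac)
        qed
        moreover have "K * (real H ^ \<rho> * (2 * Z ^ 2)) * F \<rho> = 2 * K * real H ^ \<rho> * (Z ^ 2 * F \<rho>)"
          by (simp only: mult_ac)
        ultimately show ?thesis
          by (simp only:)
      qed
      also have "\<dots> \<le> 2 * K * real H ^ \<rho> * (2 * (real H ^ (?n - \<rho>) / Z ^ 610) + real (?n + 1) * Km * (real H ^ (?n - \<rho>) / Z ^ 610))"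
      proof (intro mult_left_mono add_mono)
        have low: "Z ^ (82 * (?n - \<rho>)) \<le> real H ^ (?n - \<rho>)"
          unfolding power_mult using H(1) Z by (intro power_mono) auto
        \<comment> \<open>Here \<open>812 = 202 + 610\<close>, with \<open>202\<close> made up of
          the number of primes and the loss \<open>Z ^ 2\<close>. The exponent on the right is
          smallest at rank 0, where it is at least \<open>820\<close>.\<close>
        have "Z ^ 812 \<le> Z ^ (82 * (?n - \<rho>) + 100 * \<rho>)"
          using \<rho> n Z by (intro power_increasing) auto
        also have "\<dots> \<le> real H ^ (?n - \<rho>) * Z ^ (100 * \<rho>)"
          unfolding power_add using low Z by (intro mult_right_mono) auto
        finally have "Z ^ 812 \<le> real H ^ (?n - \<rho>) * Z ^ (100 * \<rho>)" .
        then show "Z ^ 202 / Z ^ (100 * \<rho>) \<le> real H ^ (?n - \<rho>) / Z ^ 610"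
          using Z by (intro divide_le_divide_cross) (auto simp flip: power_add)
        \<comment> \<open>Here \<open>612 = 2 + 610\<close>. The exponent on the right is smallest
          at \<open>\<rho> = n - 1\<close>, where it is at least \<open>82 + 59 * 9 = 613\<close>;
          full rank would fall short.\<close>
        have "Z ^ 612 \<le> Z ^ (82 * (?n - \<rho>) + 59 * \<rho>)"
          using \<rho> n Z by (intro power_increasing) auto
        also have "\<dots> \<le> real H ^ (?n - \<rho>) * Z ^ (59 * \<rho>)"
          unfolding power_add using low Z by (intro mult_right_mono) auto
        finally have "Z ^ 612 \<le> real H ^ (?n - \<rho>) * Z ^ (59 * \<rho>)" .
        then show "Z ^ 2 / Z ^ (59 * \<rho>) \<le> real H ^ (?n - \<rho>) / Z ^ 610"
          using Z by (intro divide_le_divide_cross) (auto simp flip: power_add)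
      qed (use K(1) Km in auto)
      also have "\<dots> = (real H ^ \<rho> * real H ^ (?n - \<rho>)) * (2 * K * (2 + real (?n + 1) * Km) / Z ^ 610)"
        by (simp add: algebra_simps add_divide_distrib)
      also have "real H ^ \<rho> * real H ^ (?n - \<rho>) = real H ^ ?n"
        using \<rho> by (simp flip: power_add)
      finally show ?thesis
        using \<rho> by (simp only: G_def if_True)
    qed
    have cnt_n: "real (card {h \<in> diff_box H. rk c h = ?n}) * G ?n \<le> real H ^ ?n * (2 ^ ?n * (2 + real (?n + 1)) / Z ^ 610)"
    proof -
      have "X / Z ^ (100 * ?n) \<le> 1 / Z ^ 610"
      proof (rule divide_le_divide_cross)
        have "Z ^ (200 + 610) \<le> Z ^ (100 * ?n)"
          using n Z by (intro power_increasing) auto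
        then show "X * Z ^ 610 \<le> 1 * Z ^ (100 * ?n)"
          by (simp only: X_def power_add mult_1)
      qed (use Z in auto)
      moreover have "1 / Z ^ 700 \<le> 1 / Z ^ 610"
        using Z by (intro frac_le power_increasing) auto
      then have "real (?n + 1) * (1 / Z ^ 700) \<le> real (?n + 1) * (1 / Z ^ 610)"
        by (rule mult_left_mono) simp
      ultimately have a: "a \<le> (2 + real (?n + 1)) / Z ^ 610"
        unfolding a_def by (simp add: add_divide_distrib)
      have "card {h \<in> diff_box H. rk c h = ?n} \<le> card (diff_box H :: (int^'n) set)"
        by (rule card_mono) auto
      also have "\<dots> \<le> (2 * H) ^ ?n"
        by (rule card_diff_box_le)
      finally have "real (card {h \<in> diff_box H. rk c h = ?n}) \<le> real ((2 * H) ^ ?n)"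
        by (simp only: of_nat_le_iff)
      then have "real (card {h \<in> diff_box H. rk c h = ?n}) * a \<le> (2 * real H) ^ ?n * ((2 + real (?n + 1)) / Z ^ 610)"
        using a Z X1 by (intro mult_mono) (auto simp: a_def)
      then show ?thesis
        by (simp add: G_def power_mult_distrib mult_ac)
    qed
    have "(\<Sum>h\<in>diff_box H. \<Sum>p\<in>P. kernel_weight c p h) \<le> (\<Sum>h\<in>diff_box H. G (rk c h) + real (card {p. (h, p) \<in> W}) * b)"
      by (rule sum_mono) (rule S)
    also have "\<dots> = (\<Sum>\<rho>\<le>?n. real (card {h \<in> diff_box H. rk c h = \<rho>}) * G \<rho>) + (\<Sum>h\<in>diff_box H. real (card {p. (h, p) \<in> W})) * b"
      by (simp only: sum.distrib sum_diff_box_by_rank sum_distrib_right)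
    also have "(\<Sum>\<rho>\<le>?n. real (card {h \<in> diff_box H. rk c h = \<rho>}) * G \<rho>) =
      (\<Sum>\<rho><?n. real (card {h \<in> diff_box H. rk c h = \<rho>}) * G \<rho>) + real (card {h \<in> diff_box H. rk c h = ?n}) * G ?n"
      by (simp only: lessThan_Suc_atMost [symmetric] sum.lessThan_Suc)
    also have "(\<Sum>h\<in>diff_box H. real (card {p. (h, p) \<in> W})) = real (card W)"
    proof -
      have "W = (SIGMA h:diff_box H. {p. (h, p) \<in> W})"
        by (auto simp: W_def)
      moreover have "finite {p. (h, p) \<in> W}" for h
        by (rule finite_subset [of _ "snd ` W"]) (use W(1) in force)+
      ultimately have "card W = (\<Sum>h\<in>diff_box H. card {p. (h, p) \<in> W})"
        using card_SigmaI [of "diff_box H" "\<lambda>h. {p. (h, p) \<in> W}"] by simp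
      then show ?thesis
        by simp
    qed
    also have "(\<Sum>\<rho><?n. real (card {h \<in> diff_box H. rk c h = \<rho>}) * G \<rho>) + real (card {h \<in> diff_box H. rk c h = ?n}) * G ?n + real (card W) * b
      \<le> (\<Sum>\<rho><?n. real H ^ ?n * (2 * K * (2 + real (?n + 1) * Km) / Z ^ 610)) + real H ^ ?n * (2 ^ ?n * (2 + real (?n + 1)) / Z ^ 610)
        + real H ^ ?n * (Cs * Km / Z ^ 610)"
    proof (intro add_mono cnt_n)
      show "(\<Sum>\<rho><?n. real (card {h \<in> diff_box H. rk c h = \<rho>}) * G \<rho>) \<le> (\<Sum>\<rho><?n. real H ^ ?n * (2 * K * (2 + real (?n + 1) * Km) / Z ^ 610))"
        by (intro sum_mono cnt) auto
      have "real (card W) * b \<le> Cs * real H ^ (?n - 1) * b"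
        by (rule mult_right_mono [OF W(2) b0])
      also have "\<dots> = real H ^ (?n - 1) * (Cs * Km) * (1 / Z ^ (59 * ?n))"
        by (simp add: b_def)
      also have "\<dots> \<le> real H ^ (?n - 1) * (Cs * Km) * (real H / Z ^ 610)"
      proof (rule mult_left_mono [OF divide_le_divide_cross])
        \<comment> \<open>For exceptional pairs the missing factor \<open>H\<close> in their number
          supplies the exponent \<open>82\<close> that the weight \<open>59 * n\<close>
          lacks.\<close>
        have "Z ^ 610 \<le> Z ^ (82 + 59 * ?n)"
          using n Z by (intro power_increasing) auto
        also have "\<dots> \<le> real H * Z ^ (59 * ?n)"
          unfolding power_add using H Z by (intro mult_right_mono) auto
        finally show "1 * Z ^ 610 \<le> real H * Z ^ (59 * ?n)"
          by simp
      qed (use Z Cs(1) Km in auto)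
      also have "\<dots> = (real H ^ (?n - 1) * real H) * (Cs * Km / Z ^ 610)"
        by simp
      also have "real H ^ (?n - 1) * real H = real H ^ ?n"
        using power_minus_mult [of ?n "real H"] by simp
      finally show "real (card W) * b \<le> real H ^ ?n * (Cs * Km / Z ^ 610)" .
    qed
    also have "\<dots> = real H ^ ?n * (C1 / Z ^ 610)"
      unfolding C1_def add_divide_distrib distrib_left sum_constant card_lessThan
      by (simp only: times_divide_eq_right mult_ac)
    finally have total: "(\<Sum>h\<in>diff_box H. \<Sum>p\<in>P. kernel_weight c p h) \<le> real H ^ ?n * (C1 / Z ^ 610)" .
    define V where "V p = (\<Sum>h\<in>diff_box H. kernel_weight c p h) / real H ^ ?n" for p
    have V0: "V p \<ge> 0" for p
      unfolding V_def by (intro divide_nonneg_nonneg sum_nonneg kernel_weight_nonneg) auto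
    have "(\<Sum>p\<in>P. V p) = (\<Sum>h\<in>diff_box H. \<Sum>p\<in>P. kernel_weight c p h) / real H ^ ?n"
      unfolding V_def sum_divide_distrib [symmetric] by (subst sum.swap) (rule refl)
    also have "\<dots> \<le> real H ^ ?n * (C1 / Z ^ 610) / real H ^ ?n"
      by (rule divide_right_mono [OF total]) simp
    also have "\<dots> = C1 / Z ^ 610"
      using H(3) by simp
    finally have VP: "(\<Sum>p\<in>P. V p) \<le> C1 / Z ^ 610" .
    have A: "sing_abs_term c p \<le> Z ^ 604 * V p + 1 / Z ^ 204" if p: "p \<in> P" for p
    proof -
      have p': "p > 0" "real p \<le> 2 * X"
        using p by (auto simp: P_def prime_gt_0_nat)
      have "sing_abs_term c p \<le> real p * sqrt (V p)"
        unfolding V_def by (rule sing_abs_term_prime_le [OF c p'(1) H(3)])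
      also have "\<dots> \<le> 2 * X * sqrt (V p)"
        using p' V0 by (intro mult_right_mono) auto
      \<comment> \<open>The factorisation of \<open>2 * X\<close> balances the two squares: summed
        over the primes, the first gives \<open>Z ^ (604 - 610)\<close> and the second about
        \<open>Z ^ (200 - 204)\<close>.\<close>
      also have "\<dots> = 2 * (Z ^ 302 * sqrt (V p)) * (1 / Z ^ 102)"
        using Z by (simp add: X_def field_simps)
      also have "\<dots> \<le> (Z ^ 302 * sqrt (V p))\<^sup>2 + (1 / Z ^ 102)\<^sup>2"
        by (rule sum_squares_bound)
      also have "\<dots> = Z ^ 604 * V p + 1 / Z ^ 204"
        using V0 by (simp add: power_mult_distrib power_divide flip: power_mult)
      finally show ?thesis .
    qed
    have "(\<Sum>p\<in>P. sing_abs_term c p) \<le> (\<Sum>p\<in>P. Z ^ 604 * V p + 1 / Z ^ 204)"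
      by (rule sum_mono) (rule A)
    also have "\<dots> = Z ^ 604 * (\<Sum>p\<in>P. V p) + real (card P) * (1 / Z ^ 204)"
      by (simp add: sum.distrib sum_distrib_left)
    also have "\<dots> \<le> Z ^ 604 * (C1 / Z ^ 610) + 2 * X * (1 / Z ^ 204)"
      using Z by (intro add_mono mult_left_mono VP mult_right_mono cardP) auto
    also have "\<dots> = C1 / Z ^ 6 + 2 / Z ^ 4"
      using Z by (simp add: X_def field_simps)
    also have "\<dots> \<le> C1 / Z ^ 4 + 2 / Z ^ 4"
      using C1 Z by (intro add_mono divide_left_mono power_increasing) auto
    finally show ?thesis
      unfolding P_def X_def by (simp add: add_divide_distrib)
  qed
  then show ?thesis
    using C1 by (intro exI [of _ "C1 + 2"] exI [of _ "2 + mc + 4 * Cs"]) auto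
qed

section \<open>Convergence and positivity\<close>

lemma finite_primes_le: "finite {p :: nat. prime p \<and> real p \<le> x}"
  by (rule finite_subset [of _ "{..nat \<lfloor>x\<rfloor>}"]) (auto simp: le_nat_floor)

lemma dyadic_bound:
  fixes g :: "nat \<Rightarrow> real"
  assumes g: "\<And>p. g p \<ge> 0" and C: "C > 0"
    and dyadic: "\<And>Z. Z \<ge> Z0 \<Longrightarrow> (\<Sum>p | prime p \<and> Z ^ 200 < real p \<and> real p \<le> 2 * Z ^ 200. g p) \<le> C / Z ^ 4"
  shows "\<exists>B. \<forall>N. (\<Sum>p | prime p \<and> p \<le> N. g p) \<le> B"
proof -
  \<comment> \<open>With this \<open>z\<close> the dyadic points \<open>X = 2 ^ j\<close> are the
    values \<open>Z ^ 200\<close> at \<open>Z = z ^ j\<close>, and the bounds form a geometric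
    series of ratio \<open>z ^ (- 4)\<close>.\<close>
  define z :: real where "z = root 200 2"
  have z: "z > 1" "z ^ 200 = 2"
    by (simp_all add: z_def)
  obtain J where J: "Z0 < z ^ J"
    using real_arch_pow [OF z(1)] by blast
  define S where "S x = (\<Sum>p | prime p \<and> real p \<le> x. g p)" for x
  define y where "y = 1 / z ^ 4"
  have y: "0 \<le> y" "y < 1"
    using z(1) by (auto simp: y_def)
  have S: "S (2 ^ (J + M)) \<le> S (2 ^ J) + (\<Sum>j<M. C * y ^ j)" for M
  proof (induction M)
    case (Suc M)
    define Z where "Z = z ^ (J + M)"
    have Z200: "Z ^ 200 = 2 ^ (J + M)"
      unfolding Z_def power_mult [symmetric] mult.commute [of "J + M"] unfolding power_mult z(2) ..
    have "{p :: nat. prime p \<and> real p \<le> 2 ^ (J + Suc M)} = {p. prime p \<and> real p \<le> 2 ^ (J + M)} \<union>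
        {p. prime p \<and> 2 ^ (J + M) < real p \<and> real p \<le> 2 * 2 ^ (J + M)}"
    proof -
      have "{p :: nat. prime p \<and> real p \<le> 2 * x} = {p. prime p \<and> real p \<le> x} \<union> {p. prime p \<and> x < real p \<and> real p \<le> 2 * x}"
        if "x \<ge> 0" for x
        using that by auto
      from this [of "2 ^ (J + M)"] show ?thesis
        by (simp only: add_Suc_right power_Suc zero_le_power zero_le_numeral simp_thms)
    qed
    moreover have "finite {p :: nat. prime p \<and> 2 ^ (J + M) < real p \<and> real p \<le> 2 * 2 ^ (J + M)}"
      by (rule finite_subset [OF _ finite_primes_le [of "2 * 2 ^ (J + M)"]]) auto
    ultimately have "S (2 ^ (J + Suc M)) = S (2 ^ (J + M)) + (\<Sum>p | prime p \<and> 2 ^ (J + M) < real p \<and> real p \<le> 2 * 2 ^ (J + M). g p)"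
      unfolding S_def by (simp only:) (intro sum.union_disjoint finite_primes_le; auto)
    moreover have "Z \<ge> Z0"
      using J power_increasing [of J "J + M" z] z(1) unfolding Z_def by linarith
    then have "(\<Sum>p | prime p \<and> 2 ^ (J + M) < real p \<and> real p \<le> 2 * 2 ^ (J + M). g p) \<le> C / Z ^ 4"
      by (rule dyadic [of Z, unfolded Z200])
    moreover have "C / Z ^ 4 \<le> C * y ^ M"
    proof -
      have "z ^ (4 * M) \<le> z ^ ((J + M) * 4)"
        using z(1) by (intro power_increasing) auto
      then have "C / z ^ ((J + M) * 4) \<le> C / z ^ (4 * M)"
        using z(1) C by (intro divide_left_mono) auto
      then show ?thesis
        by (simp only: Z_def y_def power_mult power_divide power_one times_divide_eq_right mult_1_right)
    qed
    ultimately show ?case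
      using Suc by simp
  qed simp
  have geo: "(\<Sum>j<M. C * y ^ j) \<le> (\<Sum>j. C * y ^ j)" for M
    using y C by (intro sum_le_suminf summable_mult summable_geometric) auto
  have "(\<Sum>p | prime p \<and> p \<le> N. g p) \<le> S (2 ^ J) + (\<Sum>j. C * y ^ j)" for N
  proof -
    have "real N \<le> 2 ^ N"
      using of_nat_less_two_power [of N, where 'a=real] by simp
    also have "\<dots> \<le> 2 ^ (J + N)"
      by (rule power_increasing) auto
    finally have N: "real N \<le> 2 ^ (J + N)" .
    have "(\<Sum>p | prime p \<and> p \<le> N. g p) \<le> S (2 ^ (J + N))"
      unfolding S_def
    proof (rule sum_mono2 [OF finite_primes_le])
      show "{p. prime p \<and> p \<le> N} \<subseteq> {p :: nat. prime p \<and> real p \<le> 2 ^ (J + N)}"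
      proof clarify
        fix p assume "p \<le> N"
        then have "real p \<le> real N"
          by simp
        then show "real p \<le> 2 ^ (J + N)"
          using N by linarith
      qed
    qed (rule g)
    then show ?thesis
      using S [of N] geo [of N] by linarith
  qed
  then show ?thesis
    by blast
qed

lemma of_nat_power_powr: "real (p ^ k) powr s = (real p powr s) ^ k" if "p > 0"
  using that by (induction k) (simp_all add: powr_mult)

lemma powr_prime_le: "real p powr (- 3 / 5) \<le> 2 powr (- 3 / 5)" if "prime p"
  using prime_ge_2_nat [OF that] by (intro powr_mono2') auto

lemma two_powr_less_1: "2 powr (- 3 / 5) < (1 :: real)"
  by (intro powr_less_one) auto

text \<open>The pointwise bound sums from \<open>p ^ 2\<close> on to a multiple of
  \<open>p powr (- 6 / 5)\<close>, which is summable over \<open>p\<close>. The term at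
  \<open>p\<close> itself is kept, to be handled on average.\<close>

lemma prime_powers_summable:
  fixes g :: "nat \<Rightarrow> real"
  assumes g: "\<And>q. g q \<ge> 0" and p: "prime p" and K: "\<And>k. g (p ^ k) \<le> K * real (p ^ k) powr (- 3 / 5)"
  shows "summable (\<lambda>k. g (p ^ k))"
    and "(\<Sum>k. g (p ^ Suc k)) \<le> g p + K / (1 - 2 powr (- 3 / 5)) * real p powr (- 6 / 5)"
proof -
  define x where "x = real p powr (- 3 / 5)"
  have p0: "p > 0"
    using p by (simp add: prime_gt_0_nat)
  have x: "0 \<le> x" "x \<le> 2 powr (- 3 / 5)" "x < 1"
    using powr_prime_le [OF p] two_powr_less_1 unfolding x_def by (simp, linarith+)
  have gx: "g (p ^ k) \<le> K * x ^ k" for k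
    using K [of k] unfolding of_nat_power_powr [OF p0] x_def .
  have K0: "K \<ge> 0"
    using gx [of 0] g [of "p ^ 0"] by simp
  have geo: "summable (\<lambda>k. K * x ^ k)"
    using x by (intro summable_mult summable_geometric) auto
  show sm: "summable (\<lambda>k. g (p ^ k))"
    by (rule summable_comparison_test' [OF geo, of 0]) (use g gx in auto)
  have sm1: "summable (\<lambda>k. g (p ^ Suc k))"
    using sm summable_Suc_iff [of "\<lambda>k. g (p ^ k)"] by simp
  have sm2: "summable (\<lambda>k. g (p ^ Suc (Suc k)))"
    using sm1 summable_Suc_iff [of "\<lambda>k. g (p ^ Suc k)"] by simp
  have "(\<Sum>k. g (p ^ Suc (Suc k))) \<le> (\<Sum>k. K * x ^ 2 * x ^ k)"
  proof (rule suminf_le [OF _ sm2])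
    show "g (p ^ Suc (Suc k)) \<le> K * x ^ 2 * x ^ k" for k
      using gx [of "Suc (Suc k)"] by (simp add: power2_eq_square mult.assoc)
    show "summable (\<lambda>k. K * x ^ 2 * x ^ k)"
      using x by (intro summable_mult summable_geometric) auto
  qed
  also have "\<dots> = K * x ^ 2 / (1 - x)"
    using x by (subst suminf_mult) (auto simp: suminf_geometric)
  also have "\<dots> \<le> K * x ^ 2 / (1 - 2 powr (- 3 / 5))"
    using x K0 two_powr_less_1 by (intro divide_left_mono) auto
  also have "x ^ 2 = real p powr (- 6 / 5)"
    unfolding x_def by (simp add: power2_eq_square flip: powr_add)
  finally have "(\<Sum>k. g (p ^ Suc (Suc k))) \<le> K * real p powr (- 6 / 5) / (1 - 2 powr (- 3 / 5))" .
  moreover have "(\<Sum>k. g (p ^ Suc k)) = g p + (\<Sum>k. g (p ^ Suc (Suc k)))"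
    using suminf_split_head [OF sm1] by simp
  ultimately show "(\<Sum>k. g (p ^ Suc k)) \<le> g p + K / (1 - 2 powr (- 3 / 5)) * real p powr (- 6 / 5)"
    by simp
qed

lemma sing_abs_term_primes:
  fixes c :: "'n::finite \<Rightarrow> 'n \<Rightarrow> 'n \<Rightarrow> int"
  assumes n: "CARD('n) \<ge> 10" and c: "symmetric_coeffs c" and dav: "davenport_geometric c"
  shows "prime p \<Longrightarrow> summable (\<lambda>k. sing_abs_term c (p ^ k))"
    and "\<exists>B. \<forall>N. (\<Sum>p | prime p \<and> p \<le> N. \<Sum>k. sing_abs_term c (p ^ Suc k)) \<le> B"
proof -
  let ?g = "sing_abs_term c"
  obtain K where K: "K > 0" "\<And>p k. prime p \<Longrightarrow> ?g (p ^ k) \<le> K * real (p ^ k) powr (- 3 / 5)"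
    using sing_abs_term_prime_power_bound [OF n c dav] by blast
  show "summable (\<lambda>k. ?g (p ^ k))" if "prime p"
    by (rule prime_powers_summable(1) [OF sing_abs_term_nonneg that K(2) [OF that]])
  define K' where "K' = K / (1 - 2 powr (- 3 / 5))"
  have K': "K' \<ge> 0"
    using K(1) two_powr_less_1 by (simp add: K'_def)
  obtain C Z0 where "C > 0" "\<And>Z. Z \<ge> Z0 \<Longrightarrow> (\<Sum>p | prime p \<and> Z ^ 200 < real p \<and> real p \<le> 2 * Z ^ 200. ?g p) \<le> C / Z ^ 4"
    using prime_average [OF n c dav] by blast
  from dyadic_bound [OF sing_abs_term_nonneg this]
  obtain B where B: "\<And>N. (\<Sum>p | prime p \<and> p \<le> N. ?g p) \<le> B"
    by blast
  have sm: "summable (\<lambda>p :: nat. real p powr (- 6 / 5))"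
    by (simp add: summable_real_powr_iff)
  have "(\<Sum>p | prime p \<and> p \<le> N. \<Sum>k. ?g (p ^ Suc k)) \<le> B + K' * (\<Sum>p. real p powr (- 6 / 5))" for N
  proof -
    have fin: "finite {p. prime p \<and> p \<le> N}"
      by (rule finite_subset [of _ "{..N}"]) auto
    have "(\<Sum>p | prime p \<and> p \<le> N. \<Sum>k. ?g (p ^ Suc k)) \<le> (\<Sum>p | prime p \<and> p \<le> N. ?g p + K' * real p powr (- 6 / 5))"
      unfolding K'_def
      by (rule sum_mono) (blast intro: prime_powers_summable(2) [OF sing_abs_term_nonneg _ K(2)])
    also have "\<dots> = (\<Sum>p | prime p \<and> p \<le> N. ?g p) + K' * (\<Sum>p | prime p \<and> p \<le> N. real p powr (- 6 / 5))"
      by (simp only: sum.distrib sum_distrib_left)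
    also have "\<dots> \<le> B + K' * (\<Sum>p. real p powr (- 6 / 5))"
      by (intro add_mono B mult_left_mono K' sum_le_suminf [OF sm fin]) auto
    finally show ?thesis .
  qed
  then show "\<exists>B. \<forall>N. (\<Sum>p | prime p \<and> p \<le> N. \<Sum>k. ?g (p ^ Suc k)) \<le> B"
    by blast
qed

text \<open>Beyond some \<open>M\<close> the sum of the \<open>t p\<close> is at most
  \<open>1 / 2\<close>, and the Weierstrass product inequality keeps the corresponding partial
  product at least \<open>1 / 2\<close>. The finite head is positive because every factor
  is.\<close>

lemma prime_product_limit_pos:
  fixes r t :: "nat \<Rightarrow> real"
  assumes r: "\<And>p. prime p \<Longrightarrow> r p > 0" and t: "\<And>p. prime p \<Longrightarrow> t p \<ge> 0" "\<And>p. prime p \<Longrightarrow> r p \<ge> 1 - t p"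
    and B: "\<And>N. (\<Sum>p | prime p \<and> p \<le> N. t p) \<le> B"
    and lim: "(\<lambda>N. \<Prod>p | prime p \<and> p \<le> N. r p) \<longlonglongrightarrow> L"
  shows "L > 0"
proof -
  define P where "P N = {p :: nat. prime p \<and> p \<le> N}" for N
  define T where "T N = (\<Sum>p\<in>P N. t p)" for N
  have fin: "finite (P N)" for N
    unfolding P_def by (rule finite_subset [of _ "{..N}"]) auto
  have "mono T"
    unfolding mono_def T_def by (intro allI impI sum_mono2 fin) (use t(1) in \<open>auto simp: P_def\<close>)
  moreover have "T N \<le> B" for N
    using B unfolding T_def P_def .
  ultimately obtain l where l: "T \<longlonglongrightarrow> l" "\<And>N. T N \<le> l"
    using incseq_convergent [of T B] by blast
  then have "\<forall>\<^sub>F N in sequentially. l - 1 / 2 < T N"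
    by (intro order_tendstoD(1)) auto
  then obtain M where M: "l - 1 / 2 < T M"
    using eventually_happens trivial_limit_sequentially by blast
  have "(\<Prod>p\<in>P M. r p) * (1 / 2) \<le> (\<Prod>p\<in>P N. r p)" if N: "N \<ge> M" for N
  proof -
    have sub: "P M \<subseteq> P N"
      using N by (auto simp: P_def)
    have "T N = (\<Sum>p\<in>P N - P M. t p) + T M"
      unfolding T_def by (rule sum.subset_diff [OF sub fin])
    then have small: "(\<Sum>p\<in>P N - P M. t p) \<le> 1 / 2"
      using M l(2) [of N] by linarith
    have t1: "t p \<in> {0..1}" if p: "p \<in> P N - P M" for p
    proof -
      have "t p \<le> (\<Sum>p\<in>P N - P M. t p)"
        using p fin t(1) by (intro member_le_sum) (auto simp: P_def)
      then show ?thesis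
        using small p t(1) by (simp add: P_def)
    qed
    have "1 / 2 \<le> 1 - (\<Sum>p\<in>P N - P M. t p)"
      using small by simp
    also have "\<dots> \<le> (\<Prod>p\<in>P N - P M. 1 - t p)"
      by (rule Weierstrass_prod_ineq) (use t1 in auto)
    also have "\<dots> \<le> (\<Prod>p\<in>P N - P M. r p)"
    proof (rule prod_mono)
      fix p assume p: "p \<in> P N - P M"
      then show "0 \<le> 1 - t p \<and> 1 - t p \<le> r p"
        using t1 [OF p] t(2) by (auto simp: P_def)
    qed
    finally have "1 / 2 \<le> (\<Prod>p\<in>P N - P M. r p)" .
    then have "(\<Prod>p\<in>P M. r p) * (1 / 2) \<le> (\<Prod>p\<in>P M. r p) * (\<Prod>p\<in>P N - P M. r p)"
      using r by (intro mult_left_mono prod_nonneg) (auto simp: P_def less_imp_le)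
    also have "\<dots> = (\<Prod>p\<in>P N. r p)"
      using prod.subset_diff [OF sub fin, of r] by (simp add: mult.commute)
    finally show ?thesis .
  qed
  moreover have "(\<lambda>N. \<Prod>p\<in>P N. r p) \<longlonglongrightarrow> L"
    using lim unfolding P_def .
  ultimately have "(\<Prod>p\<in>P M. r p) * (1 / 2) \<le> L"
    by (intro LIMSEQ_le_const) auto
  moreover have "(\<Prod>p\<in>P M. r p) > 0"
    using r by (intro prod_pos) (auto simp: P_def)
  ultimately show ?thesis
    by simp
qed

theorem theorem1:
  fixes c :: "'n::finite \<Rightarrow> 'n \<Rightarrow> 'n \<Rightarrow> int"
  assumes "CARD('n) \<ge> 10"
    and "symmetric_coeffs c"
    and "davenport_geometric c"
  shows "summable (\<lambda>q. sing_abs_term c (q + 1))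
    \<and> (\<lambda>N. \<Prod>p\<in>{p. prime p \<and> p \<le> N}. padic_density c p) \<longlonglongrightarrow> singular_series c
    \<and> Im (singular_series c) = 0 \<and> Re (singular_series c) > 0"
proof -
  let ?g = "sing_abs_term c"
  note sum_p = sing_abs_term_primes(1) [OF assms]
  obtain B where B: "\<And>N. (\<Sum>p | prime p \<and> p \<le> N. \<Sum>k. ?g (p ^ Suc k)) \<le> B"
    using sing_abs_term_primes(2) [OF assms] by blast
  have summable: "summable (\<lambda>q. ?g (q + 1))"
    using sing_abs_term_1 sing_abs_term_nonneg sing_abs_term_mult sum_p B
    by (rule euler_product_summable)
  have norm_p: "summable (\<lambda>k. norm (sing_term c (p ^ k)))" if "prime p" for p
    by (rule summable_comparison_test' [OF sum_p [OF that], of 0]) (simp add: norm_sing_term_le)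
  have norm_all: "summable (\<lambda>q. norm (sing_term c (q + 1)))"
    by (rule summable_comparison_test' [OF summable, of 0]) (simp add: norm_sing_term_le del: Suc_eq_plus1 add_Suc_right)
  have limit: "(\<lambda>N. \<Prod>p\<in>{p. prime p \<and> p \<le> N}. padic_density c p) \<longlonglongrightarrow> singular_series c"
    unfolding padic_density_def singular_series_def
    using sing_term_1 sing_term_mult norm_p norm_all by (rule euler_product_limit)
  obtain v where v: "det (hm c v) \<noteq> 0"
    using exists_nonsingular [OF assms(3)] by blast
  have dens: "Im (padic_density c p) = 0" "Re (padic_density c p) > 0" if "prime p" for p
    using padic_density_pos [OF assms(1) that assms(2) v summable_norm_cancel [OF norm_p [OF that]]] by auto
  \<comment> \<open>All factors are real, so both the vanishing imaginary part and positivity can be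
    read off from a limit of real products.\<close>
  have real: "(\<Prod>p\<in>{p. prime p \<and> p \<le> N}. padic_density c p) = complex_of_real (\<Prod>p\<in>{p. prime p \<and> p \<le> N}. Re (padic_density c p))" for N
    unfolding of_real_prod using dens(1) by (intro prod.cong refl) (simp add: complex_eq_iff)
  have "(\<lambda>N. Im (\<Prod>p\<in>{p. prime p \<and> p \<le> N}. padic_density c p)) \<longlonglongrightarrow> Im (singular_series c)"
    by (rule tendsto_Im [OF limit])
  then have Im: "Im (singular_series c) = 0"
    unfolding real Im_complex_of_real by (simp add: LIMSEQ_const_iff)
  have "(\<lambda>N. Re (\<Prod>p\<in>{p. prime p \<and> p \<le> N}. padic_density c p)) \<longlonglongrightarrow> Re (singular_series c)"
    by (rule tendsto_Re [OF limit])
  then have Re_lim: "(\<lambda>N. \<Prod>p\<in>{p. prime p \<and> p \<le> N}. Re (padic_density c p)) \<longlonglongrightarrow> Re (singular_series c)"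
    unfolding real Re_complex_of_real .
  have "Re (singular_series c) > 0"
  \<comment> \<open>Here \<open>t p\<close> is the absolute local series without its term at
    \<open>k = 0\<close>, which equals 1; hence the density is at least \<open>1 - t p\<close>, and
    the sums of \<open>t p\<close> are bounded by \<open>B\<close>.\<close>
  proof (rule prime_product_limit_pos [OF dens(2) _ _ B Re_lim])
    fix p :: nat assume p: "prime p"
    have sm: "summable (\<lambda>k. ?g (p ^ Suc k))"
      using sum_p [OF p] summable_Suc_iff [of "\<lambda>k. ?g (p ^ k)"] by simp
    then show "0 \<le> (\<Sum>k. ?g (p ^ Suc k))"
      by (rule suminf_nonneg) (rule sing_abs_term_nonneg)
    have "padic_density c p = sing_term c (p ^ 0) + (\<Sum>k. sing_term c (p ^ Suc k))"
      unfolding padic_density_def using suminf_split_head [OF summable_norm_cancel [OF norm_p [OF p]]] by simp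
    then have "1 - Re (padic_density c p) = - Re (\<Sum>k. sing_term c (p ^ Suc k))"
      by (simp add: sing_term_1 del: One_nat_def)
    also have "\<dots> \<le> norm (\<Sum>k. sing_term c (p ^ Suc k))"
      using abs_Re_le_cmod [of "\<Sum>k. sing_term c (p ^ Suc k)"] by linarith
    also have "\<dots> \<le> (\<Sum>k. ?g (p ^ Suc k))"
      by (rule norm_suminf_le [OF norm_sing_term_le sm])
    finally show "1 - (\<Sum>k. ?g (p ^ Suc k)) \<le> Re (padic_density c p)"
      by linarith
  qed
  then show ?thesis
    using summable limit Im by blast
qed

end
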